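(* Let $X=(X_t,\,t\in[0,1])$ be an extremal exchangeable increment process with deterministic parameters $(\alpha,\sigma,\beta)$ which is of infinite variation, i.e. either $\sigma>0$ or $\sum_i|\beta_i|=\infty$. Then, for any fixed $t\in[0,1]$, almost surely $$\limsup_{h\to 0}\frac{X_{t+h}-X_t}{h}=\infty\quad\text{and}\quad \liminf_{h\to 0}\frac{X_{t+h}-X_t}{h}=-\infty,$$ and both statements hold for the one-sided limits from the right ($h\to 0+$, when $t<1$) and for the one-sided limits from the left ($h\to0-$, when $t>0$).
   Context: A càdlàg real-valued process $X=(X_t,\,t\in[0,1])$ has exchangeable increments (is an EI process) if for every $n\ge 1$ the random variables $X_{1/n},X_{2/n}-X_{1/n},\ldots,X_1-X_{(n-1)/n}$ are exchangeable. By Kallenberg's representation, an extremal EI process with deterministic parameters $(\alpha,\sigma,\beta)$, where $\alpha\in\mathbb{R}$, $\sigma\ge 0$ and $\beta=(\beta_i)_{i\ge 1}$ is a real sequence with $\sum_i\beta_i^2<\infty$, is $$X_t=\alpha t+\sigma b_t+\sum_{i\ge 1}\beta_i\left[\mathbf{1}_{\{U_i\le t\}}-t\right],\qquad t\in[0,1],$$ where $(U_i)_{i\ge1}$ are i.i.d. uniform random variables on $(0,1)$ and $b$ is an independent standard Brownian bridge on $[0,1]$ (from $0$ to $0$). The sample paths are of infinite variation if and only if $\sigma>0$ or $\sum_i|\beta_i|=\infty$. *)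

theory Defs
  imports "HOL-Probability.Probability"
begin

definition cadlag_on_unit :: "(real \<Rightarrow> real) \<Rightarrow> bool" where
  "cadlag_on_unit f \<longleftrightarrow>
     (\<forall>t\<in>{0..<1}. continuous (at_right t) f) \<and>
     (\<forall>t\<in>{0<..1}. \<exists>l. (f \<longlongrightarrow> l) (at_left t))"

text \<open>The normal law with mean \<open>m\<close> and standard deviation \<open>s \<ge> 0\<close>, where \<open>s = 0\<close> gives the
  point mass at \<open>m\<close> (the density \<^const>\<open>normal_density\<close> only makes sense for \<open>s > 0\<close>).\<close>

definition normal_law :: "real \<Rightarrow> real \<Rightarrow> real measure" where
  "normal_law m s = (if s = 0 then return borel m else density lborel (normal_density m s))"

definition gaussian_process :: "'a measure \<Rightarrow> real set \<Rightarrow> (real \<Rightarrow> 'a \<Rightarrow> real) \<Rightarrow> bool" where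
  "gaussian_process M I Y \<longleftrightarrow>
     (\<forall>t\<in>I. Y t \<in> borel_measurable M) \<and>
     (\<forall>T c. finite T \<and> T \<subseteq> I \<longrightarrow>
        (\<exists>m s. 0 \<le> s \<and> distr M borel (\<lambda>\<omega>. \<Sum>t\<in>T. c t * Y t \<omega>) = normal_law m s))"

text \<open>The pinning \<open>b 0 = b 1 = 0\<close> (almost surely) is the vanishing of the variance at \<open>0\<close> and \<open>1\<close>.\<close>

definition brownian_bridge :: "'a measure \<Rightarrow> (real \<Rightarrow> 'a \<Rightarrow> real) \<Rightarrow> bool" where
  "brownian_bridge M b \<longleftrightarrow>
     gaussian_process M {0..1} b \<and>
     (\<forall>t\<in>{0..1}. (\<integral>\<omega>. b t \<omega> \<partial>M) = 0) \<and>
     (\<forall>s\<in>{0..1}. \<forall>t\<in>{0..1}. (\<integral>\<omega>. b s \<omega> * b t \<omega> \<partial>M) = min s t - s * t) \<and>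
     (AE \<omega> in M. continuous_on {0..1} (\<lambda>t. b t \<omega>))"

text \<open>Kallenberg's representation
  \<open>X t = \<alpha> t + \<sigma> b t + (\<Sum>i. \<beta> i * (1{U i \<le> t} - t))\<close> on the given probability space.
  When \<open>\<beta>\<close> is square summable but not absolutely summable, the series converges only
  conditionally, so it is read as the almost sure limit of its partial sums at each time \<open>t\<close>; as
  paths are cadlag, this determines \<open>X\<close> up to indistinguishability. Sequences are indexed
  from \<open>0\<close>. Independence of \<open>b\<close> and \<open>(U i)\<close> is that of the process and the sequence as a whole,
  not only of pairs of coordinates.\<close>

definition extremal_EI_process ::
  "'a measure \<Rightarrow> real \<Rightarrow> real \<Rightarrow> (nat \<Rightarrow> real) \<Rightarrow> (real \<Rightarrow> 'a \<Rightarrow> real) \<Rightarrow> bool" where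
  "extremal_EI_process M \<alpha> \<sigma> \<beta> X \<longleftrightarrow>
     prob_space M \<and> 0 \<le> \<sigma> \<and> summable (\<lambda>i. (\<beta> i)\<^sup>2) \<and>
     (\<forall>t\<in>{0..1}. X t \<in> borel_measurable M) \<and>
     (AE \<omega> in M. cadlag_on_unit (\<lambda>t. X t \<omega>)) \<and>
     (\<exists>U b.
        prob_space.indep_vars M (\<lambda>_. borel) U (UNIV :: nat set) \<and>
        (\<forall>i. distr M borel (U i) = uniform_measure lborel {0<..<1}) \<and>
        brownian_bridge M b \<and>
        prob_space.indep_var M
          (Pi\<^sub>M UNIV (\<lambda>_. borel)) (\<lambda>\<omega>. \<lambda>i\<in>UNIV. U i \<omega>)
          (Pi\<^sub>M {0..1} (\<lambda>_. borel)) (\<lambda>\<omega>. \<lambda>t\<in>{0..1}. b t \<omega>) \<and>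
        (\<forall>t\<in>{0..1}. AE \<omega> in M.
           (\<lambda>i. \<beta> i * (of_bool (U i \<omega> \<le> t) - t)) sums (X t \<omega> - \<alpha> * t - \<sigma> * b t \<omega>)))"

text \<open>The difference quotient is to be used with filters at \<open>0\<close> on which \<open>t + h \<in> {0..1}\<close>.\<close>

definition diff_quot :: "(real \<Rightarrow> real) \<Rightarrow> real \<Rightarrow> real \<Rightarrow> ereal" where
  "diff_quot f t h = ereal ((f (t + h) - f t) / h)"

end

theory Submission imports Defs
begin

text \<open>
  Fix \<open>t\<close> and look at the increments \<open>D h\<close> of \<open>X\<close> over intervals of length \<open>h\<close> that start at \<open>t\<close>
  (or end at \<open>t\<close>). Measured from \<open>t\<close>, the jump times \<open>U i\<close> become independent arrival times
  \<open>V i\<close> with \<open>P (V i \<le> h) = h\<close>, and \<open>D h = \<alpha> h + \<sigma> g h + Y h\<close>, where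
  \<open>Y h = (\<Sum>i. \<beta> i * (1{V i \<le> h} - h))\<close> and \<open>g\<close> is the increment of the bridge. It suffices that
  \<open>D h / h\<close> is almost surely unbounded above near \<open>0\<close> on either side of \<open>t\<close>: the lower limits
  follow for \<open>- D\<close>, which is of the same form.

  If \<open>\<sigma> > 0\<close>, the Gaussian part dominates: \<open>g h\<close> has size \<open>sqrt h\<close>, whereas \<open>E \<bar>Y h\<bar> = o (sqrt h)\<close>
  (\<open>limit_small_in_mean\<close>). Along \<open>h n = h0 / 4 ^ n\<close> the normalised variables
  \<open>\<xi> n = g (h n) / sqrt (h n)\<close> are so weakly correlated that \<open>E (\<xi> n; G) \<rightarrow> 0\<close> and
  \<open>E ((\<xi> n)\<^sup>2; G) \<rightarrow> P G\<close> for every event \<open>G\<close>. If \<open>D (h n) / h n\<close> were bounded above on \<open>G\<close>, the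
  positive part of \<open>\<xi> n\<close> would vanish on \<open>G\<close> in the mean, and then so would \<open>\<xi> n\<close>, which
  forces \<open>P G = 0\<close> (\<open>bridge_increments.unbounded_slope_AE\<close>).

  If \<open>\<sigma> = 0\<close>, all bounds are for finite partial sums, uniformly in the number of terms, and
  the events concern finitely many times only. Suppose first that all jumps are nonnegative and
  have infinite sum.

  \<^item> Downwards: the exponential moments of \<open>- Y h\<close> are explicit, and a second moment argument
    shows that \<open>Y h \<le> - K h\<close> has probability at least a universal constant for all small \<open>h\<close>
    (\<open>prob_Y_le_linear\<close>).

  \<^item> Upwards: such a bound can fail at fixed times. But \<open>Y h / h\<close> is a martingale as \<open>h\<close> decreases, it
    has mean \<open>0\<close>, and it moves upwards continuously, as the jumps now point downwards. Hence it is
    close to \<open>C\<close> at the passage over the level \<open>C\<close>, and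
    \<open>0 = E (Y h / h) \<le> C' + E (Y h / h; no passage before h)\<close>. By the downward estimate the last
    term would tend to \<open>- \<infinity>\<close> if the passage probability were too small
    (\<open>expectation_Y_hit_le\<close>, \<open>prob_hit_level\<close>).

  For jumps of both signs, the sums over positive and over negative jumps are independent, so the
  second one can be added at the passage time of the first one, where it is not too negative with
  a probability bounded below (\<open>prob_partial_sum_hit\<close>). This yields unbounded slopes with positive
  probability only, and Kolmogorov's zero-one law turns it into probability one, since finitely
  many jumps contribute nothing but a linear term near time \<open>0\<close> (\<open>sums_unbounded_slope_AE\<close>).\<close>

section \<open>Compensated sums of jumps\<close>

text \<open>
  The sum is a function of the vector of arrival times, not of the sample point: events are then
  predicates on finitely many coordinates, to which independence of blocks applies directly.\<close>

definition jump_sum :: "(nat \<Rightarrow> real) \<Rightarrow> nat set \<Rightarrow> real \<Rightarrow> (nat \<Rightarrow> real) \<Rightarrow> real" where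
  "jump_sum \<beta> I s v = (\<Sum>i\<in>I. \<beta> i * (of_bool (v i \<le> s) - s))"

text \<open>
  Arrival times measured from a fixed time. Their law is prescribed on \<open>{0..h0}\<close> only, so that
  jumps on the other side of the fixed time can be placed anywhere beyond \<open>h0\<close>. Positivity holds
  everywhere, not just almost surely, so that the event in the zero-one law is a genuine tail event.\<close>

locale uniform_arrivals = prob_space M for M :: "'a measure" +
  fixes V :: "nat \<Rightarrow> 'a \<Rightarrow> real" and h0 :: real
  assumes indep_V: "indep_vars (\<lambda>_. borel) V UNIV"
    and V_pos: "\<And>i \<omega>. 0 < V i \<omega>"
    and h0_pos: "0 < h0" and h0_le_1: "h0 \<le> 1"
    and prob_V_le: "\<And>i s. 0 \<le> s \<Longrightarrow> s \<le> h0 \<Longrightarrow> prob {\<omega> \<in> space M. V i \<omega> \<le> s} = s"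
begin

abbreviation Y :: "(nat \<Rightarrow> real) \<Rightarrow> nat set \<Rightarrow> real \<Rightarrow> 'a \<Rightarrow> real" where
  "Y \<beta> I s \<omega> \<equiv> jump_sum \<beta> I s (\<lambda>i. V i \<omega>)"

lemma measurable_V [measurable]: "V i \<in> borel_measurable M"
  using indep_V by (auto simp: indep_vars_def)

lemma measurable_Y [measurable]: "Y \<beta> I s \<in> borel_measurable M"
  unfolding jump_sum_def by measurable

lemma expectation_V_le:
  assumes "0 \<le> s" "s \<le> h0"
  shows "expectation (\<lambda>\<omega>. of_bool (V i \<omega> \<le> s)) = s"
proof -
  have "expectation (\<lambda>\<omega>. of_bool (V i \<omega> \<le> s)) = expectation (indicator {\<omega> \<in> space M. V i \<omega> \<le> s})"
    by (rule Bochner_Integration.integral_cong) (auto simp: indicator_def)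
  also have "\<dots> = s" using prob_V_le[OF assms] by simp
  finally show ?thesis .
qed

lemma integrable_bounded_function:
  fixes f :: "real \<Rightarrow> real"
  assumes [measurable]: "f \<in> borel_measurable borel" and "\<And>x. \<bar>f x\<bar> \<le> B"
  shows "integrable M (\<lambda>\<omega>. f (V i \<omega>))"
  by (rule integrable_const_bound[where B=B]) (use assms in auto)

lemma integrable_V_le: "integrable M (\<lambda>\<omega>. of_bool (V i \<omega> \<le> s) :: real)"
  by (rule integrable_bounded_function[where B=1]) auto

lemma abs_Y_le: "\<bar>Y \<beta> I s \<omega>\<bar> \<le> (\<Sum>i\<in>I. \<bar>\<beta> i\<bar> * (1 + \<bar>s\<bar>))"
  unfolding jump_sum_def
  by (rule order_trans[OF sum_abs], rule sum_mono) (auto simp: abs_mult intro!: mult_left_mono)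

lemma integrable_Y: "integrable M (Y \<beta> I s)"
  by (rule integrable_const_bound[where B="\<Sum>i\<in>I. \<bar>\<beta> i\<bar> * (1 + \<bar>s\<bar>)"]) (use abs_Y_le in auto)

lemma expectation_prod_pair:
  fixes f g :: "real \<Rightarrow> real"
  assumes [measurable]: "f \<in> borel_measurable borel" "g \<in> borel_measurable borel"
    and f: "\<And>x. \<bar>f x\<bar> \<le> B" and g: "\<And>x. \<bar>g x\<bar> \<le> C" and "i \<noteq> j"
  shows "expectation (\<lambda>\<omega>. f (V i \<omega>) * g (V j \<omega>)) =
    expectation (\<lambda>\<omega>. f (V i \<omega>)) * expectation (\<lambda>\<omega>. g (V j \<omega>))"
proof -
  let ?F = "\<lambda>k. if k = i then f else g"
  have ind: "indep_vars (\<lambda>_. borel) (\<lambda>k \<omega>. ?F k (V k \<omega>)) {i,j}"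
    by (rule indep_vars_compose2[OF indep_vars_subset[OF indep_V]]) auto
  have int: "integrable M (\<lambda>\<omega>. ?F k (V k \<omega>))" for k
    by (rule integrable_bounded_function[where B="max B C"])
       (use f g in \<open>auto simp: le_max_iff_disj\<close>)
  from indep_vars_lebesgue_integral[OF _ ind int]
  show ?thesis using \<open>i \<noteq> j\<close> by simp
qed

lemma second_moment_sum_centered:
  fixes f :: "nat \<Rightarrow> real \<Rightarrow> real"
  assumes I: "finite I" and [measurable]: "\<And>i. f i \<in> borel_measurable borel"
    and bd: "\<And>i x. \<bar>f i x\<bar> \<le> B i"
    and cent: "\<And>i. i \<in> I \<Longrightarrow> expectation (\<lambda>\<omega>. f i (V i \<omega>)) = 0"
  shows "expectation (\<lambda>\<omega>. (\<Sum>i\<in>I. f i (V i \<omega>))\<^sup>2) = (\<Sum>i\<in>I. expectation (\<lambda>\<omega>. (f i (V i \<omega>))\<^sup>2))"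
proof -
  have int: "integrable M (\<lambda>\<omega>. f i (V i \<omega>) * f j (V j \<omega>))" for i j
    by (rule integrable_const_bound[where B="B i * B j"])
       (auto simp: abs_mult intro!: mult_mono bd order_trans[OF abs_ge_zero bd])
  have "expectation (\<lambda>\<omega>. (\<Sum>i\<in>I. f i (V i \<omega>))\<^sup>2) =
      expectation (\<lambda>\<omega>. \<Sum>i\<in>I. \<Sum>j\<in>I. f i (V i \<omega>) * f j (V j \<omega>))"
    by (simp add: power2_eq_square sum_product)
  also have "\<dots> = (\<Sum>i\<in>I. \<Sum>j\<in>I. expectation (\<lambda>\<omega>. f i (V i \<omega>) * f j (V j \<omega>)))"
    using int by (simp add: Bochner_Integration.integral_sum)
  also have "\<dots> = (\<Sum>i\<in>I. \<Sum>j\<in>I. if i = j then expectation (\<lambda>\<omega>. (f i (V i \<omega>))\<^sup>2) else 0)"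
  proof (intro sum.cong refl)
    fix i j assume "i \<in> I" "j \<in> I"
    then show "expectation (\<lambda>\<omega>. f i (V i \<omega>) * f j (V j \<omega>)) =
      (if i = j then expectation (\<lambda>\<omega>. (f i (V i \<omega>))\<^sup>2) else 0)"
      using expectation_prod_pair[of "f i" "f j" "B i" "B j" i j] bd cent
      by (auto simp: power2_eq_square)
  qed
  also have "\<dots> = (\<Sum>i\<in>I. expectation (\<lambda>\<omega>. (f i (V i \<omega>))\<^sup>2))"
    using I by (simp add: sum.delta)
  finally show ?thesis .
qed

lemma second_moment_increment:
  assumes I: "finite I" and su: "0 \<le> s" "s \<le> u" "u \<le> h0"
  shows "expectation (\<lambda>\<omega>. (Y \<beta> I u \<omega> - Y \<beta> I s \<omega>)\<^sup>2) \<le> (u - s) * (\<Sum>i\<in>I. (\<beta> i)\<^sup>2)"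
proof -
  define f where "f i x = \<beta> i * (of_bool (x \<le> u) - of_bool (x \<le> s) - (u - s))" for i :: nat and x :: real
  have m[measurable]: "f i \<in> borel_measurable borel" for i unfolding f_def by measurable
  have bd: "\<bar>f i x\<bar> \<le> \<bar>\<beta> i\<bar> * (1 + \<bar>u - s\<bar>)" for i x
    unfolding f_def abs_mult using su by (intro mult_left_mono) (auto simp: abs_real_def)
  have d: "Y \<beta> I u \<omega> - Y \<beta> I s \<omega> = (\<Sum>i\<in>I. f i (V i \<omega>))" for \<omega>
    unfolding jump_sum_def f_def sum_subtractf[symmetric]
    by (rule sum.cong) (auto simp: algebra_simps)
  have cent: "expectation (\<lambda>\<omega>. f i (V i \<omega>)) = 0" for i
    unfolding f_def using expectation_V_le[of u i] expectation_V_le[of s i] su integrable_V_le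
    by (simp add: prob_space)
  have sq: "expectation (\<lambda>\<omega>. (f i (V i \<omega>))\<^sup>2) \<le> (u - s) * (\<beta> i)\<^sup>2" for i
  proof -
    have "(f i x)\<^sup>2 = (\<beta> i)\<^sup>2 * ((1 - 2 * (u - s)) * (of_bool (x \<le> u) - of_bool (x \<le> s)) + (u - s)\<^sup>2)" for x
      using su by (auto simp: f_def power_mult_distrib power2_eq_square algebra_simps)
    then have "expectation (\<lambda>\<omega>. (f i (V i \<omega>))\<^sup>2) =
        (\<beta> i)\<^sup>2 * ((1 - 2 * (u - s)) * (u - s) + (u - s)\<^sup>2)"
      using expectation_V_le[of u i] expectation_V_le[of s i] su integrable_V_le
      by (simp add: prob_space)
    also have "\<dots> = (u - s) * (\<beta> i)\<^sup>2 - (\<beta> i)\<^sup>2 * (u - s)\<^sup>2"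
      by (simp add: power2_eq_square algebra_simps)
    also have "\<dots> \<le> (u - s) * (\<beta> i)\<^sup>2" by simp
    finally show ?thesis .
  qed
  show ?thesis
    unfolding d second_moment_sum_centered[OF I m bd cent]
    using sum_mono[of I, OF sq] by (simp add: sum_distrib_left)
qed

lemma Y_0: "Y \<beta> I 0 \<omega> = 0"
  using V_pos by (auto simp: jump_sum_def not_le[symmetric] intro!: sum.neutral)

lemma second_moment_Y:
  assumes "finite I" "0 \<le> s" "s \<le> h0"
  shows "expectation (\<lambda>\<omega>. (Y \<beta> I s \<omega>)\<^sup>2) \<le> s * (\<Sum>i\<in>I. (\<beta> i)\<^sup>2)"
  using second_moment_increment[of I 0 s \<beta>] assms by (simp add: Y_0)

lemma expectation_Y:
  assumes "0 \<le> s" "s \<le> h0"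
  shows "expectation (Y \<beta> I s) = 0"
proof -
  have "expectation (Y \<beta> I s) = (\<Sum>i\<in>I. expectation (\<lambda>\<omega>. \<beta> i * (of_bool (V i \<omega> \<le> s) - s)))"
    unfolding jump_sum_def by (rule Bochner_Integration.integral_sum) (use integrable_V_le in auto)
  also have "\<dots> = 0"
    using expectation_V_le[OF assms] integrable_V_le by (simp add: prob_space)
  finally show ?thesis .
qed

end

section \<open>Large negative slopes of sums with nonnegative jumps\<close>

text \<open>
  The function vanishes at \<open>0\<close> and has derivative \<open>2 * (1 - exp (-x))\<^sup>2\<close>. It equals both
  \<open>4 * psi x - psi (2 * x)\<close> and \<open>2 * psi x - (1 - exp (-x))\<^sup>2\<close> for the function \<open>psi\<close> below.\<close>

lemma psi_doubling_gap_nonneg: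
  fixes x :: real
  assumes "0 \<le> x"
  shows "0 \<le> 4 * exp (-x) - exp (-2 * x) - 3 + 2 * x"
proof -
  have "(\<lambda>x. 4 * exp (-x) - exp (-2 * x) - 3 + 2 * x) 0 \<le> (\<lambda>x::real. 4 * exp (-x) - exp (-2 * x) - 3 + 2 * x) x"
  proof (rule DERIV_nonneg_imp_nondecreasing[OF assms])
    fix z :: real
    have "((\<lambda>x. 4 * exp (-x) - exp (-2 * x) - 3 + 2 * x) has_real_derivative 2 * (1 - exp (-z))\<^sup>2) (at z)"
      by (auto intro!: derivative_eq_intros simp: power2_eq_square algebra_simps exp_add[symmetric])
    then show "\<exists>y. ((\<lambda>x. 4 * exp (-x) - exp (-2 * x) - 3 + 2 * x) has_real_derivative y) (at z) \<and> 0 \<le> y"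
      by (intro exI conjI) auto
  qed
  then show ?thesis by simp
qed

text \<open>
  The Laplace exponent of a compensated Poisson process with unit jumps.\<close>

definition psi :: "real \<Rightarrow> real" where "psi x = exp (-x) - 1 + x"

lemma psi_nonneg: "0 \<le> psi x"
  using exp_ge_add_one_self[of "-x"] by (simp add: psi_def)

lemma psi_ge: "x - 1 \<le> psi x"
  by (simp add: psi_def)

lemma psi_double_le: "0 \<le> x \<Longrightarrow> psi (2 * x) \<le> 4 * psi x"
  using psi_doubling_gap_nonneg[of x] by (simp add: psi_def)

lemma square_one_minus_exp_le: "0 \<le> x \<Longrightarrow> (1 - exp (-x))\<^sup>2 \<le> 2 * psi x"
  using psi_doubling_gap_nonneg[of x]
  by (simp add: psi_def power2_eq_square algebra_simps exp_add[symmetric])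

text \<open>
  The part of the mean below \<open>E W / 2\<close> contributes at most half of it; on the rest, \<open>W\<close> is bounded by
  \<open>(a * W\<^sup>2 + 1 / a) / 2\<close>. The weight \<open>a\<close> in the proof maximises the resulting bound.\<close>

lemma (in prob_space) paley_zygmund_half:
  assumes [measurable]: "W \<in> borel_measurable M"
    and int: "integrable M W" "integrable M (\<lambda>\<omega>. (W \<omega>)\<^sup>2)"
    and pos: "0 < expectation W"
  shows "(expectation W)\<^sup>2 / (4 * expectation (\<lambda>\<omega>. (W \<omega>)\<^sup>2))
    \<le> prob {\<omega> \<in> space M. expectation W / 2 \<le> W \<omega>}"
proof -
  define m where "m = expectation W"
  define q where "q = expectation (\<lambda>\<omega>. (W \<omega>)\<^sup>2)"
  define B where "B = {\<omega> \<in> space M. m / 2 \<le> W \<omega>}"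
  have [measurable]: "B \<in> events" unfolding B_def by measurable
  have iB: "integrable M (indicator B :: 'a \<Rightarrow> real)"
    by (rule integrable_real_indicator) (auto simp: emeasure_eq_measure)
  have "m\<^sup>2 \<le> q"
    using variance_eq[OF int] variance_positive[of W] by (simp add: m_def q_def)
  then have q: "0 < q" using pos by (simp add: m_def) (smt (verit) zero_less_power)
  define a where "a = m / (2 * q)"
  have a: "0 < a" using pos q by (simp add: a_def m_def)
  have "m \<le> expectation (\<lambda>\<omega>. m / 2 + (a * (W \<omega>)\<^sup>2 + indicator B \<omega> / a) / 2)"
    unfolding m_def
  proof (rule integral_mono)
    fix \<omega> assume "\<omega> \<in> space M"
    have "0 \<le> (a * W \<omega> - 1)\<^sup>2 / a" using a by simp
    also have "\<dots> = a * (W \<omega>)\<^sup>2 + 1 / a - 2 * W \<omega>"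
      using a by (simp add: power2_eq_square field_simps)
    finally have "W \<omega> \<le> (a * (W \<omega>)\<^sup>2 + 1 / a) / 2" by simp
    then show "W \<omega> \<le> expectation W / 2 + (a * (W \<omega>)\<^sup>2 + indicator B \<omega> / a) / 2"
      using a pos \<open>\<omega> \<in> space M\<close>
      by (cases "\<omega> \<in> B") (auto simp: B_def m_def intro: add_increasing add_increasing2)
  next
    show "integrable M (\<lambda>\<omega>. expectation W / 2 + (a * (W \<omega>)\<^sup>2 + indicator B \<omega> / a) / 2)"
      by (intro Bochner_Integration.integrable_add integrable_divide integrable_mult_right int iB) auto
  qed (rule int)
  also have "\<dots> = m / 2 + (a * q + prob B / a) / 2"
    using int iB by (simp add: prob_space q_def)
  finally have "a * m - a\<^sup>2 * q \<le> prob B"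
    using a by (simp add: field_simps power2_eq_square)
  moreover have "a * m - a\<^sup>2 * q = m\<^sup>2 / (4 * q)"
    using q by (simp add: a_def power2_eq_square field_simps)
  ultimately show ?thesis by (simp add: B_def m_def q_def)
qed

context uniform_arrivals
begin

lemma expectation_exp_Y:
  assumes I: "finite I" and h: "0 \<le> h" "h \<le> h0"
  shows "expectation (\<lambda>\<omega>. exp (- l * Y \<beta> I h \<omega>)) =
      (\<Prod>i\<in>I. exp (h * (l * \<beta> i)) * (1 - h * (1 - exp (- (l * \<beta> i)))))"
    and "integrable M (\<lambda>\<omega>. exp (- l * Y \<beta> I h \<omega>))"
proof -
  define f where "f i x = exp (- l * (\<beta> i * (of_bool (x \<le> h) - h)))" for i :: nat and x :: real
  have m[measurable]: "f i \<in> borel_measurable borel" for i unfolding f_def by measurable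
  have f_eq: "f i x = exp (h * (l * \<beta> i)) * (1 - of_bool (x \<le> h) * (1 - exp (- (l * \<beta> i))))" for i x
    by (auto simp: f_def exp_add[symmetric] algebra_simps)
  have bd: "\<bar>f i x\<bar> \<le> exp (h * (l * \<beta> i)) * (1 + \<bar>1 - exp (- (l * \<beta> i))\<bar>)" for i x
    unfolding f_eq abs_mult by (intro mult_mono) auto
  have e: "expectation (\<lambda>\<omega>. f i (V i \<omega>)) = exp (h * (l * \<beta> i)) * (1 - h * (1 - exp (- (l * \<beta> i))))" for i
    unfolding f_eq using expectation_V_le[OF h] integrable_V_le by (simp add: prob_space)
  have d: "exp (- l * Y \<beta> I h \<omega>) = (\<Prod>i\<in>I. f i (V i \<omega>))" for \<omega>
    unfolding jump_sum_def f_def exp_sum[OF I, symmetric] by (simp add: sum_distrib_left)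
  have ind: "indep_vars (\<lambda>_. borel) (\<lambda>i \<omega>. f i (V i \<omega>)) I"
    by (rule indep_vars_compose2[OF indep_vars_subset[OF indep_V]]) auto
  have int: "integrable M (\<lambda>\<omega>. f i (V i \<omega>))" for i
    by (rule integrable_bounded_function[OF _ bd]) simp
  show "expectation (\<lambda>\<omega>. exp (- l * Y \<beta> I h \<omega>)) =
      (\<Prod>i\<in>I. exp (h * (l * \<beta> i)) * (1 - h * (1 - exp (- (l * \<beta> i)))))"
    unfolding d indep_vars_lebesgue_integral[OF I ind int] e ..
  show "integrable M (\<lambda>\<omega>. exp (- l * Y \<beta> I h \<omega>))"
    unfolding d by (rule indep_vars_integrable[OF I ind int])
qed

text \<open>
  The variable \<open>W = exp (- l * Y)\<close> has mean about \<open>exp (h * (\<Sum>i. psi (l * \<beta> i)))\<close> and second moment at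
  most \<open>exp (h * (\<Sum>i. psi (2 * l * \<beta> i)))\<close>, whose exponent is at most four times as large. With \<open>l\<close> tuned so
  that the first exponent is \<open>4\<close>, the second moment is comparable to the squared mean, and \<open>W\<close>
  is of the order of its mean with a probability bounded below by a universal constant.\<close>

lemma prob_Y_le_Laplace:
  assumes I: "finite I" and \<beta>: "\<And>i. i \<in> I \<Longrightarrow> 0 \<le> \<beta> i"
    and h: "0 < h" "h \<le> h0" "h \<le> 1/16" and l: "0 < l"
    and four: "h * (\<Sum>i\<in>I. psi (l * \<beta> i)) = 4"
  shows "exp (-10) / 4 \<le> prob {\<omega> \<in> space M. Y \<beta> I h \<omega> \<le> - (2 / l)}"
proof -
  define W where "W \<omega> = exp (- l * Y \<beta> I h \<omega>)" for \<omega>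
  have W2: "(W \<omega>)\<^sup>2 = exp (- (2 * l) * Y \<beta> I h \<omega>)" for \<omega>
    by (simp add: W_def power2_eq_square exp_add[symmetric])
  have [measurable]: "W \<in> borel_measurable M" unfolding W_def by measurable
  have intW: "integrable M W" unfolding W_def using expectation_exp_Y(2)[OF I, of h] h by simp
  have intW2: "integrable M (\<lambda>\<omega>. (W \<omega>)\<^sup>2)"
    unfolding W2 using expectation_exp_Y(2)[OF I, of h "2 * l"] h by simp
  define q where "q i = 1 - exp (- (l * \<beta> i))" for i
  have q: "0 \<le> q i" "q i \<le> 1" if "i \<in> I" for i
    using \<beta>[OF that] l by (auto simp: q_def)
  \<comment> \<open>the restriction \<open>h \<le> 1/16\<close> keeps the quadratic error below \<open>1\<close>, a quarter of the exponent \<open>4\<close>\<close>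
  have "exp 3 \<le> exp (h * (\<Sum>i\<in>I. psi (l * \<beta> i)) - 4 * h\<^sup>2 * (\<Sum>i\<in>I. psi (l * \<beta> i)))"
  proof -
    have "4 * h\<^sup>2 * (\<Sum>i\<in>I. psi (l * \<beta> i)) = 4 * h * (h * (\<Sum>i\<in>I. psi (l * \<beta> i)))"
      by (simp add: power2_eq_square)
    then show ?thesis using h unfolding four by simp
  qed
  also have "\<dots> \<le> exp (\<Sum>i\<in>I. h * (l * \<beta> i) - h * q i - 2 * (h * q i)\<^sup>2)"
  proof -
    have "h * psi (l * \<beta> i) - 4 * h\<^sup>2 * psi (l * \<beta> i) \<le> h * (l * \<beta> i) - h * q i - 2 * (h * q i)\<^sup>2"
      if "i \<in> I" for i
    proof -
      have "h\<^sup>2 * (q i)\<^sup>2 \<le> h\<^sup>2 * (2 * psi (l * \<beta> i))"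
        using square_one_minus_exp_le[of "l * \<beta> i"] \<beta>[OF that] l
        by (intro mult_left_mono) (auto simp: q_def)
      moreover have "h * psi (l * \<beta> i) = h * (l * \<beta> i) - h * q i"
        by (simp add: psi_def q_def algebra_simps)
      ultimately show ?thesis by (simp add: power_mult_distrib mult_ac)
    qed
    then show ?thesis
      by (auto simp: sum_distrib_left sum_subtractf[symmetric] intro!: sum_mono)
  qed
  also have "\<dots> \<le> (\<Prod>i\<in>I. exp (h * (l * \<beta> i)) * (1 - h * q i))"
    unfolding exp_sum[OF I]
  proof (rule prod_mono)
    fix i assume i: "i \<in> I"
    have hq: "0 \<le> h * q i" "h * q i \<le> 1 / 2"
      using q[OF i] h mult_mono[of h "1/2" "q i" 1] by auto
    have "exp (- (h * q i) - 2 * (h * q i)\<^sup>2) \<le> 1 - h * q i"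
    proof -
      have "exp (- (h * q i) - 2 * (h * q i)\<^sup>2) \<le> exp (ln (1 - h * q i))"
        using ln_one_minus_pos_lower_bound[OF hq] by simp
      also have "\<dots> = 1 - h * q i" using hq by (intro exp_ln) linarith
      finally show ?thesis .
    qed
    then show "0 \<le> exp (h * (l * \<beta> i) - h * q i - 2 * (h * q i)\<^sup>2) \<and>
        exp (h * (l * \<beta> i) - h * q i - 2 * (h * q i)\<^sup>2) \<le> exp (h * (l * \<beta> i)) * (1 - h * q i)"
      by (auto simp: exp_add[symmetric] exp_diff divide_inverse exp_minus)
  qed
  also have "\<dots> = expectation W"
    unfolding W_def q_def using expectation_exp_Y(1)[OF I, of h l] h by simp
  finally have EW: "exp 3 \<le> expectation W" .
  have "expectation (\<lambda>\<omega>. (W \<omega>)\<^sup>2) =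
      (\<Prod>i\<in>I. exp (h * (2 * l * \<beta> i)) * (1 - h * (1 - exp (- (2 * l * \<beta> i)))))"
    unfolding W2 using expectation_exp_Y(1)[OF I, of h "2 * l"] h by simp
  also have "\<dots> \<le> (\<Prod>i\<in>I. exp (4 * (h * psi (l * \<beta> i))))"
  proof (rule prod_mono)
    fix i assume i: "i \<in> I"
    define x where "x = l * \<beta> i"
    have x: "0 \<le> x" using \<beta>[OF i] l by (simp add: x_def)
    have "h * (1 - exp (- (2 * x))) \<le> 1 * 1" using h h0_le_1 x by (intro mult_mono) auto
    moreover have "exp (h * (2 * x)) * (1 - h * (1 - exp (- (2 * x)))) \<le>
        exp (h * (2 * x)) * exp (- (h * (1 - exp (- (2 * x)))))"
      using exp_ge_add_one_self[of "- (h * (1 - exp (- (2 * x))))"] by (intro mult_left_mono) auto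
    moreover have "\<dots> = exp (h * psi (2 * x))"
      by (simp add: exp_add[symmetric] psi_def algebra_simps)
    moreover have "\<dots> \<le> exp (4 * (h * psi x))"
      using psi_double_le[OF x] h by (simp add: mult_left_mono)
    ultimately have "0 \<le> exp (h * (2 * x)) * (1 - h * (1 - exp (- (2 * x)))) \<and>
        exp (h * (2 * x)) * (1 - h * (1 - exp (- (2 * x)))) \<le> exp (4 * (h * psi x))"
      by (intro conjI mult_nonneg_nonneg order_trans[OF _ \<open>exp (h * psi (2 * x)) \<le> _\<close>]) auto
    then show "0 \<le> exp (h * (2 * l * \<beta> i)) * (1 - h * (1 - exp (- (2 * l * \<beta> i)))) \<and>
        exp (h * (2 * l * \<beta> i)) * (1 - h * (1 - exp (- (2 * l * \<beta> i)))) \<le> exp (4 * (h * psi (l * \<beta> i)))"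
      by (simp add: x_def mult.assoc)
  qed
  also have "\<dots> = exp 16"
    unfolding exp_sum[OF I, symmetric] sum_distrib_left[symmetric] four by simp
  finally have EW2: "expectation (\<lambda>\<omega>. (W \<omega>)\<^sup>2) \<le> exp 16" .
  have pos: "0 < expectation W" using EW by (rule less_le_trans[rotated]) simp
  have pos2: "0 < expectation (\<lambda>\<omega>. (W \<omega>)\<^sup>2)"
  proof -
    have "(expectation W)\<^sup>2 \<le> expectation (\<lambda>\<omega>. (W \<omega>)\<^sup>2)"
      using variance_eq[OF intW intW2] variance_positive[of W] by simp
    then show ?thesis using pos by (smt (verit) zero_less_power)
  qed
  have "exp (-10) / 4 = (exp 3)\<^sup>2 / (4 * exp (16::real))"
    by (simp add: power2_eq_square exp_add[symmetric] exp_diff[symmetric] exp_minus[symmetric] field_simps)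
  also have "\<dots> \<le> (expectation W)\<^sup>2 / (4 * expectation (\<lambda>\<omega>. (W \<omega>)\<^sup>2))"
    using EW EW2 pos pos2 by (intro frac_le power_mono) auto
  also have "\<dots> \<le> prob {\<omega> \<in> space M. expectation W / 2 \<le> W \<omega>}"
    by (rule paley_zygmund_half[OF _ intW intW2 pos]) simp
  also have "\<dots> \<le> prob {\<omega> \<in> space M. Y \<beta> I h \<omega> \<le> - (2 / l)}"
  proof (rule finite_measure_mono)
    show "{\<omega> \<in> space M. expectation W / 2 \<le> W \<omega>} \<subseteq> {\<omega> \<in> space M. Y \<beta> I h \<omega> \<le> - (2 / l)}"
    proof safe
      fix \<omega> assume *: "expectation W / 2 \<le> W \<omega>"
      have "exp 3 = exp 1 * exp (2::real)" by (simp add: exp_add[symmetric])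
      then have "exp 2 \<le> exp 3 / (2::real)"
        using exp_ge_add_one_self[of 1] by (simp add: mult_right_mono)
      also have "\<dots> \<le> W \<omega>" using EW * by simp
      finally have "2 \<le> - l * Y \<beta> I h \<omega>" by (simp add: W_def)
      then show "Y \<beta> I h \<omega> \<le> - (2 / l)" using l by (simp add: field_simps)
    qed
  qed simp
  finally show ?thesis .
qed

text \<open>
  Since \<open>psi x\<close> grows linearly, \<open>h * (\<Sum>i. psi (l * \<beta> i))\<close> reaches \<open>4\<close> at \<open>l = 2 / (K * h)\<close> once enough
  of the jumps are summed; hence the value \<open>4\<close> is taken at some \<open>l\<close> up to this point.\<close>

lemma prob_Y_le_linear:
  assumes I: "finite I" and \<beta>: "\<And>i. i \<in> I \<Longrightarrow> 0 \<le> \<beta> i"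
    and h: "0 < h" "h \<le> h0" "h \<le> 1/16" and K: "0 < K"
    and F: "F \<subseteq> I" "2 * K + 1 \<le> (\<Sum>i\<in>F. \<beta> i)" "h * K * card F \<le> 2"
  shows "exp (-10) / 4 \<le> prob {\<omega> \<in> space M. Y \<beta> I h \<omega> \<le> - K * h}"
proof -
  \<comment> \<open>chosen so that \<open>2 / L = K * h\<close> is the bound to be reached\<close>
  define L where "L = 2 / (K * h)"
  have L: "0 < L" using K h by (simp add: L_def)
  define g where "g l = h * (\<Sum>i\<in>I. psi (l * \<beta> i))" for l
  have cardF: "card F \<le> L"
    using F(3) K h by (simp add: L_def field_simps)
  have "4 / h = 2 * K * L" using K h by (simp add: L_def field_simps)
  also have "\<dots> \<le> L * (2 * K + 1) - card F" using cardF by (simp add: algebra_simps)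
  also have "\<dots> \<le> L * (\<Sum>i\<in>F. \<beta> i) - card F" using F(2) L by (simp add: mult_left_mono)
  also have "\<dots> = (\<Sum>i\<in>F. L * \<beta> i - 1)" by (simp add: sum_subtractf sum_distrib_left)
  also have "\<dots> \<le> (\<Sum>i\<in>F. psi (L * \<beta> i))" by (intro sum_mono psi_ge)
  also have "\<dots> \<le> (\<Sum>i\<in>I. psi (L * \<beta> i))" using F(1) I psi_nonneg by (intro sum_mono2) auto
  finally have "4 \<le> g L" using h by (simp add: g_def field_simps)
  moreover have cont: "continuous_on {0..L} g"
    unfolding g_def psi_def by (intro continuous_intros)
  moreover have "g 0 = 0" by (simp add: g_def psi_def)
  ultimately obtain l where l: "0 \<le> l" "l \<le> L" "g l = 4"
    using IVT'[of g 0 4 L, OF _ _ _ cont] L by auto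
  then have "0 < l" using \<open>g 0 = 0\<close> by (cases "l = 0") auto
  have "exp (-10) / 4 \<le> prob {\<omega> \<in> space M. Y \<beta> I h \<omega> \<le> - (2 / l)}"
    using prob_Y_le_Laplace[OF I \<beta> h \<open>0 < l\<close>] l by (simp add: g_def)
  also have "\<dots> \<le> prob {\<omega> \<in> space M. Y \<beta> I h \<omega> \<le> - K * h}"
  proof (rule finite_measure_mono)
    have "K * h = 2 / L" using K h by (simp add: L_def)
    also have "\<dots> \<le> 2 / l" using l \<open>0 < l\<close> by (intro divide_left_mono) auto
    finally show "{\<omega> \<in> space M. Y \<beta> I h \<omega> \<le> - (2 / l)} \<subseteq> {\<omega> \<in> space M. Y \<beta> I h \<omega> \<le> - K * h}"
      by auto
  qed simp
  finally show ?thesis .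
qed

end

section \<open>First passage of the slope\<close>

lemma measurable_jump_sum [measurable]:
  "jump_sum \<beta> I s \<in> borel_measurable (Pi\<^sub>M I (\<lambda>_. borel))"
  unfolding jump_sum_def by measurable

context uniform_arrivals
begin

lemma prob_restrict_indep:
  assumes JK: "J \<inter> K = {}"
    and [measurable]: "Measurable.pred (Pi\<^sub>M J (\<lambda>_. borel)) p" "Measurable.pred (Pi\<^sub>M K (\<lambda>_. borel)) q"
  shows "prob {\<omega> \<in> space M. p (\<lambda>i\<in>J. V i \<omega>) \<and> q (\<lambda>i\<in>K. V i \<omega>)} =
    prob {\<omega> \<in> space M. p (\<lambda>i\<in>J. V i \<omega>)} * prob {\<omega> \<in> space M. q (\<lambda>i\<in>K. V i \<omega>)}"
proof -
  let ?J = "\<lambda>\<omega>. \<lambda>i\<in>J. V i \<omega>" and ?K = "\<lambda>\<omega>. \<lambda>i\<in>K. V i \<omega>"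
  have "indep_var (Pi\<^sub>M J (\<lambda>_. borel)) ?J (Pi\<^sub>M K (\<lambda>_. borel)) ?K"
    by (rule indep_var_restrict[OF indep_V JK]) auto
  from indep_varD[OF this, of "{v \<in> space (Pi\<^sub>M J (\<lambda>_. borel)). p v}" "{v \<in> space (Pi\<^sub>M K (\<lambda>_. borel)). q v}"]
  have "prob ((\<lambda>\<omega>. (?J \<omega>, ?K \<omega>)) -` ({v \<in> space (Pi\<^sub>M J (\<lambda>_. borel)). p v} \<times> {v \<in> space (Pi\<^sub>M K (\<lambda>_. borel)). q v}) \<inter> space M)
    = prob (?J -` {v \<in> space (Pi\<^sub>M J (\<lambda>_. borel)). p v} \<inter> space M) *
      prob (?K -` {v \<in> space (Pi\<^sub>M K (\<lambda>_. borel)). q v} \<inter> space M)"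
    by simp
  moreover have "(\<lambda>\<omega>. (?J \<omega>, ?K \<omega>)) -` ({v \<in> space (Pi\<^sub>M J (\<lambda>_. borel)). p v} \<times> {v \<in> space (Pi\<^sub>M K (\<lambda>_. borel)). q v}) \<inter> space M
      = {\<omega> \<in> space M. p (?J \<omega>) \<and> q (?K \<omega>)}"
    "?J -` {v \<in> space (Pi\<^sub>M J (\<lambda>_. borel)). p v} \<inter> space M = {\<omega> \<in> space M. p (?J \<omega>)}"
    "?K -` {v \<in> space (Pi\<^sub>M K (\<lambda>_. borel)). q v} \<inter> space M = {\<omega> \<in> space M. q (?K \<omega>)}"
    by (auto simp: space_PiM)
  ultimately show ?thesis by simp
qed

lemma jump_sum_restrict: "I \<subseteq> J \<Longrightarrow> jump_sum \<beta> I s (restrict v J) = jump_sum \<beta> I s v"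
  unfolding jump_sum_def by (rule sum.cong) (auto simp: subset_eq)

text \<open>
  An event that does not distinguish arrivals up to time \<open>s\<close> depends, on \<open>V i \<le> s\<close>, on the other
  arrivals only, hence is independent of the value of \<open>V i\<close> there.\<close>

lemma prob_arrival_and_past:
  assumes i: "i \<in> I" and u: "0 \<le> u" "u \<le> s" "s \<le> h0"
    and [measurable]: "Measurable.pred (Pi\<^sub>M I (\<lambda>_. borel)) a"
    and past: "\<And>v w. (\<And>j. j \<in> I \<Longrightarrow> v j = w j \<or> v j \<le> s \<and> w j \<le> s) \<Longrightarrow> a v = a w"
  shows "prob {\<omega> \<in> space M. V i \<omega> \<le> u \<and> a (\<lambda>j. V j \<omega>)} =
    u * prob {\<omega> \<in> space M. a ((\<lambda>j\<in>I - {i}. V j \<omega>)(i := s))}"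
proof -
  have "prob {\<omega> \<in> space M. V i \<omega> \<le> u \<and> a (\<lambda>j. V j \<omega>)} =
      prob {\<omega> \<in> space M. (\<lambda>j\<in>{i}. V j \<omega>) i \<le> u \<and> a ((\<lambda>j\<in>I - {i}. V j \<omega>)(i := s))}"
    using u by (intro arg_cong[where f=prob] Collect_cong conj_cong refl past) auto
  also have "\<dots> = prob {\<omega> \<in> space M. (\<lambda>j\<in>{i}. V j \<omega>) i \<le> u} *
      prob {\<omega> \<in> space M. a ((\<lambda>j\<in>I - {i}. V j \<omega>)(i := s))}"
  proof (rule prob_restrict_indep)
    have "(\<lambda>v. v(i := s)) \<in> Pi\<^sub>M (I - {i}) (\<lambda>_. borel) \<rightarrow>\<^sub>M Pi\<^sub>M I (\<lambda>_. borel)"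
      by (rule measurable_fun_upd[where J="I - {i}"]) (use i in auto)
    then show "Measurable.pred (Pi\<^sub>M (I - {i}) (\<lambda>_. borel)) (\<lambda>v. a (v(i := s)))"
      by measurable
    show "Measurable.pred (Pi\<^sub>M {i} (\<lambda>_. borel)) (\<lambda>v. v i \<le> u)" by measurable
  qed auto
  also have "prob {\<omega> \<in> space M. (\<lambda>j\<in>{i}. V j \<omega>) i \<le> u} = u"
    using prob_V_le[of u i] u by simp
  finally show ?thesis .
qed

lemma pred_V:
  assumes [measurable]: "Measurable.pred (Pi\<^sub>M I (\<lambda>_. borel)) a"
    and dep: "\<And>v. a (restrict v I) = a v"
  shows "Measurable.pred M (\<lambda>\<omega>. a (\<lambda>j. V j \<omega>))"
proof -
  have "(\<lambda>\<omega>. \<lambda>j\<in>I. V j \<omega>) \<in> M \<rightarrow>\<^sub>M Pi\<^sub>M I (\<lambda>_. borel)"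
    by (rule measurable_restrict) simp
  then have "Measurable.pred M (\<lambda>\<omega>. a (\<lambda>j\<in>I. V j \<omega>))" by measurable
  then show ?thesis unfolding dep .
qed

text \<open>
  The martingale property of \<open>Y h / h\<close> for decreasing \<open>h\<close>: the hypothesis \<open>past\<close> says that the event
  is determined by the path from time \<open>s\<close> on.\<close>

lemma reversed_martingale:
  assumes I: "finite I" and h: "0 < h" "h \<le> s" "s \<le> h0"
    and a: "Measurable.pred (Pi\<^sub>M I (\<lambda>_. borel)) a"
    and past: "\<And>v w. (\<And>j. j \<in> I \<Longrightarrow> v j = w j \<or> v j \<le> s \<and> w j \<le> s) \<Longrightarrow> a v = a w"
  shows "expectation (\<lambda>\<omega>. Y \<beta> I h \<omega> * of_bool (a (\<lambda>j. V j \<omega>))) =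
    h / s * expectation (\<lambda>\<omega>. Y \<beta> I s \<omega> * of_bool (a (\<lambda>j. V j \<omega>)))"
proof -
  have [measurable]: "Measurable.pred M (\<lambda>\<omega>. a (\<lambda>j. V j \<omega>))"
    by (rule pred_V[OF a]) (rule past, auto)
  let ?A = "\<lambda>\<omega>. of_bool (a (\<lambda>j. V j \<omega>)) :: real"
  have intA: "integrable M ?A"
    by (rule integrable_const_bound[where B=1]) auto
  have int: "integrable M (\<lambda>\<omega>. of_bool (V i \<omega> \<le> u \<and> a (\<lambda>j. V j \<omega>)) :: real)" for i u
    by (rule integrable_const_bound[where B=1]) auto
  have bool_prob: "expectation (\<lambda>\<omega>. of_bool (V i \<omega> \<le> u \<and> a (\<lambda>j. V j \<omega>))) =
      prob {\<omega> \<in> space M. V i \<omega> \<le> u \<and> a (\<lambda>j. V j \<omega>)}" for i u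
  proof -
    have "expectation (\<lambda>\<omega>. of_bool (V i \<omega> \<le> u \<and> a (\<lambda>j. V j \<omega>))) =
      expectation (indicator {\<omega> \<in> space M. V i \<omega> \<le> u \<and> a (\<lambda>j. V j \<omega>)})"
      by (rule Bochner_Integration.integral_cong) (auto simp: indicator_def)
    also have "\<dots> = prob {\<omega> \<in> space M. V i \<omega> \<le> u \<and> a (\<lambda>j. V j \<omega>)}" by simp
    finally show ?thesis .
  qed
  define p where "p i = prob {\<omega> \<in> space M. a ((\<lambda>j\<in>I - {i}. V j \<omega>)(i := s))}" for i
  have E: "expectation (\<lambda>\<omega>. Y \<beta> I u \<omega> * ?A \<omega>) = u * (\<Sum>i\<in>I. \<beta> i * (p i - expectation ?A))"
    if u: "0 \<le> u" "u \<le> s" for u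
  proof -
    have "Y \<beta> I u \<omega> * ?A \<omega> =
        (\<Sum>i\<in>I. \<beta> i * (of_bool (V i \<omega> \<le> u \<and> a (\<lambda>j. V j \<omega>)) - u * ?A \<omega>))" for \<omega>
      unfolding jump_sum_def sum_distrib_right by (rule sum.cong) auto
    then have "expectation (\<lambda>\<omega>. Y \<beta> I u \<omega> * ?A \<omega>) =
        expectation (\<lambda>\<omega>. \<Sum>i\<in>I. \<beta> i * (of_bool (V i \<omega> \<le> u \<and> a (\<lambda>j. V j \<omega>)) - u * ?A \<omega>))"
      by simp
    also have "\<dots> = (\<Sum>i\<in>I. \<beta> i * (prob {\<omega> \<in> space M. V i \<omega> \<le> u \<and> a (\<lambda>j. V j \<omega>)} - u * expectation ?A))"
      using int intA bool_prob by (subst Bochner_Integration.integral_sum) auto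
    also have "\<dots> = (\<Sum>i\<in>I. u * (\<beta> i * (p i - expectation ?A)))"
    proof (rule sum.cong[OF refl])
      fix i assume "i \<in> I"
      then show "\<beta> i * (prob {\<omega> \<in> space M. V i \<omega> \<le> u \<and> a (\<lambda>j. V j \<omega>)} - u * expectation ?A) =
          u * (\<beta> i * (p i - expectation ?A))"
        using prob_arrival_and_past[OF _ u h(3) a past, of i] by (simp add: p_def algebra_simps)
    qed
    finally show ?thesis by (simp add: sum_distrib_left)
  qed
  show ?thesis using E[of h] E[of s] h by simp
qed

text \<open>
  Stop the martingale at the largest grid time \<open>h + k * d\<close> at which \<open>Y\<close> exceeds slope \<open>C\<close>. At the
  next larger grid time it was below that slope, and by \<open>\<beta> \<ge> 0\<close> the first \<open>N\<close> jumps add at most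
  \<open>d * (\<Sum>i<N. \<beta> i)\<close> to \<open>Y\<close> when going down one grid step. The increments \<open>R k\<close> of the remaining
  jumps are controlled all at once by the sum of their second moments. The hypotheses on mesh and
  tail make both errors of order \<open>h\<close>; the last summand accounts for passage at the initial time
  \<open>\<delta>\<close>.\<close>

lemma expectation_Y_hit_le:
  assumes I: "finite I" and \<beta>: "\<And>i. i \<in> I \<Longrightarrow> 0 \<le> \<beta> i" and C: "0 \<le> C"
    and h: "0 < h" "h < \<delta>" "\<delta> \<le> h0" and m: "0 < (m::nat)"
    and d: "d = (\<delta> - h) / m"
    and mesh: "d * (C + (\<Sum>i\<in>I \<inter> {..<N}. \<beta> i)) \<le> h"
    and tail: "(\<Sum>i\<in>I - {..<N}. (\<beta> i)\<^sup>2) \<le> h\<^sup>2"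
  shows "expectation (\<lambda>\<omega>. Y \<beta> I h \<omega> * of_bool (\<exists>k\<le>m. C * (h + real k * d) < Y \<beta> I (h + real k * d) \<omega>))
    \<le> h * (C + 2 + (1 + (\<Sum>i\<in>I. (\<beta> i)\<^sup>2)) / \<delta>)"
proof -
  define s where "s k = h + real k * d" for k
  have d0: "0 < d" using h m by (simp add: d)
  have s: "0 < s k" "h \<le> s k" for k using h d0 by (auto simp: s_def intro!: add_pos_nonneg)
  have s_m: "s m = \<delta>" using m by (simp add: s_def d)
  have s_mono: "s k \<le> s l" if "k \<le> l" for k l
    using that d0 by (simp add: s_def mult_right_mono)
  have s_Suc: "s (Suc k) - s k = d" for k by (simp add: s_def algebra_simps)
  have s_le: "s k \<le> h0" if "k \<le> m" for k using s_mono[OF that] s_m h by simp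
  define a where "a k v \<longleftrightarrow> C * s k < jump_sum \<beta> I (s k) v \<and> (\<forall>l\<in>{k<..m}. jump_sum \<beta> I (s l) v \<le> C * s l)"
    for k v
  have a_meas: "Measurable.pred (Pi\<^sub>M I (\<lambda>_. borel)) (a k)" for k
    unfolding a_def by measurable
  have a_past: "a k v = a k w" if vw: "\<And>j. j \<in> I \<Longrightarrow> v j = w j \<or> v j \<le> s k \<and> w j \<le> s k" for k v w
  proof -
    have "jump_sum \<beta> I (s l) v = jump_sum \<beta> I (s l) w" if "k \<le> l" for l
      unfolding jump_sum_def
    proof (rule sum.cong[OF refl])
      fix j assume "j \<in> I"
      from vw[OF this] s_mono[OF that] show "\<beta> j * (of_bool (v j \<le> s l) - s l) = \<beta> j * (of_bool (w j \<le> s l) - s l)"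
        by auto
    qed
    then show ?thesis by (auto simp: a_def)
  qed
  define A where "A k \<omega> = (of_bool (a k (\<lambda>j. V j \<omega>)) :: real)" for k \<omega>
  have [measurable]: "Measurable.pred M (\<lambda>\<omega>. a k (\<lambda>j. V j \<omega>))" for k
    by (rule pred_V[OF a_meas]) (rule a_past, auto)
  have [measurable]: "A k \<in> borel_measurable M" for k unfolding A_def by measurable
  have A01: "0 \<le> A k \<omega>" "A k \<omega> \<le> 1" for k \<omega> by (auto simp: A_def)
  have intA: "integrable M (A k)" for k
    by (rule integrable_const_bound[where B=1]) (auto simp: A_def)
  have intYA: "integrable M (\<lambda>\<omega>. Y \<beta> I u \<omega> * A k \<omega>)" for u k
  proof (rule Bochner_Integration.integrable_bound[OF integrable_Y[of \<beta> I u]])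
    show "AE \<omega> in M. norm (Y \<beta> I u \<omega> * A k \<omega>) \<le> norm (Y \<beta> I u \<omega>)"
      using A01 by (auto simp: abs_mult intro!: mult_left_le)
  qed simp
  have disj: "\<not> (a k v \<and> a l v)" if "k < l" "l \<le> m" for k l v
    using that by (force simp: a_def)
  have sum_A: "(\<Sum>k\<le>m. A k \<omega>) = of_bool (\<exists>k\<le>m. C * s k < Y \<beta> I (s k) \<omega>)" for \<omega>
  proof (cases "\<exists>k\<le>m. C * s k < Y \<beta> I (s k) \<omega>")
    case True
    \<comment> \<open>the passage time is the largest grid time above the level\<close>
    define k where "k = Max {k. k \<le> m \<and> C * s k < Y \<beta> I (s k) \<omega>}"
    have fin: "finite {k. k \<le> m \<and> C * s k < Y \<beta> I (s k) \<omega>}" by simp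
    have k: "k \<le> m" "C * s k < Y \<beta> I (s k) \<omega>"
      using Max_in[OF fin] True by (auto simp: k_def)
    have "Y \<beta> I (s l) \<omega> \<le> C * s l" if "k < l" "l \<le> m" for l
      using Max_ge[OF fin, of l] that by (force simp: k_def[symmetric])
    then have ak: "a k (\<lambda>j. V j \<omega>)" using k by (auto simp: a_def)
    have "A l \<omega> = (if l = k then 1 else 0)" if "l \<le> m" for l
      using ak disj[of k l] disj[of l k] k that by (cases l k rule: linorder_cases) (auto simp: A_def)
    then have "(\<Sum>l\<le>m. A l \<omega>) = (\<Sum>l\<le>m. if l = k then 1 else 0)" by (intro sum.cong) auto
    then show ?thesis using True k by (simp add: sum.delta)
  next
    case False
    then show ?thesis by (auto simp: A_def a_def intro!: sum.neutral)
  qed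
  define R where "R k \<omega> = Y \<beta> (I - {..<N}) (s (Suc k)) \<omega> - Y \<beta> (I - {..<N}) (s k) \<omega>" for k \<omega>
  have [measurable]: "R k \<in> borel_measurable M" for k unfolding R_def by measurable
  have intR2: "integrable M (\<lambda>\<omega>. (R k \<omega>)\<^sup>2)" for k
  proof (rule integrable_const_bound)
    show "AE \<omega> in M. norm ((R k \<omega>)\<^sup>2) \<le> ((\<Sum>i\<in>I - {..<N}. \<bar>\<beta> i\<bar> * (1 + \<bar>s (Suc k)\<bar>)) + (\<Sum>i\<in>I - {..<N}. \<bar>\<beta> i\<bar> * (1 + \<bar>s k\<bar>)))\<^sup>2"
      unfolding R_def real_norm_def abs_power2
      using abs_Y_le by (intro AE_I2 abs_le_square_iff[THEN iffD1] order_trans[OF abs_triangle_ineq4] order_trans[OF _ abs_ge_self] add_mono) auto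
  qed simp
  have ER2: "expectation (\<lambda>\<omega>. (R k \<omega>)\<^sup>2) \<le> d * h\<^sup>2" if "k < m" for k
  proof -
    have "expectation (\<lambda>\<omega>. (R k \<omega>)\<^sup>2) \<le> (s (Suc k) - s k) * (\<Sum>i\<in>I - {..<N}. (\<beta> i)\<^sup>2)"
      unfolding R_def using I s[of k] s_mono[of k "Suc k"] s_le[of "Suc k"] that
      by (intro second_moment_increment) auto
    also have "\<dots> \<le> d * h\<^sup>2" using tail d0 by (simp add: s_Suc)
    finally show ?thesis .
  qed
  have overshoot: "h / s k * (Y \<beta> I (s k) \<omega> * A k \<omega>) \<le> h * (C + 3/2) * A k \<omega> + (R k \<omega>)\<^sup>2 / (2 * h)"
    if "k < m" for k \<omega>
  proof (cases "a k (\<lambda>j. V j \<omega>)")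
    case True
    have le: "Y \<beta> I (s (Suc k)) \<omega> \<le> C * s (Suc k)" using True that by (auto simp: a_def)
    have pos: "0 < Y \<beta> I (s k) \<omega>"
      using True C s(1)[of k] by (auto simp: a_def intro: le_less_trans[rotated])
    have "0 \<le> (h - \<bar>R k \<omega>\<bar>)\<^sup>2" by simp
    then have "2 * h * \<bar>R k \<omega>\<bar> \<le> h\<^sup>2 + (R k \<omega>)\<^sup>2" by (simp add: power2_eq_square algebra_simps)
    then have R: "\<bar>R k \<omega>\<bar> \<le> h / 2 + (R k \<omega>)\<^sup>2 / (2 * h)"
      using h by (simp add: field_simps power2_eq_square)
    have split: "Y \<beta> I u \<omega> = Y \<beta> (I \<inter> {..<N}) u \<omega> + Y \<beta> (I - {..<N}) u \<omega>" for u
      unfolding jump_sum_def using I by (subst sum.Int_Diff[of I _ "{..<N}"]) auto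
    have "Y \<beta> (I \<inter> {..<N}) (s k) \<omega> - Y \<beta> (I \<inter> {..<N}) (s (Suc k)) \<omega> =
        (\<Sum>i\<in>I \<inter> {..<N}. \<beta> i * (of_bool (V i \<omega> \<le> s k) - of_bool (V i \<omega> \<le> s (Suc k)) + d))"
      unfolding jump_sum_def sum_subtractf[symmetric] using s_Suc[of k]
      by (intro sum.cong refl) (simp add: algebra_simps)
    also have "\<dots> \<le> (\<Sum>i\<in>I \<inter> {..<N}. \<beta> i * d)"
      using \<beta> s_mono[of k "Suc k"] by (intro sum_mono mult_left_mono) auto
    finally have "Y \<beta> I (s k) \<omega> \<le> C * s (Suc k) + d * (\<Sum>i\<in>I \<inter> {..<N}. \<beta> i) + \<bar>R k \<omega>\<bar>"
      using le unfolding R_def split by (simp add: sum_distrib_left mult.commute)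
    also have "\<dots> = C * s k + d * (C + (\<Sum>i\<in>I \<inter> {..<N}. \<beta> i)) + \<bar>R k \<omega>\<bar>"
      using s_Suc[of k] by (simp add: algebra_simps)
    also have "\<dots> \<le> C * s k + (h * (3/2) + (R k \<omega>)\<^sup>2 / (2 * h))" using mesh R by simp
    finally have Y_le: "Y \<beta> I (s k) \<omega> \<le> C * s k + (h * (3/2) + (R k \<omega>)\<^sup>2 / (2 * h))" .
    have "h / s k * Y \<beta> I (s k) \<omega> \<le> h / s k * (C * s k + (h * (3/2) + (R k \<omega>)\<^sup>2 / (2 * h)))"
      using Y_le h s[of k] by (intro mult_left_mono) auto
    also have "\<dots> = h * C + h / s k * (h * (3/2) + (R k \<omega>)\<^sup>2 / (2 * h))"
      using s(1)[of k] by (simp add: field_simps)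
    also have "\<dots> \<le> h * C + 1 * (h * (3/2) + (R k \<omega>)\<^sup>2 / (2 * h))"
      using h s[of k] by (intro add_left_mono mult_right_mono) auto
    finally show ?thesis using True by (simp add: A_def algebra_simps)
  next
    case False
    then show ?thesis using h by (simp add: A_def)
  qed
  have last: "h / s m * (Y \<beta> I (s m) \<omega> * A m \<omega>) \<le> h / \<delta> * (1 + (Y \<beta> I \<delta> \<omega>)\<^sup>2)" for \<omega>
  proof -
    have "0 \<le> (Y \<beta> I \<delta> \<omega> - 1/2)\<^sup>2" by simp
    then have "Y \<beta> I \<delta> \<omega> \<le> 1 + (Y \<beta> I \<delta> \<omega>)\<^sup>2" by (simp add: power2_eq_square algebra_simps)
    moreover have "0 \<le> 1 + (Y \<beta> I \<delta> \<omega>)\<^sup>2" by (intro add_nonneg_nonneg) auto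
    ultimately show ?thesis unfolding s_m
      using h by (intro mult_left_mono) (auto simp: A_def)
  qed
  have intY2: "integrable M (\<lambda>\<omega>. (Y \<beta> I \<delta> \<omega>)\<^sup>2)"
    by (rule integrable_const_bound[where B="(\<Sum>i\<in>I. \<bar>\<beta> i\<bar> * (1 + \<bar>\<delta>\<bar>))\<^sup>2"])
       (auto simp: abs_le_square_iff[symmetric] intro!: order_trans[OF abs_Y_le])
  have "expectation (\<lambda>\<omega>. Y \<beta> I h \<omega> * of_bool (\<exists>k\<le>m. C * s k < Y \<beta> I (s k) \<omega>)) =
      expectation (\<lambda>\<omega>. \<Sum>k\<le>m. Y \<beta> I h \<omega> * A k \<omega>)"
    by (simp add: sum_A[symmetric] sum_distrib_left)
  also have "\<dots> = (\<Sum>k\<le>m. expectation (\<lambda>\<omega>. Y \<beta> I h \<omega> * A k \<omega>))"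
    using intYA by (intro Bochner_Integration.integral_sum) auto
  also have "\<dots> = (\<Sum>k\<le>m. h / s k * expectation (\<lambda>\<omega>. Y \<beta> I (s k) \<omega> * A k \<omega>))"
    unfolding A_def using h s s_le by (intro sum.cong refl reversed_martingale[OF I _ _ _ a_meas a_past]) auto
  also have "\<dots> = (\<Sum>k\<le>m. expectation (\<lambda>\<omega>. h / s k * (Y \<beta> I (s k) \<omega> * A k \<omega>)))"
    by simp
  also have "\<dots> = (\<Sum>k<m. expectation (\<lambda>\<omega>. h / s k * (Y \<beta> I (s k) \<omega> * A k \<omega>))) +
      expectation (\<lambda>\<omega>. h / s m * (Y \<beta> I (s m) \<omega> * A m \<omega>))"
    by (simp add: lessThan_Suc_atMost[symmetric] del: Bochner_Integration.integral_mult_right_zero)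
  also have "\<dots> \<le> (\<Sum>k<m. h * (C + 3/2) * expectation (A k) + h * d / 2) + h / \<delta> * (1 + (\<Sum>i\<in>I. (\<beta> i)\<^sup>2))"
  proof (intro add_mono sum_mono)
    fix k assume k: "k \<in> {..<m}"
    have "expectation (\<lambda>\<omega>. h / s k * (Y \<beta> I (s k) \<omega> * A k \<omega>)) \<le>
        expectation (\<lambda>\<omega>. h * (C + 3/2) * A k \<omega> + (R k \<omega>)\<^sup>2 / (2 * h))"
      using intYA intA intR2 overshoot k by (intro integral_mono) auto
    also have "\<dots> = h * (C + 3/2) * expectation (A k) + expectation (\<lambda>\<omega>. (R k \<omega>)\<^sup>2) / (2 * h)"
      using intA intR2 by simp
    also have "expectation (\<lambda>\<omega>. (R k \<omega>)\<^sup>2) / (2 * h) \<le> d * h\<^sup>2 / (2 * h)"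
      using ER2 k h by (intro divide_right_mono) auto
    also have "d * h\<^sup>2 / (2 * h) = h * d / 2" using h by (simp add: power2_eq_square)
    finally show "expectation (\<lambda>\<omega>. h / s k * (Y \<beta> I (s k) \<omega> * A k \<omega>)) \<le> h * (C + 3/2) * expectation (A k) + h * d / 2"
      by simp
  next
    have "expectation (\<lambda>\<omega>. h / s m * (Y \<beta> I (s m) \<omega> * A m \<omega>)) \<le> expectation (\<lambda>\<omega>. h / \<delta> * (1 + (Y \<beta> I \<delta> \<omega>)\<^sup>2))"
      using intYA intY2 last by (intro integral_mono) auto
    also have "\<dots> = h / \<delta> * (1 + expectation (\<lambda>\<omega>. (Y \<beta> I \<delta> \<omega>)\<^sup>2))"
      using intY2 by (simp add: prob_space)
    also have "\<dots> \<le> h / \<delta> * (1 + (\<Sum>i\<in>I. (\<beta> i)\<^sup>2))"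
    proof -
      have "expectation (\<lambda>\<omega>. (Y \<beta> I \<delta> \<omega>)\<^sup>2) \<le> \<delta> * (\<Sum>i\<in>I. (\<beta> i)\<^sup>2)"
        using h by (intro second_moment_Y I) auto
      also have "\<dots> \<le> 1 * (\<Sum>i\<in>I. (\<beta> i)\<^sup>2)"
        using h h0_le_1 by (intro mult_right_mono sum_nonneg) auto
      finally show ?thesis using h by (intro mult_left_mono) auto
    qed
    finally show "expectation (\<lambda>\<omega>. h / s m * (Y \<beta> I (s m) \<omega> * A m \<omega>)) \<le> h / \<delta> * (1 + (\<Sum>i\<in>I. (\<beta> i)\<^sup>2))" .
  qed
  also have "(\<Sum>k<m. h * (C + 3/2) * expectation (A k) + h * d / 2) \<le> h * (C + 2)"
  proof -
    have "(\<Sum>k<m. expectation (A k)) \<le> (\<Sum>k\<le>m. expectation (A k))"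
      using A01 by (intro sum_mono2) (auto intro!: integral_nonneg)
    also have "\<dots> = expectation (\<lambda>\<omega>. \<Sum>k\<le>m. A k \<omega>)"
      using intA by (simp add: Bochner_Integration.integral_sum)
    also have "\<dots> \<le> expectation (\<lambda>\<omega>. 1)"
      by (intro integral_mono Bochner_Integration.integrable_sum intA) (auto simp: sum_A)
    finally have "(\<Sum>k<m. expectation (A k)) \<le> 1" by (simp add: prob_space)
    then have "h * (C + 3/2) * (\<Sum>k<m. expectation (A k)) \<le> h * (C + 3/2) * 1"
      using h C by (intro mult_left_mono) auto
    moreover have "real m * (h * d / 2) \<le> h * (1 / 2)"
    proof -
      have "real m * d \<le> 1" using h h0_le_1 m by (simp add: d)
      then have "h / 2 * (real m * d) \<le> h / 2 * 1" using h by (intro mult_left_mono) auto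
      then show ?thesis by (simp add: algebra_simps)
    qed
    moreover have "(\<Sum>k<m. h * (C + 3/2) * expectation (A k) + h * d / 2) =
        h * (C + 3/2) * (\<Sum>k<m. expectation (A k)) + real m * (h * d / 2)"
      by (simp add: sum.distrib sum_distrib_left)
    moreover have "h * (C + 2) = h * (C + 3/2) * 1 + h * (1 / 2)" by (simp add: algebra_simps)
    ultimately show ?thesis by linarith
  qed
  also have "h * (C + 2) + h / \<delta> * (1 + (\<Sum>i\<in>I. (\<beta> i)\<^sup>2)) = h * (C + 2 + (1 + (\<Sum>i\<in>I. (\<beta> i)\<^sup>2)) / \<delta>)"
    by (simp add: algebra_simps add_divide_distrib)
  finally show ?thesis by (simp add: s_def)
qed

end

text \<open>
  The probability that \<open>prob_Y_le_linear\<close> guarantees. It also serves as a lower bound in the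
  alternative case of \<open>prob_Y_le_multiple\<close>, which is why it has to be at most \<open>1/2\<close>.\<close>

definition c0 :: real where "c0 = exp (-10) / 4"

lemma c0: "0 < c0" "c0 \<le> 1/2"
  using exp_ge_add_one_self[of 10] by (auto simp: c0_def exp_minus field_simps)

context uniform_arrivals
begin

text \<open>
  Split \<open>E (Y h) = 0\<close> according to whether the level was passed. The passed part is at most \<open>\<kappa> * h\<close>
  with \<open>\<kappa>\<close> independent of \<open>h\<close>; so without passage \<open>Y h \<le> - K * h\<close> has probability at most \<open>\<kappa> / K\<close>.
  As \<open>prob_Y_le_linear\<close> gives \<open>c0\<close> for the same inequality, \<open>K = 2 * \<kappa> / c0\<close> leaves
  \<open>c0 / 2\<close> for the passage. The grid and \<open>F\<close> are chosen before the index set, which makes the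
  bound uniform over partial sums.\<close>

lemma prob_hit_level:
  assumes \<beta>: "\<And>i. i \<in> P \<Longrightarrow> 0 \<le> \<beta> i" and sq: "summable (\<lambda>i. (\<beta> i)\<^sup>2)"
    and unb: "\<And>B. \<exists>F. finite F \<and> F \<subseteq> P \<and> B \<le> (\<Sum>i\<in>F. \<beta> i)"
    and C: "0 \<le> C" and \<delta>: "0 < \<delta>" "\<delta> \<le> h0"
  shows "\<exists>S F. finite S \<and> S \<subseteq> {0<..\<delta>} \<and> finite F \<and> F \<subseteq> P \<and>
    (\<forall>I. finite I \<longrightarrow> F \<subseteq> I \<longrightarrow> I \<subseteq> P \<longrightarrow>
      c0 / 2 \<le> prob {\<omega> \<in> space M. \<exists>s\<in>S. C * s < Y \<beta> I s \<omega>})"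
proof -
  define \<kappa> where "\<kappa> = 2 * C + 2 + (1 + (\<Sum>i. (\<beta> i)\<^sup>2)) / \<delta>"
  have \<kappa>: "0 < \<kappa>"
  proof -
    have "0 \<le> (\<Sum>i. (\<beta> i)\<^sup>2)" using sq by (intro suminf_nonneg) auto
    then have "0 \<le> (1 + (\<Sum>i. (\<beta> i)\<^sup>2)) / \<delta>" using \<delta> by simp
    then show ?thesis using C unfolding \<kappa>_def by linarith
  qed
  define K where "K = 2 * \<kappa> / c0"
  have K: "0 < K" using \<kappa> c0 by (simp add: K_def)
  obtain F where F: "finite F" "F \<subseteq> P" "2 * K + 1 \<le> (\<Sum>i\<in>F. \<beta> i)" using unb by blast
  \<comment> \<open>the third entry ensures \<open>h * K * card F \<le> 2\<close>; adding \<open>1\<close> avoids a division by zero\<close>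
  define h where "h = Min {\<delta> / 2, 1 / 16, 2 / (K * (real (card F) + 1))}"
  have h: "0 < h" "h < \<delta>" "h \<le> 1 / 16"
    using \<delta> K by (auto simp: h_def min_less_iff_disj intro!: divide_pos_pos mult_pos_pos)
  have hF: "h * K * card F \<le> 2"
  proof -
    have "h * K * card F \<le> h * (K * (real (card F) + 1))"
      using h K by (simp add: algebra_simps)
    also have "\<dots> \<le> 2 / (K * (real (card F) + 1)) * (K * (real (card F) + 1))"
      using K by (intro mult_right_mono) (auto simp: h_def)
    also have "\<dots> = 2" using K by (simp add: add_eq_0_iff)
    finally show ?thesis .
  qed
  obtain N where N: "(\<Sum>i. (\<beta> (i + N))\<^sup>2) < h\<^sup>2"
  proof -
    have "eventually (\<lambda>N. (\<Sum>i. (\<beta> (i + N))\<^sup>2) < h\<^sup>2) sequentially"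
      by (rule order_tendstoD(2)[OF suminf_exist_split2[OF sq]]) (use h in simp)
    then show ?thesis using that by (auto simp: eventually_sequentially)
  qed
  define B where "B = (\<Sum>i<N. \<bar>\<beta> i\<bar>)"
  have B: "0 \<le> B" by (auto simp: B_def intro!: sum_nonneg)
  obtain m0 :: nat where "(\<delta> - h) * (C + B) / h \<le> m0" using real_arch_simple by blast
  then obtain m :: nat where m: "0 < m" "(\<delta> - h) * (C + B) / h \<le> m"
    by (intro that[of "Suc m0"]) auto
  define d where "d = (\<delta> - h) / m"
  have d: "0 < d" "d * (C + B) \<le> h" using m h by (auto simp: d_def field_simps)
  define S where "S = (\<lambda>k. h + real k * d) ` {..m}"
  have S\<delta>: "S \<subseteq> {0<..\<delta>}"
  proof
    fix s assume "s \<in> S"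
    then obtain k where k: "k \<le> m" "s = h + real k * d" by (auto simp: S_def)
    have "real k * d \<le> real m * d" using k d by (intro mult_right_mono) auto
    then show "s \<in> {0<..\<delta>}" using k h d m by (auto simp: d_def intro!: add_pos_nonneg)
  qed
  have "c0 / 2 \<le> prob {\<omega> \<in> space M. \<exists>s\<in>S. C * s < Y \<beta> I s \<omega>}"
    if I: "finite I" "F \<subseteq> I" "I \<subseteq> P" for I
  proof -
    let ?hit = "\<lambda>\<omega>. \<exists>k\<le>m. C * (h + real k * d) < Y \<beta> I (h + real k * d) \<omega>"
    have hit_eq: "(\<exists>s\<in>S. C * s < Y \<beta> I s \<omega>) \<longleftrightarrow> ?hit \<omega>" for \<omega> by (auto simp: S_def)
    have \<beta>I: "0 \<le> \<beta> i" if "i \<in> I" for i using \<beta> I that by auto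
    have sumI: "(\<Sum>i\<in>I. (\<beta> i)\<^sup>2) \<le> (\<Sum>i. (\<beta> i)\<^sup>2)"
      using sum_le_suminf[OF sq I(1)] by simp
    have "(\<Sum>i\<in>I - {..<N}. (\<beta> i)\<^sup>2) = (\<Sum>i\<in>(\<lambda>i. i - N) ` (I - {..<N}). (\<beta> (i + N))\<^sup>2)"
      by (subst sum.reindex) (auto simp: inj_on_def intro!: sum.cong)
    also have "\<dots> \<le> (\<Sum>i. (\<beta> (i + N))\<^sup>2)"
      using I by (intro sum_le_suminf summable_ignore_initial_segment[OF sq]) auto
    finally have tail: "(\<Sum>i\<in>I - {..<N}. (\<beta> i)\<^sup>2) \<le> h\<^sup>2" using N by simp
    have "(\<Sum>i\<in>I \<inter> {..<N}. \<beta> i) \<le> B"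
      unfolding B_def by (rule order_trans[OF sum_mono sum_mono2]) auto
    then have mesh: "d * (C + (\<Sum>i\<in>I \<inter> {..<N}. \<beta> i)) \<le> h"
      using d by (intro order_trans[OF mult_left_mono d(2)]) auto
    have "expectation (\<lambda>\<omega>. Y \<beta> I h \<omega> * of_bool (?hit \<omega>)) \<le> h * (C + 2 + (1 + (\<Sum>i\<in>I. (\<beta> i)\<^sup>2)) / \<delta>)"
      by (rule expectation_Y_hit_le[OF I(1) \<beta>I C h(1,2) \<delta>(2) m(1) d_def mesh tail])
    also have "\<dots> \<le> h * (\<kappa> - C)"
      unfolding \<kappa>_def using h \<delta> sumI by (intro mult_left_mono) (auto intro!: divide_right_mono)
    finally have hit_le: "expectation (\<lambda>\<omega>. Y \<beta> I h \<omega> * of_bool (?hit \<omega>)) \<le> h * (\<kappa> - C)" .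
    define E where "E = {\<omega> \<in> space M. Y \<beta> I h \<omega> \<le> - K * h \<and> \<not> ?hit \<omega>}"
    have [measurable]: "E \<in> events" unfolding E_def by measurable
    have "0 = expectation (Y \<beta> I h)" using expectation_Y[of h \<beta> I] h \<delta> by simp
    also have "\<dots> \<le> expectation (\<lambda>\<omega>. Y \<beta> I h \<omega> * of_bool (?hit \<omega>) + (C * h - K * h * indicator E \<omega>))"
    proof (rule integral_mono)
      show "integrable M (\<lambda>\<omega>. Y \<beta> I h \<omega> * of_bool (?hit \<omega>) + (C * h - K * h * indicator E \<omega>))"
      proof (intro Bochner_Integration.integrable_add Bochner_Integration.integrable_diff integrable_mult_right)
        show "integrable M (\<lambda>\<omega>. Y \<beta> I h \<omega> * of_bool (?hit \<omega>))"
          by (rule Bochner_Integration.integrable_bound[OF integrable_Y[of \<beta> I h]]) auto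
      qed (auto simp: emeasure_eq_measure)
      fix \<omega> assume \<omega>: "\<omega> \<in> space M"
      show "Y \<beta> I h \<omega> \<le> Y \<beta> I h \<omega> * of_bool (?hit \<omega>) + (C * h - K * h * indicator E \<omega>)"
      proof (cases "?hit \<omega>")
        case True
        then show ?thesis using C h by (auto simp: E_def)
      next
        case False
        then have "\<not> C * (h + real 0 * d) < Y \<beta> I (h + real 0 * d) \<omega>" by blast
        then have "Y \<beta> I h \<omega> \<le> C * h" by simp
        moreover have "0 \<le> C * h" using C h by simp
        ultimately show ?thesis using False \<omega> by (auto simp: E_def indicator_def)
      qed
    qed (rule integrable_Y)
    also have "\<dots> = expectation (\<lambda>\<omega>. Y \<beta> I h \<omega> * of_bool (?hit \<omega>)) + (C * h - K * h * prob E)"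
    proof -
      have "integrable M (\<lambda>\<omega>. Y \<beta> I h \<omega> * of_bool (?hit \<omega>))"
        by (rule Bochner_Integration.integrable_bound[OF integrable_Y[of \<beta> I h]]) auto
      moreover have "integrable M (indicator E :: _ \<Rightarrow> real)"
        by (rule integrable_real_indicator) (auto simp: emeasure_eq_measure)
      ultimately show ?thesis by (simp add: prob_space)
    qed
    also have "\<dots> \<le> h * (\<kappa> - C) + (C * h - K * h * prob E)" using hit_le by simp
    also have "\<dots> = h * (\<kappa> - K * prob E)" by (simp add: algebra_simps)
    finally have "K * prob E \<le> \<kappa>" using h by (simp add: zero_le_mult_iff)
    then have E: "prob E \<le> c0 / 2" using \<kappa> c0 by (simp add: K_def field_simps)
    have "c0 \<le> prob {\<omega> \<in> space M. Y \<beta> I h \<omega> \<le> - K * h}"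
      unfolding c0_def using prob_Y_le_linear[OF I(1) \<beta>I h(1) _ h(3) K I(2) F(3) hF] h \<delta> by simp
    also have "\<dots> \<le> prob (E \<union> {\<omega> \<in> space M. ?hit \<omega>})"
      by (rule finite_measure_mono) (auto simp: E_def)
    also have "\<dots> \<le> prob E + prob {\<omega> \<in> space M. ?hit \<omega>}"
      by (rule measure_Un_le) auto
    finally show ?thesis using E unfolding hit_eq by simp
  qed
  moreover have "finite S" by (simp add: S_def)
  ultimately show ?thesis using S\<delta> F by blast
qed

text \<open>
  If the jumps have bounded sum, Markov's inequality for the uncompensated sum gives the bound;
  otherwise \<open>prob_Y_le_linear\<close> gives it even with \<open>L = 0\<close>.\<close>

lemma prob_Y_le_multiple:
  assumes \<beta>: "\<And>i. i \<in> Q \<Longrightarrow> 0 \<le> \<beta> i"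
  shows "\<exists>L h1 F. 0 \<le> L \<and> 0 < h1 \<and> finite F \<and> F \<subseteq> Q \<and>
    (\<forall>h I. 0 < h \<longrightarrow> h \<le> h1 \<longrightarrow> h \<le> h0 \<longrightarrow> finite I \<longrightarrow> F \<subseteq> I \<longrightarrow> I \<subseteq> Q \<longrightarrow>
      c0 \<le> prob {\<omega> \<in> space M. Y \<beta> I h \<omega> \<le> L * h})"
proof (cases "\<exists>B. \<forall>F. finite F \<longrightarrow> F \<subseteq> Q \<longrightarrow> (\<Sum>i\<in>F. \<beta> i) \<le> B")
  case True
  then obtain B where B: "\<And>F. finite F \<Longrightarrow> F \<subseteq> Q \<Longrightarrow> (\<Sum>i\<in>F. \<beta> i) \<le> B" by blast
  have B0: "0 \<le> B" using B[of "{}"] by simp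
  define L where "L = 2 * B + 1"
  have L: "0 < L" using B0 by (simp add: L_def)
  have "c0 \<le> prob {\<omega> \<in> space M. Y \<beta> I h \<omega> \<le> L * h}"
    if h: "0 < h" "h \<le> h0" and I: "finite I" "I \<subseteq> Q" for h I
  proof -
    define J where "J \<omega> = (\<Sum>i\<in>I. \<beta> i * of_bool (V i \<omega> \<le> h))" for \<omega>
    have J0: "0 \<le> J \<omega>" for \<omega> unfolding J_def using \<beta> I by (intro sum_nonneg) auto
    have intJ: "integrable M J" unfolding J_def using integrable_V_le by auto
    have EJ: "expectation J = (\<Sum>i\<in>I. \<beta> i) * h"
      unfolding J_def using integrable_V_le expectation_V_le[of h] h
      by (simp add: Bochner_Integration.integral_sum sum_distrib_right)
    have YJ: "Y \<beta> I h \<omega> \<le> J \<omega>" for \<omega>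
      unfolding jump_sum_def J_def using \<beta> I h by (intro sum_mono mult_left_mono) auto
    define E where "E = {\<omega> \<in> space M. \<not> Y \<beta> I h \<omega> \<le> L * h}"
    have [measurable]: "E \<in> events" unfolding E_def by measurable
    have "L * h * prob E = expectation (\<lambda>\<omega>. L * h * indicator E \<omega>)" by simp
    also have "\<dots> \<le> expectation J"
    proof (rule integral_mono)
      show "integrable M (\<lambda>\<omega>. L * h * indicator E \<omega>)"
        by (intro integrable_mult_right integrable_real_indicator) (auto simp: emeasure_eq_measure)
      fix \<omega> show "L * h * indicator E \<omega> \<le> J \<omega>"
        using YJ[of \<omega>] J0[of \<omega>] by (auto simp: E_def indicator_def)
    qed (rule intJ)
    also have "\<dots> \<le> B * h" unfolding EJ using B[OF I] h by (intro mult_right_mono) auto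
    finally have "h * (L * prob E) \<le> h * B" by (simp add: mult_ac)
    then have LE: "L * prob E \<le> B" using h by simp
    have "prob E \<le> 1 / 2"
    proof (rule ccontr)
      assume "\<not> prob E \<le> 1 / 2"
      then have "L * (1 / 2) < L * prob E" using L by (intro mult_strict_left_mono) auto
      then show False using LE by (simp add: L_def)
    qed
    moreover have "prob E = 1 - prob {\<omega> \<in> space M. Y \<beta> I h \<omega> \<le> L * h}"
      unfolding E_def by (rule prob_neg) simp
    ultimately show ?thesis using c0 by simp
  qed
  then show ?thesis using L by (intro exI[of _ L] exI[of _ 1] exI[of _ "{}"]) auto
next
  case False
  then obtain F where F: "finite F" "F \<subseteq> Q" "2 * 1 + 1 \<le> (\<Sum>i\<in>F. \<beta> i)"
    by (meson linear)
  define h1 where "h1 = min (1/16) (2 / (real (card F) + 1))"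
  have "c0 \<le> prob {\<omega> \<in> space M. Y \<beta> I h \<omega> \<le> 0 * h}"
    if h: "0 < h" "h \<le> h1" "h \<le> h0" and I: "finite I" "F \<subseteq> I" "I \<subseteq> Q" for h I
  proof -
    have "h * 1 * card F \<le> h * (real (card F) + 1)" using h by simp
    also have "\<dots> \<le> 2 / (real (card F) + 1) * (real (card F) + 1)"
      using h by (intro mult_right_mono) (auto simp: h1_def)
    also have "\<dots> = 2" using of_nat_0_le_iff[of "card F"] by (simp add: nonzero_divide_eq_eq)
    finally have "h * 1 * card F \<le> 2" .
    then have "c0 \<le> prob {\<omega> \<in> space M. Y \<beta> I h \<omega> \<le> - 1 * h}"
      unfolding c0_def using h \<beta> I F
      by (intro prob_Y_le_linear[where F=F]) (auto simp: h1_def)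
    also have "\<dots> \<le> prob {\<omega> \<in> space M. Y \<beta> I h \<omega> \<le> 0 * h}"
      using h by (intro finite_measure_mono) auto
    finally show ?thesis .
  qed
  moreover have "0 < h1" by (auto simp: h1_def intro!: divide_pos_pos add_nonneg_pos)
  ultimately show ?thesis using F by (intro exI[of _ 0] exI[of _ h1] exI[of _ F]) auto
qed

end

section \<open>Jumps of both signs\<close>

lemma (in prob_space) prob_frequently_ge:
  assumes [measurable]: "\<And>n::nat. E n \<in> events"
    and c: "eventually (\<lambda>n. c \<le> prob (E n)) sequentially"
  shows "c \<le> prob {\<omega> \<in> space M. \<exists>\<^sub>F n in sequentially. \<omega> \<in> E n}"
proof -
  let ?U = "\<lambda>N. \<Union>n\<in>{N..}. E n"
  have "(\<lambda>N. prob (?U N)) \<longlonglongrightarrow> prob (\<Inter>N. ?U N)"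
  proof (rule finite_Lim_measure_decseq)
    show "decseq ?U" unfolding decseq_def by (intro allI impI UN_mono) auto
  qed auto
  moreover have "eventually (\<lambda>N. c \<le> prob (?U N)) sequentially"
    using c
  proof eventually_elim
    case (elim N)
    also have "prob (E N) \<le> prob (?U N)" by (rule finite_measure_mono) auto
    finally show ?case .
  qed
  ultimately have "c \<le> prob (\<Inter>N. ?U N)"
    by (rule tendsto_lowerbound) simp
  also have "(\<Inter>N. ?U N) = {\<omega> \<in> space M. \<exists>\<^sub>F n in sequentially. \<omega> \<in> E n}"
    using sets.sets_into_space[OF assms(1)] by (fastforce simp: frequently_sequentially Bex_def)
  finally show ?thesis .
qed

context uniform_arrivals
begin

text \<open>
  A condition that has probability at least \<open>c\<close> at each fixed time still has conditional
  probability at least \<open>c\<close> at a random time that is independent of it.\<close>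

lemma prob_ex_indep_ge:
  fixes p q :: "real \<Rightarrow> (nat \<Rightarrow> real) \<Rightarrow> bool"
  assumes S: "finite S" and JK: "J \<inter> K = {}"
    and [measurable]: "\<And>s. Measurable.pred (Pi\<^sub>M J (\<lambda>_. borel)) (p s)"
      "\<And>s. Measurable.pred (Pi\<^sub>M K (\<lambda>_. borel)) (q s)"
    and q: "\<And>s. s \<in> S \<Longrightarrow> c \<le> prob {\<omega> \<in> space M. q s (\<lambda>i\<in>K. V i \<omega>)}"
  shows "c * prob {\<omega> \<in> space M. \<exists>s\<in>S. p s (\<lambda>i\<in>J. V i \<omega>)} \<le>
    prob {\<omega> \<in> space M. \<exists>s\<in>S. p s (\<lambda>i\<in>J. V i \<omega>) \<and> q s (\<lambda>i\<in>K. V i \<omega>)}"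
proof -
  \<comment> \<open>split according to the largest time in \<open>S\<close> at which \<open>p\<close> holds\<close>
  define a where "a s v \<longleftrightarrow> p s v \<and> (\<forall>u\<in>{u\<in>S. s < u}. \<not> p u v)" for s v
  have [measurable]: "(\<lambda>\<omega>. \<lambda>j\<in>J. V j \<omega>) \<in> M \<rightarrow>\<^sub>M Pi\<^sub>M J (\<lambda>_. borel)" for J
    by (rule measurable_restrict) simp
  have a_meas[measurable]: "Measurable.pred (Pi\<^sub>M J (\<lambda>_. borel)) (a s)" for s
    unfolding a_def using S by (intro pred_intros_logic pred_intros_finite) auto
  let ?J = "\<lambda>\<omega>. \<lambda>i\<in>J. V i \<omega>" and ?K = "\<lambda>\<omega>. \<lambda>i\<in>K. V i \<omega>"
  have ex: "\<exists>s\<in>S. a s v" if "\<exists>s\<in>S. p s v" for v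
  proof -
    have fin: "finite {s\<in>S. p s v}" and ne: "{s\<in>S. p s v} \<noteq> {}" using S that by auto
    let ?s = "Max {s\<in>S. p s v}"
    have "?s \<in> {s\<in>S. p s v}" by (rule Max_in[OF fin ne])
    moreover have "\<not> p u v" if "u \<in> S" "?s < u" for u
      using Max_ge[OF fin, of u] that by auto
    ultimately show ?thesis by (auto simp: a_def intro!: bexI[of _ ?s])
  qed
  have disj: "disjoint_family_on (\<lambda>s. {\<omega> \<in> space M. a s (?J \<omega>) \<and> r s \<omega>}) S" for r
    unfolding disjoint_family_on_def a_def
  proof (intro ballI impI equals0I)
    fix s u \<omega> assume "s \<in> S" "u \<in> S" "s \<noteq> u"
      "\<omega> \<in> {\<omega> \<in> space M. (p s (?J \<omega>) \<and> (\<forall>u\<in>{u \<in> S. s < u}. \<not> p u (?J \<omega>))) \<and> r s \<omega>} \<inter>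
        {\<omega> \<in> space M. (p u (?J \<omega>) \<and> (\<forall>u'\<in>{u' \<in> S. u < u'}. \<not> p u' (?J \<omega>))) \<and> r u \<omega>}"
    then show False by (cases s u rule: linorder_cases) auto
  qed
  have "c * prob {\<omega> \<in> space M. \<exists>s\<in>S. p s (?J \<omega>)} = c * prob (\<Union>s\<in>S. {\<omega> \<in> space M. a s (?J \<omega>) \<and> True})"
    by (intro arg_cong[where f="\<lambda>A. c * prob A"]) (use ex in \<open>auto simp: a_def\<close>)
  also have "\<dots> = (\<Sum>s\<in>S. c * prob {\<omega> \<in> space M. a s (?J \<omega>)})"
    using disj[of "\<lambda>_ _. True"] S by (subst finite_measure_finite_Union) (auto simp: sum_distrib_left)
  also have "\<dots> \<le> (\<Sum>s\<in>S. prob {\<omega> \<in> space M. a s (?J \<omega>) \<and> q s (?K \<omega>)})"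
  proof (rule sum_mono)
    fix s assume "s \<in> S"
    then have "prob {\<omega> \<in> space M. a s (?J \<omega>)} * c \<le>
        prob {\<omega> \<in> space M. a s (?J \<omega>)} * prob {\<omega> \<in> space M. q s (?K \<omega>)}"
      using q by (intro mult_left_mono) auto
    then show "c * prob {\<omega> \<in> space M. a s (?J \<omega>)} \<le> prob {\<omega> \<in> space M. a s (?J \<omega>) \<and> q s (?K \<omega>)}"
      using prob_restrict_indep[OF JK a_meas[of s], of "q s"] by (simp add: mult.commute)
  qed
  also have "\<dots> = prob (\<Union>s\<in>S. {\<omega> \<in> space M. a s (?J \<omega>) \<and> q s (?K \<omega>)})"
    using disj[of "\<lambda>s \<omega>. q s (?K \<omega>)"] S by (subst finite_measure_finite_Union) auto
  also have "\<dots> \<le> prob {\<omega> \<in> space M. \<exists>s\<in>S. p s (?J \<omega>) \<and> q s (?K \<omega>)}"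
  proof (rule finite_measure_mono)
    show "{\<omega> \<in> space M. \<exists>s\<in>S. p s (?J \<omega>) \<and> q s (?K \<omega>)} \<in> events"
      using S by measurable
  qed (auto simp: a_def)
  finally show ?thesis .
qed

lemma jump_sum_uminus: "jump_sum (\<lambda>i. - \<beta> i) I s v = - jump_sum \<beta> I s v"
  by (simp add: jump_sum_def sum_negf)

lemma not_summable_abs_unbounded:
  fixes \<beta> :: "nat \<Rightarrow> real"
  assumes "\<not> summable (\<lambda>i. \<bar>\<beta> i\<bar>)"
    and B: "\<And>F. finite F \<Longrightarrow> F \<subseteq> {i. 0 \<le> \<beta> i} \<Longrightarrow> (\<Sum>i\<in>F. \<beta> i) \<le> B"
  shows "\<exists>F. finite F \<and> F \<subseteq> {i. \<beta> i < 0} \<and> C \<le> (\<Sum>i\<in>F. - \<beta> i)"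
proof (rule ccontr)
  assume *: "\<not> ?thesis"
  have "(\<Sum>i<n. \<bar>\<beta> i\<bar>) \<le> B + C" for n
  proof -
    have "(\<Sum>i<n. \<bar>\<beta> i\<bar>) = (\<Sum>i\<in>{..<n} \<inter> {i. 0 \<le> \<beta> i}. \<bar>\<beta> i\<bar>) + (\<Sum>i\<in>{..<n} - {i. 0 \<le> \<beta> i}. \<bar>\<beta> i\<bar>)"
      by (rule sum.Int_Diff) simp
    also have "\<dots> = (\<Sum>i\<in>{..<n} \<inter> {i. 0 \<le> \<beta> i}. \<beta> i) + (\<Sum>i\<in>{..<n} - {i. 0 \<le> \<beta> i}. - \<beta> i)"
      by (intro arg_cong2[where f="(+)"] sum.cong) auto
    also have "\<dots> \<le> B + C"
    proof -
      have sub: "{..<n} - {i. 0 \<le> \<beta> i} \<subseteq> {i. \<beta> i < 0}" by auto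
      show ?thesis using B[of "{..<n} \<inter> {i. 0 \<le> \<beta> i}"] sub *
        by (intro add_mono) (auto simp: not_le dest!: spec[of _ "{..<n} - {i. 0 \<le> \<beta> i}"])
    qed
    finally show ?thesis .
  qed
  then have "summable (\<lambda>i. \<bar>\<beta> i\<bar>)" by (intro summableI_nonneg_bounded) auto
  then show False using assms(1) by simp
qed

text \<open>
  If the positive jumps have infinite sum, their part passes a high level at a random time, at
  which the independent negative part is harmless with probability at least \<open>c0\<close>. If they have
  finite sum \<open>B\<close>, the positive part is at least \<open>- B * h\<close> at every time \<open>h\<close>, and the negative jumps must have
  infinite sum; then one fixed small time suffices, by \<open>prob_Y_le_linear\<close> for the reflected
  negative part.\<close>

lemma prob_partial_sum_hit:
  assumes sq: "summable (\<lambda>i. (\<beta> i)\<^sup>2)" and inf: "\<not> summable (\<lambda>i. \<bar>\<beta> i\<bar>)"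
    and K: "0 \<le> K" and \<epsilon>: "0 < \<epsilon>"
  shows "\<exists>S. finite S \<and> S \<subseteq> {0<..\<epsilon>} \<and> S \<subseteq> {0<..h0} \<and>
    (\<forall>\<^sub>F n in sequentially. c0 * (c0 / 2) \<le> prob {\<omega> \<in> space M. \<exists>s\<in>S. K * s < Y \<beta> {..<n} s \<omega>})"
proof -
  define P where "P = {i. 0 \<le> \<beta> i}"
  define Q where "Q = {i. \<beta> i < 0}"
  define \<gamma> where "\<gamma> = (\<lambda>i. - \<beta> i)"
  have PQ: "P \<inter> Q = {}" "P \<union> Q = UNIV" by (auto simp: P_def Q_def)
  have \<beta>P: "0 \<le> \<beta> i" if "i \<in> P" for i using that by (simp add: P_def)
  have \<gamma>Q: "0 \<le> \<gamma> i" if "i \<in> Q" for i using that by (simp add: Q_def \<gamma>_def)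
  have split: "jump_sum \<beta> {..<n} s v = jump_sum \<beta> ({..<n} \<inter> P) s v - jump_sum \<gamma> ({..<n} \<inter> Q) s v" for n s v
  proof -
    have "jump_sum \<beta> {..<n} s v = jump_sum \<beta> ({..<n} \<inter> P) s v + jump_sum \<beta> ({..<n} - P) s v"
      unfolding jump_sum_def by (rule sum.Int_Diff) simp
    moreover have "{..<n} - P = {..<n} \<inter> Q" by (auto simp: P_def Q_def)
    ultimately show ?thesis unfolding \<gamma>_def jump_sum_uminus by simp
  qed
  have ev: "\<forall>\<^sub>F n in sequentially. F \<subseteq> {..<n}" if F: "finite F" for F :: "nat set"
  proof -
    obtain m where "F \<subseteq> {..<m}" using F finite_nat_iff_bounded by blast
    then show ?thesis unfolding eventually_sequentially by (intro exI[of _ m]) auto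
  qed
  show ?thesis
  proof (cases "\<exists>B. \<forall>F. finite F \<longrightarrow> F \<subseteq> P \<longrightarrow> (\<Sum>i\<in>F. \<beta> i) \<le> B")
    case False
    obtain L h1 F2 where L: "0 \<le> L" and h1: "0 < h1" and F2: "finite F2" "F2 \<subseteq> Q"
      and Q_le: "\<And>h I. 0 < h \<Longrightarrow> h \<le> h1 \<Longrightarrow> h \<le> h0 \<Longrightarrow> finite I \<Longrightarrow> F2 \<subseteq> I \<Longrightarrow> I \<subseteq> Q \<Longrightarrow>
          c0 \<le> prob {\<omega> \<in> space M. Y \<gamma> I h \<omega> \<le> L * h}"
      using prob_Y_le_multiple[of Q \<gamma>, OF \<gamma>Q] by blast
    define \<delta> where "\<delta> = min \<epsilon> (min h0 h1)"
    have \<delta>: "0 < \<delta>" "\<delta> \<le> h0" using \<epsilon> h0_pos h1 by (auto simp: \<delta>_def)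
    have unb: "\<exists>F. finite F \<and> F \<subseteq> P \<and> B \<le> (\<Sum>i\<in>F. \<beta> i)" for B
    proof -
      obtain F where "finite F" "F \<subseteq> P" "\<not> (\<Sum>i\<in>F. \<beta> i) \<le> B" using False by blast
      then show ?thesis by (intro exI[of _ F]) auto
    qed
    have "0 \<le> K + L" using K L by simp
    then have "\<exists>S F. finite S \<and> S \<subseteq> {0<..\<delta>} \<and> finite F \<and> F \<subseteq> P \<and>
        (\<forall>I. finite I \<longrightarrow> F \<subseteq> I \<longrightarrow> I \<subseteq> P \<longrightarrow>
          c0 / 2 \<le> prob {\<omega> \<in> space M. \<exists>s\<in>S. (K + L) * s < Y \<beta> I s \<omega>})"
      by (intro prob_hit_level \<beta>P sq unb \<delta>)
    then obtain S F1 where SF: "finite S \<and> S \<subseteq> {0<..\<delta>} \<and> finite F1 \<and> F1 \<subseteq> P \<and>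
        (\<forall>I. finite I \<longrightarrow> F1 \<subseteq> I \<longrightarrow> I \<subseteq> P \<longrightarrow>
          c0 / 2 \<le> prob {\<omega> \<in> space M. \<exists>s\<in>S. (K + L) * s < Y \<beta> I s \<omega>})"
      by (elim exE)
    then have S: "finite S" "S \<subseteq> {0<..\<delta>}" and F1: "finite F1" "F1 \<subseteq> P"
      and hit: "\<And>I. finite I \<Longrightarrow> F1 \<subseteq> I \<Longrightarrow> I \<subseteq> P \<Longrightarrow>
          c0 / 2 \<le> prob {\<omega> \<in> space M. \<exists>s\<in>S. (K + L) * s < Y \<beta> I s \<omega>}"
      by simp_all
    have "\<forall>\<^sub>F n in sequentially. F1 \<union> F2 \<subseteq> {..<n}" using ev[of "F1 \<union> F2"] F1 F2 by simp
    then have "\<forall>\<^sub>F n in sequentially. c0 * (c0 / 2) \<le> prob {\<omega> \<in> space M. \<exists>s\<in>S. K * s < Y \<beta> {..<n} s \<omega>}"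
    proof eventually_elim
      case (elim n)
      let ?J = "{..<n} \<inter> P" and ?K = "{..<n} \<inter> Q"
      let ?p = "\<lambda>s v. (K + L) * s < jump_sum \<beta> ?J s v" and ?q = "\<lambda>s v. jump_sum \<gamma> ?K s v \<le> L * s"
      have "c0 * (c0 / 2) \<le> c0 * prob {\<omega> \<in> space M. \<exists>s\<in>S. (K + L) * s < Y \<beta> ?J s \<omega>}"
        using elim F1 F2 c0 by (intro mult_left_mono hit) auto
      also have "\<dots> = c0 * prob {\<omega> \<in> space M. \<exists>s\<in>S. ?p s (\<lambda>i\<in>?J. V i \<omega>)}"
        by (simp add: jump_sum_restrict)
      also have "\<dots> \<le> prob {\<omega> \<in> space M. \<exists>s\<in>S. ?p s (\<lambda>i\<in>?J. V i \<omega>) \<and> ?q s (\<lambda>i\<in>?K. V i \<omega>)}"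
      proof (rule prob_ex_indep_ge)
        fix s assume "s \<in> S"
        then have "s \<in> {0<..\<delta>}" using S by auto
        then have "c0 \<le> prob {\<omega> \<in> space M. Y \<gamma> ?K s \<omega> \<le> L * s}"
          using elim F2 by (intro Q_le) (auto simp: \<delta>_def)
        then show "c0 \<le> prob {\<omega> \<in> space M. ?q s (\<lambda>i\<in>?K. V i \<omega>)}"
          by (simp add: jump_sum_restrict)
      qed (use S PQ in auto)
      also have "\<dots> = prob {\<omega> \<in> space M. \<exists>s\<in>S. (K + L) * s < Y \<beta> ?J s \<omega> \<and> Y \<gamma> ?K s \<omega> \<le> L * s}"
        by (simp add: jump_sum_restrict)
      also have "\<dots> \<le> prob {\<omega> \<in> space M. \<exists>s\<in>S. K * s < Y \<beta> {..<n} s \<omega>}"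
        unfolding split
      proof (rule finite_measure_mono)
        show "{\<omega> \<in> space M. \<exists>s\<in>S. (K + L) * s < Y \<beta> ?J s \<omega> \<and> Y \<gamma> ?K s \<omega> \<le> L * s} \<subseteq>
            {\<omega> \<in> space M. \<exists>s\<in>S. K * s < Y \<beta> ?J s \<omega> - Y \<gamma> ?K s \<omega>}"
        proof safe
          fix \<omega> s assume "s \<in> S" "(K + L) * s < Y \<beta> ?J s \<omega>" "Y \<gamma> ?K s \<omega> \<le> L * s"
          then show "\<exists>s\<in>S. K * s < Y \<beta> ?J s \<omega> - Y \<gamma> ?K s \<omega>"
            by (intro bexI[of _ s]) (auto simp: algebra_simps)
        qed
        have "Measurable.pred M (\<lambda>\<omega>. \<exists>s\<in>S. K * s < Y \<beta> ?J s \<omega> - Y \<gamma> ?K s \<omega>)"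
          by (rule pred_intros_finite(4)[OF S(1)]) measurable
        then show "{\<omega> \<in> space M. \<exists>s\<in>S. K * s < Y \<beta> ?J s \<omega> - Y \<gamma> ?K s \<omega>} \<in> events"
          by (simp add: pred_def)
      qed
      finally show ?case .
    qed
    moreover have "S \<subseteq> {0<..\<epsilon>}" "S \<subseteq> {0<..h0}" using S by (auto simp: \<delta>_def)
    ultimately show ?thesis using S by blast
  next
    case True
    then obtain B where B: "\<And>F. finite F \<Longrightarrow> F \<subseteq> P \<Longrightarrow> (\<Sum>i\<in>F. \<beta> i) \<le> B" by blast
    have B0: "0 \<le> B" using B[of "{}"] by simp
    define K' where "K' = K + B + 1"
    have K': "0 < K'" using K B0 by (simp add: K'_def)
    obtain F where F: "finite F" "F \<subseteq> Q" "2 * K' + 1 \<le> (\<Sum>i\<in>F. \<gamma> i)"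
      using not_summable_abs_unbounded[OF inf, of B "2 * K' + 1"] B by (auto simp: P_def Q_def \<gamma>_def)
    define h where "h = Min {\<epsilon>, h0, 1/16, 2 / (K' * (real (card F) + 1))}"
    have h: "0 < h" "h \<le> \<epsilon>" "h \<le> h0" "h \<le> 1 / 16"
      using \<epsilon> h0_pos K' by (auto simp: h_def intro!: divide_pos_pos mult_pos_pos)
    have hF: "h * K' * card F \<le> 2"
    proof -
      have "h * K' * card F \<le> h * (K' * (real (card F) + 1))"
        using h K' by (simp add: algebra_simps)
      also have "\<dots> \<le> 2 / (K' * (real (card F) + 1)) * (K' * (real (card F) + 1))"
        using K' by (intro mult_right_mono) (auto simp: h_def)
      also have "\<dots> = 2" using K' by (simp add: add_eq_0_iff)
      finally show ?thesis .
    qed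
    have "\<forall>\<^sub>F n in sequentially. F \<subseteq> {..<n}" using ev F by simp
    then have "\<forall>\<^sub>F n in sequentially. c0 * (c0 / 2) \<le> prob {\<omega> \<in> space M. \<exists>s\<in>{h}. K * s < Y \<beta> {..<n} s \<omega>}"
    proof eventually_elim
      case (elim n)
      have "c0 * (c0 / 2) \<le> c0 * 1" using c0 by (intro mult_left_mono) auto
      also have "\<dots> \<le> prob {\<omega> \<in> space M. Y \<gamma> ({..<n} \<inter> Q) h \<omega> \<le> - K' * h}"
        using prob_Y_le_linear[of "{..<n} \<inter> Q" \<gamma> h K' F] \<gamma>Q h K' F hF elim by (auto simp: c0_def)
      also have "\<dots> \<le> prob {\<omega> \<in> space M. \<exists>s\<in>{h}. K * s < Y \<beta> {..<n} s \<omega>}"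
      proof (rule finite_measure_mono)
        have "- B * h \<le> Y \<beta> ({..<n} \<inter> P) h \<omega>" for \<omega>
        proof -
          have "- (\<Sum>i\<in>{..<n} \<inter> P. \<beta> i) * h = (\<Sum>i\<in>{..<n} \<inter> P. \<beta> i * (- h))"
            by (simp add: sum_distrib_right sum_negf)
          also have "\<dots> \<le> Y \<beta> ({..<n} \<inter> P) h \<omega>"
            unfolding jump_sum_def using \<beta>P by (intro sum_mono mult_left_mono) auto
          finally have "- (\<Sum>i\<in>{..<n} \<inter> P. \<beta> i) * h \<le> Y \<beta> ({..<n} \<inter> P) h \<omega>" .
          moreover have "(\<Sum>i\<in>{..<n} \<inter> P. \<beta> i) * h \<le> B * h"
            using h by (intro mult_right_mono B) auto
          ultimately show ?thesis by linarith
        qed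
        then show "{\<omega> \<in> space M. Y \<gamma> ({..<n} \<inter> Q) h \<omega> \<le> - K' * h} \<subseteq> {\<omega> \<in> space M. \<exists>s\<in>{h}. K * s < Y \<beta> {..<n} s \<omega>}"
          unfolding split K'_def using h
        proof safe
          fix \<omega> assume lower: "\<And>\<omega>. - B * h \<le> Y \<beta> ({..<n} \<inter> P) h \<omega>"
            and "Y \<gamma> ({..<n} \<inter> Q) h \<omega> \<le> - (K + B + 1) * h"
          then have "K * h + Y \<gamma> ({..<n} \<inter> Q) h \<omega> \<le> - B * h - h" by (simp add: algebra_simps)
          then have "K * h < Y \<beta> ({..<n} \<inter> P) h \<omega> - Y \<gamma> ({..<n} \<inter> Q) h \<omega>"
            using lower[of \<omega>] h(1) by linarith
          then show "\<exists>s\<in>{h}. K * s < Y \<beta> ({..<n} \<inter> P) s \<omega> - Y \<gamma> ({..<n} \<inter> Q) s \<omega>" by simp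
        qed
      qed auto
      finally show ?case .
    qed
    then show ?thesis using h by (intro exI[of _ "{h}"]) auto
  qed
qed

end

section \<open>From positive probability to probability one\<close>

context uniform_arrivals
begin

definition tail_algebra :: "nat \<Rightarrow> 'a measure" where
  "tail_algebra k = sigma (space M) (\<Union>i\<in>{k..}. sigma_sets (space M) {V i -` B \<inter> space M |B. B \<in> sets borel})"

lemma space_tail_algebra [simp]: "space (tail_algebra k) = space M"
  by (simp add: tail_algebra_def space_measure_of_conv)

lemma sets_tail_algebra:
  "sets (tail_algebra k) = sigma_sets (space M) (\<Union>i\<in>{k..}. sigma_sets (space M) {V i -` B \<inter> space M |B. B \<in> sets borel})"
  unfolding tail_algebra_def
proof (rule sets_measure_of, safe)
  fix i A x assume "A \<in> sigma_sets (space M) {V i -` B \<inter> space M |B. B \<in> sets borel}" "x \<in> A"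
  then show "x \<in> space M" using sigma_sets_into_sp[of "{V i -` B \<inter> space M |B. B \<in> sets borel}" "space M"] by blast
qed

lemma measurable_V_tail_algebra:
  assumes "k \<le> i"
  shows "V i \<in> borel_measurable (tail_algebra k)"
proof (rule measurableI)
  fix B :: "real set" assume "B \<in> sets borel"
  then have "V i -` B \<inter> space M \<in> sigma_sets (space M) {V i -` B \<inter> space M |B. B \<in> sets borel}"
    by (intro sigma_sets.Basic) auto
  then show "V i -` B \<inter> space (tail_algebra k) \<in> sets (tail_algebra k)"
    using assms unfolding sets_tail_algebra by (auto intro!: sigma_sets.Basic)
qed simp

lemma kolmogorov_V:
  assumes "\<And>k. X \<in> sets (tail_algebra k)"
  shows "prob X = 0 \<or> prob X = 1"
proof (rule kolmogorov_0_1_law)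
  show "sigma_algebra (space M) (sigma_sets (space M) {V i -` B \<inter> space M |B. B \<in> sets borel})" for i
    by (rule sigma_algebra_sigma_sets) auto
  show "indep_sets (\<lambda>i. sigma_sets (space M) {V i -` B \<inter> space M |B. B \<in> sets borel}) UNIV"
    using indep_V by (simp add: indep_vars_def)
  show "X \<in> tail_events (\<lambda>i. sigma_sets (space M) {V i -` B \<inter> space M |B. B \<in> sets borel})"
    unfolding tail_events_def using assms by (auto simp: sets_tail_algebra)
qed

text \<open>
  The events \<open>T k\<close> say that the slopes of the sums without the first \<open>k\<close> jumps are unbounded near \<open>0\<close>.
  Before the first of these \<open>k\<close> arrivals, their contribution is a multiple of \<open>s\<close>, so all \<open>T k\<close>
  coincide and are tail events. They are phrased with \<open>eventually\<close> in the number of summands in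
  place of the limit, so that they are measurable for the tail algebras without exceptional sets.\<close>

lemma sums_unbounded_slope_AE:
  fixes S :: "nat \<Rightarrow> real set"
  assumes fin: "\<And>m. finite (S m)"
    and S: "\<And>m. S m \<subseteq> {0<..1 / Suc m}" "\<And>m. S m \<subseteq> {0<..h0}"
    and c: "0 < c"
    and hit: "\<And>m. \<forall>\<^sub>F n in sequentially. c \<le> prob {\<omega> \<in> space M. \<exists>s\<in>S m. real m * s < Y \<beta> {..<n} s \<omega>}"
    and conv: "\<And>s. 0 < s \<Longrightarrow> s \<le> h0 \<Longrightarrow> AE \<omega> in M. convergent (\<lambda>n. Y \<beta> {..<n} s \<omega>)"
  shows "AE \<omega> in M. \<forall>q::nat. \<exists>\<^sub>F m in sequentially. \<exists>s\<in>S m. \<forall>\<^sub>F n in sequentially. real q * s \<le> Y \<beta> {..<n} s \<omega>"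
proof -
  define T where "T k = {\<omega> \<in> space M. \<forall>q::nat. \<exists>\<^sub>F m in sequentially. \<exists>s\<in>S m. \<forall>\<^sub>F n in sequentially. real q * s \<le> Y \<beta> {k..<n} s \<omega>}" for k
  have T_meas: "T k \<in> sets (tail_algebra k)" for k
  proof -
    have [measurable]: "(\<lambda>\<omega>. Y \<beta> {k..<n} s \<omega>) \<in> borel_measurable (tail_algebra k)" for n s
      unfolding jump_sum_def
      by (intro borel_measurable_sum borel_measurable_times borel_measurable_diff borel_measurable_const
          measurable_compose[OF measurable_V_tail_algebra, of k _ "\<lambda>x. of_bool (x \<le> s)"]) auto
    have "Measurable.pred (tail_algebra k) (\<lambda>\<omega>. \<forall>\<^sub>F n in sequentially. real q * s \<le> Y \<beta> {k..<n} s \<omega>)" for q s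
      unfolding eventually_sequentially by measurable
    note [measurable] = pred_intros_finite(4)[OF fin this]
    have "Measurable.pred (tail_algebra k) (\<lambda>\<omega>. \<forall>q::nat. \<exists>\<^sub>F m in sequentially. \<exists>s\<in>S m. \<forall>\<^sub>F n in sequentially. real q * s \<le> Y \<beta> {k..<n} s \<omega>)"
      unfolding frequently_sequentially by measurable
    then show ?thesis by (simp add: T_def pred_def)
  qed
  have shift: "\<forall>q::nat. \<exists>\<^sub>F m in sequentially. \<exists>s\<in>S m. \<forall>\<^sub>F n in sequentially. real q * s \<le> z n s"
    if y: "\<forall>q::nat. \<exists>\<^sub>F m in sequentially. \<exists>s\<in>S m. \<forall>\<^sub>F n in sequentially. real q * s \<le> y n s"
      and yz: "\<forall>\<^sub>F m in sequentially. \<forall>s\<in>S m. \<forall>\<^sub>F n in sequentially. y n s \<le> z n s + B * s"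
    for y z :: "nat \<Rightarrow> real \<Rightarrow> real" and B
  proof
    fix q :: nat
    obtain r :: nat where r: "real q + B \<le> r" using real_arch_simple by blast
    from y have "\<exists>\<^sub>F m in sequentially. \<exists>s\<in>S m. \<forall>\<^sub>F n in sequentially. real r * s \<le> y n s" by blast
    then have "\<exists>\<^sub>F m in sequentially. (\<exists>s\<in>S m. \<forall>\<^sub>F n in sequentially. real r * s \<le> y n s) \<and>
        (\<forall>s\<in>S m. \<forall>\<^sub>F n in sequentially. y n s \<le> z n s + B * s)"
      using yz by (rule frequently_eventually_frequently)
    then show "\<exists>\<^sub>F m in sequentially. \<exists>s\<in>S m. \<forall>\<^sub>F n in sequentially. real q * s \<le> z n s"
    proof (rule frequently_elim1)
      fix m assume "(\<exists>s\<in>S m. \<forall>\<^sub>F n in sequentially. real r * s \<le> y n s) \<and>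
        (\<forall>s\<in>S m. \<forall>\<^sub>F n in sequentially. y n s \<le> z n s + B * s)"
      then obtain s where s: "s \<in> S m" and 1: "\<forall>\<^sub>F n in sequentially. real r * s \<le> y n s"
        and 2: "\<forall>\<^sub>F n in sequentially. y n s \<le> z n s + B * s" by blast
      have le: "(real q + B) * s \<le> real r * s" using r s S(1)[of m] by (intro mult_right_mono) auto
      from 1 2 have "\<forall>\<^sub>F n in sequentially. real q * s \<le> z n s"
        by eventually_elim (use le in \<open>simp add: algebra_simps\<close>)
      then show "\<exists>s\<in>S m. \<forall>\<^sub>F n in sequentially. real q * s \<le> z n s" using s by blast
    qed
  qed
  have "T k = T 0" for k
  proof -
    define b where "b = (\<Sum>i<k. \<beta> i)"
    have eq: "\<forall>\<^sub>F m in sequentially. \<forall>s\<in>S m. \<forall>\<^sub>F n in sequentially. Y \<beta> {0..<n} s \<omega> = Y \<beta> {k..<n} s \<omega> - b * s" for \<omega>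
    proof -
      have "\<forall>\<^sub>F m in sequentially. 1 / Suc m < Min (insert 1 ((\<lambda>i. V i \<omega>) ` {..<k}))"
        using LIMSEQ_inverse_real_of_nat V_pos
        by (intro order_tendstoD(2)[where y=0]) (auto simp: inverse_eq_divide)
      then show ?thesis
      proof eventually_elim
        case (elim m)
        show ?case
        proof
          fix s assume "s \<in> S m"
          then have "s \<le> 1 / Suc m" using S(1)[of m] by auto
          then have "s < Min (insert 1 ((\<lambda>i. V i \<omega>) ` {..<k}))" using elim by (rule le_less_trans)
          then have "s < V i \<omega>" if "i < k" for i using that by auto
          then have less: "jump_sum \<beta> {..<k} s (\<lambda>i. V i \<omega>) = - b * s"
            unfolding jump_sum_def b_def sum_distrib_right sum_negf[symmetric]
            by (intro sum.cong) (auto simp: not_le[symmetric])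
          have "Y \<beta> {0..<n} s \<omega> = Y \<beta> {k..<n} s \<omega> - b * s" if "k \<le> n" for n
          proof -
            have "{0..<n} = {..<k} \<union> {k..<n}" using that by auto
            then have "Y \<beta> {0..<n} s \<omega> = Y \<beta> {..<k} s \<omega> + Y \<beta> {k..<n} s \<omega>"
              unfolding jump_sum_def by (simp add: sum.union_disjoint ivl_disj_int)
            then show ?thesis using less by simp
          qed
          then show "\<forall>\<^sub>F n in sequentially. Y \<beta> {0..<n} s \<omega> = Y \<beta> {k..<n} s \<omega> - b * s"
            by (auto simp: eventually_sequentially)
        qed
      qed
    qed
    have "\<omega> \<in> T k \<longleftrightarrow> \<omega> \<in> T 0" if "\<omega> \<in> space M" for \<omega>
    proof
      assume "\<omega> \<in> T k"
      then have 1: "\<forall>q::nat. \<exists>\<^sub>F m in sequentially. \<exists>s\<in>S m. \<forall>\<^sub>F n in sequentially. real q * s \<le> Y \<beta> {k..<n} s \<omega>"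
        by (simp add: T_def)
      have "\<forall>\<^sub>F m in sequentially. \<forall>s\<in>S m. \<forall>\<^sub>F n in sequentially. Y \<beta> {k..<n} s \<omega> \<le> Y \<beta> {0..<n} s \<omega> + b * s"
        using eq[of \<omega>] by (auto elim!: eventually_mono)
      from shift[OF 1 this] show "\<omega> \<in> T 0" using that by (simp add: T_def)
    next
      assume "\<omega> \<in> T 0"
      then have 1: "\<forall>q::nat. \<exists>\<^sub>F m in sequentially. \<exists>s\<in>S m. \<forall>\<^sub>F n in sequentially. real q * s \<le> Y \<beta> {0..<n} s \<omega>"
        by (simp add: T_def)
      have "\<forall>\<^sub>F m in sequentially. \<forall>s\<in>S m. \<forall>\<^sub>F n in sequentially. Y \<beta> {0..<n} s \<omega> \<le> Y \<beta> {k..<n} s \<omega> + (- b) * s"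
        using eq[of \<omega>] by (auto elim!: eventually_mono)
      from shift[OF 1 this] show "\<omega> \<in> T k" using that by (simp add: T_def)
    qed
    then show ?thesis by (auto simp: T_def)
  qed
  then have T01: "prob (T 0) = 0 \<or> prob (T 0) = 1"
    using T_meas by (intro kolmogorov_V) metis
  \<comment> \<open>one unit of slope is given up to make the inequality hold for all large \<open>n\<close>, not only infinitely often\<close>
  define G where "G m = {\<omega> \<in> space M. \<exists>s\<in>S m. \<forall>\<^sub>F n in sequentially. (real m - 1) * s \<le> Y \<beta> {..<n} s \<omega>}" for m
  have G_meas[measurable]: "G m \<in> events" for m
  proof -
    have "Measurable.pred M (\<lambda>\<omega>. \<forall>\<^sub>F n in sequentially. (real m - 1) * s \<le> Y \<beta> {..<n} s \<omega>)" for s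
      unfolding eventually_sequentially by measurable
    then have "Measurable.pred M (\<lambda>\<omega>. \<exists>s\<in>S m. \<forall>\<^sub>F n in sequentially. (real m - 1) * s \<le> Y \<beta> {..<n} s \<omega>)"
      by (rule pred_intros_finite(4)[OF fin])
    then show ?thesis by (simp add: G_def pred_def)
  qed
  have T_meas0[measurable]: "T 0 \<in> events"
  proof -
    have "Measurable.pred M (\<lambda>\<omega>. \<forall>\<^sub>F n in sequentially. real q * s \<le> Y \<beta> {0..<n} s \<omega>)" for q s
      unfolding eventually_sequentially by measurable
    note [measurable] = pred_intros_finite(4)[OF fin this]
    have "Measurable.pred M (\<lambda>\<omega>. \<forall>q::nat. \<exists>\<^sub>F m in sequentially. \<exists>s\<in>S m. \<forall>\<^sub>F n in sequentially. real q * s \<le> Y \<beta> {0..<n} s \<omega>)"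
      unfolding frequently_sequentially by measurable
    then show ?thesis by (simp add: T_def pred_def)
  qed
  have "c \<le> prob (G m)" for m
  proof -
    have E[measurable]: "{\<omega> \<in> space M. \<exists>s\<in>S m. real m * s < Y \<beta> {..<n} s \<omega>} \<in> events" for n
    proof -
      have "Measurable.pred M (\<lambda>\<omega>. \<exists>s\<in>S m. real m * s < Y \<beta> {..<n} s \<omega>)"
        by (rule pred_intros_finite(4)[OF fin]) measurable
      then show ?thesis by (simp add: pred_def)
    qed
    have "c \<le> prob {\<omega> \<in> space M. \<exists>\<^sub>F n in sequentially. \<omega> \<in> {\<omega> \<in> space M. \<exists>s\<in>S m. real m * s < Y \<beta> {..<n} s \<omega>}}"
      by (rule prob_frequently_ge[OF E hit])
    also have "\<dots> \<le> prob (G m)"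
    proof (rule finite_measure_mono_AE)
      have "AE \<omega> in M. \<forall>s\<in>S m. convergent (\<lambda>n. Y \<beta> {..<n} s \<omega>)"
        using S(2)[of m] by (intro AE_finite_allI fin conv) auto
      then show "AE \<omega> in M. \<omega> \<in> {\<omega> \<in> space M. \<exists>\<^sub>F n in sequentially. \<omega> \<in> {\<omega> \<in> space M. \<exists>s\<in>S m. real m * s < Y \<beta> {..<n} s \<omega>}} \<longrightarrow> \<omega> \<in> G m"
      proof eventually_elim
        case (elim \<omega>)
        show ?case
        proof
          assume "\<omega> \<in> {\<omega> \<in> space M. \<exists>\<^sub>F n in sequentially. \<omega> \<in> {\<omega> \<in> space M. \<exists>s\<in>S m. real m * s < Y \<beta> {..<n} s \<omega>}}"
          then have \<omega>: "\<omega> \<in> space M" and freq_ex: "\<exists>\<^sub>F n in sequentially. \<exists>s\<in>S m. real m * s < Y \<beta> {..<n} s \<omega>" by auto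
          obtain s where s: "s \<in> S m" and freq: "\<exists>\<^sub>F n in sequentially. real m * s < Y \<beta> {..<n} s \<omega>"
            using frequently_bex_finite[OF fin freq_ex] by blast
          obtain l where l: "(\<lambda>n. Y \<beta> {..<n} s \<omega>) \<longlonglongrightarrow> l" using elim s by (auto simp: convergent_def)
          have "(real m - 1) * s < l"
          proof (rule ccontr)
            assume "\<not> (real m - 1) * s < l"
            then have "l < real m * s" using s S(1)[of m] by (auto simp: algebra_simps)
            then have "\<forall>\<^sub>F n in sequentially. Y \<beta> {..<n} s \<omega> < real m * s" by (rule order_tendstoD(2)[OF l])
            then have "\<forall>\<^sub>F n in sequentially. \<not> real m * s < Y \<beta> {..<n} s \<omega>"
              by (rule eventually_mono) simp
            then show False using freq by (simp add: frequently_def)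
          qed
          then have "\<forall>\<^sub>F n in sequentially. (real m - 1) * s < Y \<beta> {..<n} s \<omega>" by (rule order_tendstoD(1)[OF l])
          then have "\<forall>\<^sub>F n in sequentially. (real m - 1) * s \<le> Y \<beta> {..<n} s \<omega>" by eventually_elim simp
          then show "\<omega> \<in> G m" using \<omega> s by (auto simp: G_def)
        qed
      qed
    qed simp
    finally show ?thesis .
  qed
  then have "c \<le> prob {\<omega> \<in> space M. \<exists>\<^sub>F m in sequentially. \<omega> \<in> G m}"
    by (intro prob_frequently_ge) auto
  also have "\<dots> \<le> prob (T 0)"
  proof (rule finite_measure_mono)
    show "{\<omega> \<in> space M. \<exists>\<^sub>F m in sequentially. \<omega> \<in> G m} \<subseteq> T 0"
      unfolding T_def
    proof safe
      fix \<omega> and q :: nat assume "\<exists>\<^sub>F m in sequentially. \<omega> \<in> G m"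
      then have "\<exists>\<^sub>F m in sequentially. \<omega> \<in> G m \<and> q + 1 \<le> m"
        by (rule frequently_eventually_frequently) (rule eventually_ge_at_top)
      then show "\<exists>\<^sub>F m in sequentially. \<exists>s\<in>S m. \<forall>\<^sub>F n in sequentially. real q * s \<le> Y \<beta> {0..<n} s \<omega>"
      proof (rule frequently_elim1)
        fix m assume m: "\<omega> \<in> G m \<and> q + 1 \<le> m"
        then obtain s where s: "s \<in> S m" and ev: "\<forall>\<^sub>F n in sequentially. (real m - 1) * s \<le> Y \<beta> {..<n} s \<omega>"
          by (auto simp: G_def)
        have "real q * s \<le> (real m - 1) * s" using m s S(1)[of m] by (intro mult_right_mono) auto
        then have "\<forall>\<^sub>F n in sequentially. real q * s \<le> Y \<beta> {0..<n} s \<omega>"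
          using ev by (auto simp: atLeast0LessThan elim!: eventually_mono)
        then show "\<exists>s\<in>S m. \<forall>\<^sub>F n in sequentially. real q * s \<le> Y \<beta> {0..<n} s \<omega>" using s by blast
      qed
    qed
  qed simp
  finally have "prob (T 0) = 1" using T01 c by auto
  then have "AE \<omega> in M. \<omega> \<in> T 0" by (rule AE_prob_1)
  then show ?thesis by eventually_elim (simp add: T_def atLeast0LessThan)
qed

lemma limit_unbounded_slope_AE:
  assumes sq: "summable (\<lambda>i. (\<beta> i)\<^sup>2)" and inf: "\<not> summable (\<lambda>i. \<bar>\<beta> i\<bar>)"
    and lim: "\<And>s. 0 < s \<Longrightarrow> s \<le> h0 \<Longrightarrow> AE \<omega> in M. (\<lambda>n. Y \<beta> {..<n} s \<omega>) \<longlonglongrightarrow> Z s \<omega>"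
  shows "AE \<omega> in M. \<forall>K \<epsilon>. 0 < \<epsilon> \<longrightarrow> (\<exists>s. 0 < s \<and> s < \<epsilon> \<and> s \<le> h0 \<and> K * s \<le> Z s \<omega>)"
proof -
  define good where "good m S \<longleftrightarrow> finite S \<and> S \<subseteq> {0<..1 / Suc m} \<and> S \<subseteq> {0<..h0} \<and>
    (\<forall>\<^sub>F n in sequentially. c0 * (c0 / 2) \<le> prob {\<omega> \<in> space M. \<exists>s\<in>S. real m * s < Y \<beta> {..<n} s \<omega>})" for m S
  have "\<forall>m. \<exists>S. good m S"
    unfolding good_def by (intro allI prob_partial_sum_hit[OF sq inf]) simp_all
  from choice[OF this] obtain S where "\<forall>m. good m (S m)" by (elim exE)
  then have fin: "\<And>m. finite (S m)" and S: "\<And>m. S m \<subseteq> {0<..1 / Suc m}" "\<And>m. S m \<subseteq> {0<..h0}"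
    and hit: "\<And>m. \<forall>\<^sub>F n in sequentially. c0 * (c0 / 2) \<le> prob {\<omega> \<in> space M. \<exists>s\<in>S m. real m * s < Y \<beta> {..<n} s \<omega>}"
    unfolding good_def by simp_all
  have conv: "AE \<omega> in M. convergent (\<lambda>n. Y \<beta> {..<n} s \<omega>)" if "0 < s" "s \<le> h0" for s
    using lim[OF that] by eventually_elim (auto simp: convergent_def)
  have "AE \<omega> in M. \<forall>q::nat. \<exists>\<^sub>F m in sequentially. \<exists>s\<in>S m. \<forall>\<^sub>F n in sequentially. real q * s \<le> Y \<beta> {..<n} s \<omega>"
    using c0 by (intro sums_unbounded_slope_AE[OF fin S _ hit conv]) auto
  moreover have "AE \<omega> in M. \<forall>m. \<forall>s\<in>S m. (\<lambda>n. Y \<beta> {..<n} s \<omega>) \<longlonglongrightarrow> Z s \<omega>"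
    unfolding AE_all_countable using S(2) by (intro allI AE_finite_allI fin lim) force+
  ultimately show ?thesis
  proof eventually_elim
    case (elim \<omega>)
    show ?case
    proof (intro allI impI)
      fix K \<epsilon> :: real assume \<epsilon>: "0 < \<epsilon>"
      obtain q :: nat where q: "K \<le> q" using real_arch_simple by blast
      have "\<forall>\<^sub>F m in sequentially. 1 / Suc m < \<epsilon>"
        using LIMSEQ_inverse_real_of_nat \<epsilon>
        by (intro order_tendstoD(2)[where y=0]) (auto simp: inverse_eq_divide)
      then have "\<exists>\<^sub>F m in sequentially. (\<exists>s\<in>S m. \<forall>\<^sub>F n in sequentially. real q * s \<le> Y \<beta> {..<n} s \<omega>) \<and> 1 / Suc m < \<epsilon>"
        using elim(1) by (intro frequently_eventually_frequently) auto
      then obtain m s where m: "1 / Suc m < \<epsilon>" and s: "s \<in> S m"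
        and ev: "\<forall>\<^sub>F n in sequentially. real q * s \<le> Y \<beta> {..<n} s \<omega>"
        by (auto elim!: frequentlyE)
      have "real q * s \<le> Z s \<omega>"
        using elim(2) s ev by (intro tendsto_lowerbound[of "\<lambda>n. Y \<beta> {..<n} s \<omega>" _ sequentially]) auto
      moreover have "K * s \<le> real q * s" using q s S(1)[of m] by (intro mult_right_mono) auto
      ultimately show "\<exists>s. 0 < s \<and> s < \<epsilon> \<and> s \<le> h0 \<and> K * s \<le> Z s \<omega>"
        using s S(1)[of m] S(2)[of m] m by (intro exI[of _ s]) force
    qed
  qed
qed

end

section \<open>The Gaussian part\<close>

lemma normal_law_moments:
  assumes "0 \<le> s"
  shows "integrable (normal_law m s) (\<lambda>x. (x - m) ^ k)"
    and "(\<integral>x. (x - m) \<partial>normal_law m s) = 0"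
    and "(\<integral>x. (x - m)\<^sup>2 \<partial>normal_law m s) = s\<^sup>2"
    and "(\<integral>x. (x - m) ^ 4 \<partial>normal_law m s) = 3 * s ^ 4"
proof -
  show "integrable (normal_law m s) (\<lambda>x. (x - m) ^ k)"
  proof (cases "s = 0")
    case True
    interpret prob_space "return borel m" by (rule prob_space_return) simp
    show ?thesis
      unfolding normal_law_def using True
      by (auto intro!: integrable_const_bound[where B="\<bar>0 ^ k\<bar>"] simp: AE_return)
  next
    case False
    then show ?thesis
      using assms integrable_normal_moment[of s m k]
      by (simp add: normal_law_def integrable_density normal_density_nonneg)
  qed
  show "(\<integral>x. (x - m) \<partial>normal_law m s) = 0"
  proof (cases "s = 0")
    case False
    then show ?thesis
      using assms integral_normal_moment_odd[of s m 0]
      by (simp add: normal_law_def integral_density normal_density_nonneg)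
  qed (simp add: normal_law_def integral_return)
  show "(\<integral>x. (x - m)\<^sup>2 \<partial>normal_law m s) = s\<^sup>2"
  proof (cases "s = 0")
    case False
    then show ?thesis
      using assms integral_normal_moment_even[of s m 1]
      by (simp add: normal_law_def integral_density normal_density_nonneg)
  qed (simp add: normal_law_def integral_return)
  show "(\<integral>x. (x - m) ^ 4 \<partial>normal_law m s) = 3 * s ^ 4"
  proof (cases "s = 0")
    case False
    then show ?thesis
      using assms integral_normal_moment_even[of s m 2]
      by (simp add: normal_law_def integral_density normal_density_nonneg fact_numeral field_simps)
  qed (simp add: normal_law_def integral_return)
qed

lemma (in prob_space) normal_law_moments_rv:
  assumes [measurable]: "Z \<in> borel_measurable M" and Z: "distr M borel Z = normal_law 0 s" and s: "0 \<le> s"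
  shows "integrable M (\<lambda>\<omega>. Z \<omega> ^ k)" "expectation (\<lambda>\<omega>. (Z \<omega>)\<^sup>2) = s\<^sup>2" "expectation (\<lambda>\<omega>. Z \<omega> ^ 4) = 3 * s ^ 4"
proof -
  show "integrable M (\<lambda>\<omega>. Z \<omega> ^ k)"
    using normal_law_moments(1)[OF s, of 0 k] unfolding Z[symmetric] by (simp add: integrable_distr_eq)
  show "expectation (\<lambda>\<omega>. (Z \<omega>)\<^sup>2) = s\<^sup>2"
    using normal_law_moments(3)[OF s, of 0] unfolding Z[symmetric] by (simp add: integral_distr)
  show "expectation (\<lambda>\<omega>. Z \<omega> ^ 4) = 3 * s ^ 4"
    using normal_law_moments(4)[OF s, of 0] unfolding Z[symmetric] by (simp add: integral_distr)
qed

lemma sum_half_power_dist_le: "(\<Sum>k<N. (1/2::real) ^ ((n - k) + (k - n))) \<le> 4"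
proof -
  have geom: "(\<Sum>j<N. (1/2::real) ^ j) \<le> 2" for N
    using sum_le_suminf[of "\<lambda>j. (1/2::real) ^ j" "{..<N}"] suminf_geometric[of "1/2::real"]
    by (simp add: summable_geometric)
  have "(\<Sum>k<N. (1/2::real) ^ ((n - k) + (k - n))) \<le>
      (\<Sum>k\<in>{..<Suc n} \<union> {n..<n + N}. (1/2::real) ^ ((n - k) + (k - n)))"
    by (intro sum_mono2) auto
  also have "\<dots> \<le> (\<Sum>k<Suc n. (1/2::real) ^ ((n - k) + (k - n))) + (\<Sum>k=n..<n+N. (1/2::real) ^ ((n - k) + (k - n)))"
    by (subst sum.union_inter[symmetric]) (auto intro!: sum_nonneg)
  also have "(\<Sum>k<Suc n. (1/2::real) ^ ((n - k) + (k - n))) = (\<Sum>k<Suc n. (1/2::real) ^ (n - k))"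
    by (intro sum.cong) auto
  also have "\<dots> = (\<Sum>k<Suc n. (1/2::real) ^ k)"
    using sum.nat_diff_reindex[of "\<lambda>k. (1/2::real) ^ k" "Suc n"] by simp
  also have "(\<Sum>k=n..<n+N. (1/2::real) ^ ((n - k) + (k - n))) = (\<Sum>k<N. (1/2::real) ^ k)"
    by (rule sum.reindex_bij_witness[of _ "\<lambda>k. k + n" "\<lambda>k. k - n"]) auto
  finally show ?thesis using geom[of "Suc n"] geom[of N] by linarith
qed

text \<open>
  Bessel's inequality: for an orthonormal sequence the squares of the coefficients \<open>a n\<close> of the
  indicator of \<open>G\<close> are summable. Geometrically decaying inner products only change the constant.\<close>

lemma (in prob_space) almost_orthogonal_tendsto_0:
  fixes f :: "nat \<Rightarrow> 'a \<Rightarrow> real"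
  assumes G[measurable]: "G \<in> events"
    and int: "\<And>n. integrable M (f n)" "\<And>n k. integrable M (\<lambda>\<omega>. f n \<omega> * f k \<omega>)"
    and C: "0 < C" "\<And>n k. \<bar>expectation (\<lambda>\<omega>. f n \<omega> * f k \<omega>)\<bar> \<le> C * (1/2) ^ ((n - k) + (k - n))"
  shows "(\<lambda>n. expectation (\<lambda>\<omega>. f n \<omega> * indicator G \<omega>)) \<longlonglongrightarrow> 0"
proof -
  define a where "a n = expectation (\<lambda>\<omega>. f n \<omega> * indicator G \<omega>)" for n
  have intG: "integrable M (\<lambda>\<omega>. f n \<omega> * indicator G \<omega>)" for n
    using integrable_mult_indicator[OF G int(1)[of n]] by (simp add: mult.commute)
  have bound: "(\<Sum>n<N. (a n)\<^sup>2) \<le> 4 * C" for N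
  proof -
    define S where "S = (\<Sum>n<N. (a n)\<^sup>2)"
    define F where "F \<omega> = (\<Sum>n<N. a n * f n \<omega>)" for \<omega>
    have F2: "(F \<omega>)\<^sup>2 = (\<Sum>n<N. \<Sum>k<N. a n * a k * (f n \<omega> * f k \<omega>))" for \<omega>
      unfolding F_def power2_eq_square sum_product by (simp add: mult_ac)
    have intF2: "integrable M (\<lambda>\<omega>. (F \<omega>)\<^sup>2)"
      unfolding F2 by (intro Bochner_Integration.integrable_sum integrable_mult_right int)
    have intFG: "integrable M (\<lambda>\<omega>. F \<omega> * indicator G \<omega>)"
      unfolding F_def sum_distrib_right mult.assoc
      by (intro Bochner_Integration.integrable_sum integrable_mult_right intG)
    have "expectation (\<lambda>\<omega>. (F \<omega>)\<^sup>2) = (\<Sum>n<N. \<Sum>k<N. a n * a k * expectation (\<lambda>\<omega>. f n \<omega> * f k \<omega>))"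
      unfolding F2 using int by (simp add: Bochner_Integration.integral_sum)
    also have "\<dots> \<le> (\<Sum>n<N. \<Sum>k<N. ((a n)\<^sup>2 / 2 + (a k)\<^sup>2 / 2) * (C * (1/2) ^ ((n - k) + (k - n))))"
    proof (intro sum_mono)
      fix n k
      have "0 \<le> (\<bar>a n\<bar> - \<bar>a k\<bar>)\<^sup>2" by simp
      then have "\<bar>a n * a k\<bar> \<le> (a n)\<^sup>2 / 2 + (a k)\<^sup>2 / 2"
        unfolding power2_diff by (simp add: abs_mult)
      then have "\<bar>a n * a k\<bar> * \<bar>expectation (\<lambda>\<omega>. f n \<omega> * f k \<omega>)\<bar> \<le>
          ((a n)\<^sup>2 / 2 + (a k)\<^sup>2 / 2) * (C * (1/2) ^ ((n - k) + (k - n)))"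
        using C by (intro mult_mono) auto
      then show "a n * a k * expectation (\<lambda>\<omega>. f n \<omega> * f k \<omega>) \<le>
          ((a n)\<^sup>2 / 2 + (a k)\<^sup>2 / 2) * (C * (1/2) ^ ((n - k) + (k - n)))"
        unfolding abs_mult[symmetric, of "a n * a k"] by (rule order_trans[OF abs_ge_self])
    qed
    also have "\<dots> = (\<Sum>n<N. (a n)\<^sup>2 * C * (\<Sum>k<N. (1/2) ^ ((n - k) + (k - n))))"
    proof -
      have "(\<Sum>n<N. \<Sum>k<N. (a k)\<^sup>2 / 2 * (C * (1/2) ^ ((n - k) + (k - n)))) =
          (\<Sum>n<N. \<Sum>k<N. (a n)\<^sup>2 / 2 * (C * (1/2) ^ ((n - k) + (k - n))))"
        by (subst sum.swap) (simp add: add.commute)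
      then have "(\<Sum>n<N. \<Sum>k<N. ((a n)\<^sup>2 / 2 + (a k)\<^sup>2 / 2) * (C * (1/2) ^ ((n - k) + (k - n)))) =
          (\<Sum>n<N. \<Sum>k<N. (a n)\<^sup>2 / 2 * (C * (1/2) ^ ((n - k) + (k - n)))) +
          (\<Sum>n<N. \<Sum>k<N. (a n)\<^sup>2 / 2 * (C * (1/2) ^ ((n - k) + (k - n))))"
        by (simp only: distrib_right sum.distrib)
      also have "\<dots> = (\<Sum>n<N. \<Sum>k<N. (a n)\<^sup>2 * C * (1/2) ^ ((n - k) + (k - n)))"
        unfolding sum.distrib[symmetric] by (intro sum.cong refl) (simp add: field_simps)
      finally show ?thesis by (simp only: sum_distrib_left)
    qed
    also have "\<dots> \<le> (\<Sum>n<N. (a n)\<^sup>2 * C * 4)"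
      using C sum_half_power_dist_le by (intro sum_mono mult_left_mono) auto
    also have "\<dots> = 4 * C * S" by (simp add: S_def sum_distrib_left mult_ac)
    finally have EF2: "expectation (\<lambda>\<omega>. (F \<omega>)\<^sup>2) \<le> 4 * C * S" .
    \<comment> \<open>Cauchy-Schwarz would give \<open>S\<^sup>2 \<le> E F\<^sup>2 \<le> 4 * C * S\<close>; the constant \<open>4 * C\<close> below linearises it\<close>
    have "S = expectation (\<lambda>\<omega>. F \<omega> * indicator G \<omega>)"
      unfolding F_def sum_distrib_right mult.assoc S_def
      using intG by (subst Bochner_Integration.integral_sum) (auto simp: a_def power2_eq_square)
    also have "\<dots> \<le> expectation (\<lambda>\<omega>. 2 * C + (F \<omega>)\<^sup>2 / (8 * C))"
    proof (rule integral_mono[OF intFG])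
      show "integrable M (\<lambda>\<omega>. 2 * C + (F \<omega>)\<^sup>2 / (8 * C))" using intF2 by simp
      fix \<omega>
      have "0 \<le> (F \<omega> - 4 * C)\<^sup>2 / (8 * C)" using C by simp
      also have "\<dots> = 2 * C + (F \<omega>)\<^sup>2 / (8 * C) - F \<omega>" using C by (simp add: power2_eq_square field_simps)
      finally have "F \<omega> \<le> 2 * C + (F \<omega>)\<^sup>2 / (8 * C)" by simp
      moreover have "0 \<le> 2 * C + (F \<omega>)\<^sup>2 / (8 * C)" using C by simp
      ultimately show "F \<omega> * indicator G \<omega> \<le> 2 * C + (F \<omega>)\<^sup>2 / (8 * C)" by (simp add: indicator_def)
    qed
    also have "\<dots> = 2 * C + expectation (\<lambda>\<omega>. (F \<omega>)\<^sup>2) / (8 * C)" using intF2 by (simp add: prob_space)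
    also have "\<dots> \<le> 2 * C + (4 * C * S) / (8 * C)" using EF2 C by (intro add_left_mono divide_right_mono) auto
    also have "\<dots> = 2 * C + S / 2" using C by simp
    finally show ?thesis by (simp add: S_def)
  qed
  have "summable (\<lambda>n. (a n)\<^sup>2)" using bound by (intro summableI_nonneg_bounded) auto
  then have "(\<lambda>n. (a n)\<^sup>2) \<longlonglongrightarrow> 0" by (rule summable_LIMSEQ_zero)
  then have "(\<lambda>n. sqrt ((a n)\<^sup>2)) \<longlonglongrightarrow> sqrt 0" by (rule tendsto_real_sqrt)
  then show ?thesis by (simp add: a_def tendsto_rabs_zero_iff)
qed

text \<open>
  Increments of a Brownian bridge over nested intervals of lengths \<open>h\<close> with a common end point. Only
  the laws of combinations of two increments are recorded, as polarisation turns their moments into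
  the mixed moments of order four.\<close>

locale bridge_increments = prob_space M for M :: "'a measure" +
  fixes g :: "real \<Rightarrow> 'a \<Rightarrow> real" and h0 :: real
  assumes h0: "0 < h0" "h0 \<le> 1"
    and g_meas: "\<And>h. 0 < h \<Longrightarrow> h \<le> h0 \<Longrightarrow> g h \<in> borel_measurable M"
    and g_normal: "\<And>h k a b. 0 < h \<Longrightarrow> h \<le> h0 \<Longrightarrow> 0 < k \<Longrightarrow> k \<le> h0 \<Longrightarrow>
        \<exists>s\<ge>0. distr M borel (\<lambda>\<omega>. a * g h \<omega> + b * g k \<omega>) = normal_law 0 s"
    and g_cov: "\<And>h k. 0 < h \<Longrightarrow> h \<le> h0 \<Longrightarrow> 0 < k \<Longrightarrow> k \<le> h0 \<Longrightarrow>
        expectation (\<lambda>\<omega>. g h \<omega> * g k \<omega>) = min h k - h * k"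
begin

text \<open>
  The mixed fourth moment comes from \<open>12 x\<^sup>2 y\<^sup>2 = (x + y)\<^sup>4 + (x - y)\<^sup>4 - 2 x\<^sup>4 - 2 y\<^sup>4\<close> and
  \<open>E Z\<^sup>4 = 3 (E Z\<^sup>2)\<^sup>2\<close> for the four centred normal variables involved.\<close>

lemma g_moments:
  assumes h: "0 < h" "h \<le> h0" and k: "0 < k" "k \<le> h0"
  defines "c \<equiv> min h k - h * k"
  shows "integrable M (\<lambda>\<omega>. g h \<omega> ^ n)" "integrable M (\<lambda>\<omega>. g h \<omega> * g k \<omega>)"
    "integrable M (\<lambda>\<omega>. (g h \<omega>)\<^sup>2 * (g k \<omega>)\<^sup>2)"
    "expectation (\<lambda>\<omega>. (g h \<omega>)\<^sup>2) = h - h\<^sup>2"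
    "expectation (\<lambda>\<omega>. g h \<omega> ^ 4) = 3 * (h - h\<^sup>2)\<^sup>2"
    "expectation (\<lambda>\<omega>. (g h \<omega>)\<^sup>2 * (g k \<omega>)\<^sup>2) = (h - h\<^sup>2) * (k - k\<^sup>2) + 2 * c\<^sup>2"
proof -
  have [measurable]: "g h \<in> borel_measurable M" "g k \<in> borel_measurable M" using g_meas h k by auto
  have E2: "expectation (\<lambda>\<omega>. (g h \<omega>)\<^sup>2) = h - h\<^sup>2" if "0 < h" "h \<le> h0" for h
    using g_cov[OF that that] by (simp add: power2_eq_square)
  have int: "integrable M (\<lambda>\<omega>. g h \<omega> ^ n)" and E4: "expectation (\<lambda>\<omega>. g h \<omega> ^ 4) = 3 * (h - h\<^sup>2)\<^sup>2"
    if hh: "0 < h" "h \<le> h0" for h n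
  proof -
    have [measurable]: "g h \<in> borel_measurable M" using g_meas that by auto
    obtain s where s: "0 \<le> s" "distr M borel (g h) = normal_law 0 s"
      using g_normal[OF hh hh, of 1 0] by auto
    note m = normal_law_moments_rv[OF _ s(2,1)]
    show "integrable M (\<lambda>\<omega>. g h \<omega> ^ n)" by (rule m(1)) simp
    have "s ^ 4 = (s\<^sup>2)\<^sup>2" by simp
    then show "expectation (\<lambda>\<omega>. g h \<omega> ^ 4) = 3 * (h - h\<^sup>2)\<^sup>2" using m(2,3) E2[OF hh] by simp
  qed
  show "integrable M (\<lambda>\<omega>. g h \<omega> ^ n)" "expectation (\<lambda>\<omega>. (g h \<omega>)\<^sup>2) = h - h\<^sup>2"
    "expectation (\<lambda>\<omega>. g h \<omega> ^ 4) = 3 * (h - h\<^sup>2)\<^sup>2"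
    using int[OF h] E2[OF h] E4[OF h] by auto
  have sum_normal: "integrable M (\<lambda>\<omega>. (g h \<omega> + b * g k \<omega>) ^ n)" 
    "expectation (\<lambda>\<omega>. (g h \<omega> + b * g k \<omega>) ^ 4) = 3 * (expectation (\<lambda>\<omega>. (g h \<omega> + b * g k \<omega>)\<^sup>2))\<^sup>2" for b n
  proof -
    obtain s where s: "0 \<le> s" "distr M borel (\<lambda>\<omega>. g h \<omega> + b * g k \<omega>) = normal_law 0 s"
      using g_normal[OF h k, of 1 b] by auto
    note m = normal_law_moments_rv[OF _ s(2,1)]
    show "integrable M (\<lambda>\<omega>. (g h \<omega> + b * g k \<omega>) ^ n)" by (rule m(1)) simp
    have "s ^ 4 = (s\<^sup>2)\<^sup>2" by simp
    then show "expectation (\<lambda>\<omega>. (g h \<omega> + b * g k \<omega>) ^ 4) = 3 * (expectation (\<lambda>\<omega>. (g h \<omega> + b * g k \<omega>)\<^sup>2))\<^sup>2"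
      using m(2,3) by simp
  qed
  have hk: "g h \<omega> * g k \<omega> = ((g h \<omega> + 1 * g k \<omega>)\<^sup>2 - (g h \<omega>)\<^sup>2 - (g k \<omega>)\<^sup>2) / 2" for \<omega>
    by (simp add: power2_eq_square algebra_simps)
  show int_hk: "integrable M (\<lambda>\<omega>. g h \<omega> * g k \<omega>)"
    unfolding hk by (intro integrable_divide Bochner_Integration.integrable_diff sum_normal int h k)
  have sq: "expectation (\<lambda>\<omega>. (g h \<omega> + b * g k \<omega>)\<^sup>2) = (h - h\<^sup>2) + 2 * b * c + b\<^sup>2 * (k - k\<^sup>2)" for b
  proof -
    have "(g h \<omega> + b * g k \<omega>)\<^sup>2 = (g h \<omega>)\<^sup>2 + 2 * b * (g h \<omega> * g k \<omega>) + b\<^sup>2 * (g k \<omega>)\<^sup>2" for \<omega>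
      by (simp add: power2_eq_square algebra_simps)
    then show ?thesis
      using int_hk int[OF h, of 2] int[OF k, of 2] E2[OF h] E2[OF k] g_cov[OF h k] by (simp add: c_def)
  qed
  have quartic: "(g h \<omega>)\<^sup>2 * (g k \<omega>)\<^sup>2 =
      ((g h \<omega> + 1 * g k \<omega>) ^ 4 + (g h \<omega> + (- 1) * g k \<omega>) ^ 4 - 2 * g h \<omega> ^ 4 - 2 * g k \<omega> ^ 4) / 12" for \<omega>
    by (simp add: power2_eq_square power4_eq_xxxx algebra_simps)
  show "integrable M (\<lambda>\<omega>. (g h \<omega>)\<^sup>2 * (g k \<omega>)\<^sup>2)"
    unfolding quartic
    by (intro integrable_divide Bochner_Integration.integrable_diff Bochner_Integration.integrable_add
        integrable_mult_right sum_normal int h k)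
  have "expectation (\<lambda>\<omega>. (g h \<omega>)\<^sup>2 * (g k \<omega>)\<^sup>2) =
      (3 * ((h - h\<^sup>2) + 2 * 1 * c + 1\<^sup>2 * (k - k\<^sup>2))\<^sup>2 + 3 * ((h - h\<^sup>2) + 2 * (- 1) * c + (- 1)\<^sup>2 * (k - k\<^sup>2))\<^sup>2
        - 2 * (3 * (h - h\<^sup>2)\<^sup>2) - 2 * (3 * (k - k\<^sup>2)\<^sup>2)) / 12"
    unfolding quartic sq[symmetric] sum_normal(2)[symmetric] E4[OF h, symmetric] E4[OF k, symmetric]
    using sum_normal(1)[of 1 4] sum_normal(1)[of "-1" 4] int[OF h, of 4] int[OF k, of 4]
    by (simp del: mult_1 mult_minus1)
  also have "\<dots> = (h - h\<^sup>2) * (k - k\<^sup>2) + 2 * c\<^sup>2"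
  proof -
    have "(3 * (v + 2 * 1 * c + 1\<^sup>2 * w)\<^sup>2 + 3 * (v + 2 * (- 1) * c + (- 1)\<^sup>2 * w)\<^sup>2
        - 2 * (3 * v\<^sup>2) - 2 * (3 * w\<^sup>2)) / 12 = v * w + 2 * c\<^sup>2" for v w :: real
      by (simp add: power2_eq_square field_simps)
    then show ?thesis .
  qed
  finally show "expectation (\<lambda>\<omega>. (g h \<omega>)\<^sup>2 * (g k \<omega>)\<^sup>2) = (h - h\<^sup>2) * (k - k\<^sup>2) + 2 * c\<^sup>2" .
qed

text \<open>
  On an event \<open>G\<close> on which the slopes along \<open>h n\<close> are eventually at most \<open>K\<close>, the positive part of \<open>\<xi> n\<close> is
  bounded by \<open>((K + \<bar>\<alpha>\<bar>) * h n + \<bar>Z\<bar>) / (\<sigma> * r n)\<close>, where \<open>Z\<close> is the remainder and \<open>r n = sqrt (h n)\<close>; its mean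
  tends to \<open>0\<close>. Integrating \<open>x\<^sup>2 \<le> A \<bar>x\<bar> + x\<^sup>4 / A\<^sup>2\<close> with \<open>\<bar>x\<bar> = 2 max 0 x - x\<close> over \<open>G\<close> and letting \<open>n\<close> tend to
  infinity leaves \<open>P G \<le> 3 / A\<^sup>2\<close> for every \<open>A\<close>.\<close>

lemma unbounded_slope_AE:
  fixes D :: "real \<Rightarrow> 'a \<Rightarrow> real" and \<alpha> \<sigma> :: real
  assumes \<sigma>: "0 < \<sigma>"
    and D_meas: "\<And>h. 0 < h \<Longrightarrow> h \<le> h0 \<Longrightarrow> D h \<in> borel_measurable M"
    and small: "\<And>\<epsilon>. 0 < \<epsilon> \<Longrightarrow> \<exists>h1>0. \<forall>h. 0 < h \<longrightarrow> h \<le> h1 \<longrightarrow> h \<le> h0 \<longrightarrow>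
        integrable M (\<lambda>\<omega>. \<bar>D h \<omega> - \<alpha> * h - \<sigma> * g h \<omega>\<bar>) \<and>
        expectation (\<lambda>\<omega>. \<bar>D h \<omega> - \<alpha> * h - \<sigma> * g h \<omega>\<bar>) \<le> \<epsilon> * sqrt h"
  shows "AE \<omega> in M. \<forall>K \<epsilon>. 0 < \<epsilon> \<longrightarrow> (\<exists>s. 0 < s \<and> s < \<epsilon> \<and> s \<le> h0 \<and> K * s \<le> D s \<omega>)"
proof -
  define r where "r n = sqrt h0 / 2 ^ n" for n :: nat
  define h where "h n = (r n)\<^sup>2" for n
  have r: "0 < r n" for n using h0 by (simp add: r_def)
  have h_eq: "h n = h0 / 4 ^ n" for n
    using h0 by (simp add: h_def r_def power_divide power_mult[symmetric] mult.commute[of n])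
      (simp add: power_mult)
  have h: "0 < h n" "h n \<le> h0" for n
    using h0 by (auto simp: h_eq divide_le_eq)
  have h1: "h n \<le> 1" for n using h[of n] h0 by simp
  have sqrt_h: "sqrt (h n) = r n" for n using r[of n] by (simp add: h_def)
  have h_lim: "h \<longlonglongrightarrow> 0"
    unfolding h_eq[abs_def] using LIMSEQ_divide_realpow_zero[of 4 h0] by simp
  have r_lim: "r \<longlonglongrightarrow> 0"
    unfolding r_def[abs_def] using LIMSEQ_divide_realpow_zero[of 2 "sqrt h0"] by simp
  have [measurable]: "g (h n) \<in> borel_measurable M" "D (h n) \<in> borel_measurable M" for n
    using g_meas D_meas h by auto
  define \<xi> where "\<xi> n \<omega> = g (h n) \<omega> / r n" for n \<omega>
  have [measurable]: "\<xi> n \<in> borel_measurable M" for n unfolding \<xi>_def by measurable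
  note gm = g_moments[OF h h]
  define \<rho> where "\<rho> n k = (min (h n) (h k) - h n * h k) / (r n * r k)" for n k
  have \<rho>: "0 \<le> \<rho> n k" "\<rho> n k \<le> (1/2) ^ ((n - k) + (k - n))" for n k
  proof -
    have "h n * h k \<le> min (h n) (h k)"
      using h h1 mult_left_le[of "h k" "h n"] mult_left_le[of "h n" "h k"]
      by (auto simp: mult.commute less_imp_le)
    then show "0 \<le> \<rho> n k" using r[of n] r[of k] by (simp add: \<rho>_def)
    have main: "min (h n) (h k) / (r n * r k) = (1/2) ^ (k - n)" if "n \<le> k" for n k
    proof -
      have rk: "r k = r n * (1/2) ^ (k - n)"
      proof -
        have "(2::real) ^ k = 2 ^ n * 2 ^ (k - n)" using that by (simp add: power_add[symmetric])
        then show ?thesis by (simp add: r_def power_one_over)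
      qed
      have "r k \<le> r n" unfolding rk using r[of n] by (simp add: mult_left_le power_le_one)
      then have "h k \<le> h n" unfolding h_def using r[of k] by (intro power_mono) auto
      then have "min (h n) (h k) / (r n * r k) = r k / r n"
        using r[of k] by (simp add: h_def power2_eq_square)
      then show ?thesis using r[of n] by (simp add: rk)
    qed
    have "min (h n) (h k) - h n * h k \<le> min (h n) (h k)"
      using mult_pos_pos[OF h(1)[of n] h(1)[of k]] by linarith
    then have "\<rho> n k \<le> min (h n) (h k) / (r n * r k)"
      unfolding \<rho>_def using r[of n] r[of k] by (intro divide_right_mono) auto
    also have "\<dots> = (1/2) ^ ((n - k) + (k - n))"
      using main[of n k] main[of k n] by (cases "n \<le> k") (auto simp: min.commute mult.commute)
    finally show "\<rho> n k \<le> (1/2) ^ ((n - k) + (k - n))" .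
  qed
  have int_\<xi>: "integrable M (\<lambda>\<omega>. \<xi> n \<omega> ^ j)" for n j
    unfolding \<xi>_def power_divide by (intro integrable_divide gm(1))
  have int_\<xi>\<xi>: "integrable M (\<lambda>\<omega>. \<xi> n \<omega> * \<xi> k \<omega>)" for n k
    unfolding \<xi>_def using gm(2)[of n k] by simp
  have E\<xi>\<xi>: "expectation (\<lambda>\<omega>. \<xi> n \<omega> * \<xi> k \<omega>) = \<rho> n k" for n k
    unfolding \<xi>_def \<rho>_def using g_cov[OF h[of n] h[of k]] by simp
  define v where "v n = 1 - h n" for n
  have v: "0 \<le> v n" "v n \<le> 1" for n using h[of n] h1[of n] by (auto simp: v_def)
  have v_lim: "v \<longlonglongrightarrow> 1" unfolding v_def[abs_def] using tendsto_diff[OF tendsto_const h_lim, of 1] by simp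
  have hv: "h n - (h n)\<^sup>2 = (r n)\<^sup>2 * v n" for n by (simp add: v_def h_def power2_eq_square algebra_simps)
  have E\<xi>2: "expectation (\<lambda>\<omega>. (\<xi> n \<omega>)\<^sup>2) = v n" for n
    unfolding \<xi>_def power_divide using gm(4)[of n] hv[of n] r[of n] by simp
  have E\<xi>4: "expectation (\<lambda>\<omega>. \<xi> n \<omega> ^ 4) \<le> 3" for n
  proof -
    have "expectation (\<lambda>\<omega>. \<xi> n \<omega> ^ 4) = 3 * (v n)\<^sup>2"
      unfolding \<xi>_def power_divide using gm(5)[of n] hv[of n] r[of n]
      by (simp add: power_mult_distrib flip: power_mult)
    then show ?thesis using v[of n] by (simp add: power_le_one)
  qed
  have int22: "integrable M (\<lambda>\<omega>. (\<xi> n \<omega>)\<^sup>2 * (\<xi> k \<omega>)\<^sup>2)" for n k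
    unfolding \<xi>_def power_divide using gm(3)[of n k] by simp
  have E22: "expectation (\<lambda>\<omega>. (\<xi> n \<omega>)\<^sup>2 * (\<xi> k \<omega>)\<^sup>2) = v n * v k + 2 * (\<rho> n k)\<^sup>2" for n k
  proof -
    have "expectation (\<lambda>\<omega>. (\<xi> n \<omega>)\<^sup>2 * (\<xi> k \<omega>)\<^sup>2) =
        ((r n)\<^sup>2 * v n * ((r k)\<^sup>2 * v k) + 2 * (min (h n) (h k) - h n * h k)\<^sup>2) / ((r n)\<^sup>2 * (r k)\<^sup>2)"
      unfolding \<xi>_def power_divide hv[symmetric] gm(6)[of n k, symmetric] by simp
    also have "\<dots> = v n * v k + 2 * (\<rho> n k)\<^sup>2"
      unfolding \<rho>_def power_divide power_mult_distrib using r[of n] r[of k] by (simp add: field_simps)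
    finally show ?thesis .
  qed
  have bad_null: "prob {\<omega> \<in> space M. \<forall>n\<ge>n0. D (h n) \<omega> \<le> K * h n} = 0" if K: "0 \<le> K" for K :: real and n0
  proof -
    define G where "G = {\<omega> \<in> space M. \<forall>n\<ge>n0. D (h n) \<omega> \<le> K * h n}"
    have G[measurable]: "G \<in> events" unfolding G_def by measurable
    have a_lim: "(\<lambda>n. expectation (\<lambda>\<omega>. \<xi> n \<omega> * indicator G \<omega>)) \<longlonglongrightarrow> 0"
    proof (rule almost_orthogonal_tendsto_0[OF G, where C=1])
      show "\<bar>expectation (\<lambda>\<omega>. \<xi> n \<omega> * \<xi> k \<omega>)\<bar> \<le> 1 * (1/2) ^ ((n - k) + (k - n))" for n k
        using \<rho>[of n k] by (simp add: E\<xi>\<xi>)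
    qed (use int_\<xi>[of _ 1] int_\<xi>\<xi> in auto)
    have b_lim: "(\<lambda>n. expectation (\<lambda>\<omega>. ((\<xi> n \<omega>)\<^sup>2 - v n) * indicator G \<omega>)) \<longlonglongrightarrow> 0"
    proof (rule almost_orthogonal_tendsto_0[OF G, where C=2])
      have eq: "((\<xi> n \<omega>)\<^sup>2 - v n) * ((\<xi> k \<omega>)\<^sup>2 - v k) =
          (\<xi> n \<omega>)\<^sup>2 * (\<xi> k \<omega>)\<^sup>2 - v n * (\<xi> k \<omega>)\<^sup>2 - v k * (\<xi> n \<omega>)\<^sup>2 + v n * v k" for n k \<omega>
        by (simp add: algebra_simps)
      show "integrable M (\<lambda>\<omega>. ((\<xi> n \<omega>)\<^sup>2 - v n) * ((\<xi> k \<omega>)\<^sup>2 - v k))" for n k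
        unfolding eq using int22 int_\<xi>[of _ 2] by simp
      have "expectation (\<lambda>\<omega>. ((\<xi> n \<omega>)\<^sup>2 - v n) * ((\<xi> k \<omega>)\<^sup>2 - v k)) = 2 * (\<rho> n k)\<^sup>2" for n k
        unfolding eq using int22 int_\<xi>[of _ 2] by (simp add: E22 E\<xi>2 prob_space)
      moreover have "(\<rho> n k)\<^sup>2 \<le> (1/2) ^ ((n - k) + (k - n))" for n k
      proof -
        have "(1/2::real) ^ ((n - k) + (k - n)) \<le> 1" by (rule power_le_one) auto
        then have "\<rho> n k \<le> 1" using \<rho>(2)[of n k] by linarith
        then have "(\<rho> n k)\<^sup>2 \<le> \<rho> n k"
          using \<rho>(1)[of n k] mult_left_le[of "\<rho> n k" "\<rho> n k"] by (simp add: power2_eq_square)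
        then show ?thesis using \<rho>(2)[of n k] by linarith
      qed
      ultimately show "\<bar>expectation (\<lambda>\<omega>. ((\<xi> n \<omega>)\<^sup>2 - v n) * ((\<xi> k \<omega>)\<^sup>2 - v k))\<bar> \<le> 2 * (1/2) ^ ((n - k) + (k - n))" for n k
        by simp
    qed (use int_\<xi>[of _ 2] in auto)
    have intG: "integrable M (\<lambda>\<omega>. X \<omega> * indicator G \<omega>)" if "integrable M X" for X :: "'a \<Rightarrow> real"
      using integrable_mult_indicator[OF G that] by (simp add: mult.commute)
    define e where "e n = expectation (\<lambda>\<omega>. max 0 (\<xi> n \<omega>) * indicator G \<omega>)" for n
    have int_max: "integrable M (\<lambda>\<omega>. max 0 (\<xi> n \<omega>))" for n
      using int_\<xi>[of n 1] by simp
    have e_lim: "e \<longlonglongrightarrow> 0"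
    proof (rule tendstoI)
      fix \<epsilon> :: real assume \<epsilon>: "0 < \<epsilon>"
      define \<eta> where "\<eta> = \<epsilon> * \<sigma> / 2"
      have \<eta>: "0 < \<eta>" using \<epsilon> \<sigma> by (simp add: \<eta>_def)
      obtain h' where h': "0 < h'" and sm: "\<And>h. 0 < h \<Longrightarrow> h \<le> h' \<Longrightarrow> h \<le> h0 \<Longrightarrow>
        integrable M (\<lambda>\<omega>. \<bar>D h \<omega> - \<alpha> * h - \<sigma> * g h \<omega>\<bar>) \<and>
        expectation (\<lambda>\<omega>. \<bar>D h \<omega> - \<alpha> * h - \<sigma> * g h \<omega>\<bar>) \<le> \<eta> * sqrt h"
        using small[OF \<eta>] by blast
      have "\<forall>\<^sub>F n in sequentially. h n < h'" by (rule order_tendstoD(2)[OF h_lim h'])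
      moreover have "\<forall>\<^sub>F n in sequentially. (K + \<bar>\<alpha>\<bar>) * r n < \<eta>"
        using tendsto_mult_right_zero[OF r_lim, of "K + \<bar>\<alpha>\<bar>"] \<eta> by (rule order_tendstoD(2))
      ultimately show "\<forall>\<^sub>F n in sequentially. dist (e n) 0 < \<epsilon>"
        using eventually_ge_at_top[of n0]
      proof eventually_elim
        case (elim n)
        define Z where "Z \<omega> = \<bar>D (h n) \<omega> - \<alpha> * h n - \<sigma> * g (h n) \<omega>\<bar>" for \<omega>
        have Z: "integrable M Z" "expectation Z \<le> \<eta> * r n"
          using sm[OF h(1) _ h(2), of n] elim sqrt_h[of n] by (auto simp: Z_def[abs_def])
        have "e n \<le> expectation (\<lambda>\<omega>. ((K + \<bar>\<alpha>\<bar>) * h n + Z \<omega>) / (\<sigma> * r n))"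
          unfolding e_def
        proof (rule integral_mono[OF intG[OF int_max]])
          fix \<omega>
          have nn: "0 \<le> ((K + \<bar>\<alpha>\<bar>) * h n + Z \<omega>) / (\<sigma> * r n)"
            using K h[of n] \<sigma> r[of n] by (auto simp: Z_def intro!: divide_nonneg_nonneg add_nonneg_nonneg)
          show "max 0 (\<xi> n \<omega>) * indicator G \<omega> \<le> ((K + \<bar>\<alpha>\<bar>) * h n + Z \<omega>) / (\<sigma> * r n)"
          proof (cases "\<omega> \<in> G")
            case True
            then have "D (h n) \<omega> \<le> K * h n" using elim by (simp add: G_def)
            moreover have "- \<alpha> * h n \<le> \<bar>\<alpha>\<bar> * h n" using h[of n] by (intro mult_right_mono) auto
            ultimately have "\<sigma> * g (h n) \<omega> \<le> (K + \<bar>\<alpha>\<bar>) * h n + Z \<omega>"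
              unfolding Z_def distrib_right by linarith
            then have "\<xi> n \<omega> \<le> ((K + \<bar>\<alpha>\<bar>) * h n + Z \<omega>) / (\<sigma> * r n)"
              using \<sigma> r[of n] by (simp add: \<xi>_def field_simps)
            then show ?thesis using nn True by simp
          qed (use nn in simp)
        qed (use Z in simp)
        also have "\<dots> = ((K + \<bar>\<alpha>\<bar>) * h n + expectation Z) / (\<sigma> * r n)"
          using Z by (simp add: prob_space)
        also have "\<dots> \<le> ((K + \<bar>\<alpha>\<bar>) * h n + \<eta> * r n) / (\<sigma> * r n)"
          using Z \<sigma> r[of n] by (intro divide_right_mono) auto
        also have "\<dots> = ((K + \<bar>\<alpha>\<bar>) * r n + \<eta>) / \<sigma>"
          using \<sigma> r[of n] by (simp add: h_def power2_eq_square field_simps)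
        also have "\<dots> < (\<eta> + \<eta>) / \<sigma>" using elim \<sigma> by (intro divide_strict_right_mono) auto
        also have "\<dots> = \<epsilon>" using \<sigma> by (simp add: \<eta>_def)
        finally have "e n < \<epsilon>" .
        moreover have "0 \<le> e n" unfolding e_def by (rule Bochner_Integration.integral_nonneg) (simp add: indicator_def)
        ultimately show ?case by simp
      qed
    qed
    have P_le: "prob G \<le> 3 / A\<^sup>2" if A: "0 < A" for A
    proof -
      have ineq: "expectation (\<lambda>\<omega>. ((\<xi> n \<omega>)\<^sup>2 - v n) * indicator G \<omega>) + v n * prob G \<le>
          2 * A * e n - A * expectation (\<lambda>\<omega>. \<xi> n \<omega> * indicator G \<omega>) + 3 / A\<^sup>2" for n
      proof -
        have iG: "integrable M (indicator G :: 'a \<Rightarrow> real)"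
          by (rule integrable_real_indicator) (auto simp: emeasure_eq_measure)
        have i1: "integrable M (\<lambda>\<omega>. ((\<xi> n \<omega>)\<^sup>2 - v n) * indicator G \<omega>)"
          using int_\<xi>[of n 2] by (intro intG) simp
        have i2: "integrable M (\<lambda>\<omega>. max 0 (\<xi> n \<omega>) * indicator G \<omega>)" by (rule intG[OF int_max])
        have i3: "integrable M (\<lambda>\<omega>. \<xi> n \<omega> * indicator G \<omega>)" using int_\<xi>[of n 1] by (intro intG) simp
        have "expectation (\<lambda>\<omega>. ((\<xi> n \<omega>)\<^sup>2 - v n) * indicator G \<omega>) + v n * prob G =
            expectation (\<lambda>\<omega>. ((\<xi> n \<omega>)\<^sup>2 - v n) * indicator G \<omega> + v n * indicator G \<omega>)"
          using i1 iG by simp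
        also have "\<dots> \<le> expectation (\<lambda>\<omega>. 2 * A * (max 0 (\<xi> n \<omega>) * indicator G \<omega>) - A * (\<xi> n \<omega> * indicator G \<omega>) + \<xi> n \<omega> ^ 4 / A\<^sup>2)"
        proof (rule integral_mono)
          fix \<omega>
          have "(\<xi> n \<omega>)\<^sup>2 \<le> A * \<bar>\<xi> n \<omega>\<bar> + \<xi> n \<omega> ^ 4 / A\<^sup>2"
          proof (cases "\<bar>\<xi> n \<omega>\<bar> \<le> A")
            case True
            then have "\<bar>\<xi> n \<omega>\<bar> * \<bar>\<xi> n \<omega>\<bar> \<le> A * \<bar>\<xi> n \<omega>\<bar>" by (intro mult_right_mono) auto
            then show ?thesis using A by (simp add: power2_eq_square add_increasing2)
          next
            case False
            then have "A\<^sup>2 \<le> \<bar>\<xi> n \<omega>\<bar>\<^sup>2" using A by (intro power_mono) auto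
            then have "(\<xi> n \<omega>)\<^sup>2 * A\<^sup>2 \<le> (\<xi> n \<omega>)\<^sup>2 * (\<xi> n \<omega>)\<^sup>2" by (intro mult_left_mono) auto
            then have "(\<xi> n \<omega>)\<^sup>2 \<le> \<xi> n \<omega> ^ 4 / A\<^sup>2" using A by (simp add: field_simps flip: power_add)
            then show ?thesis using A by (simp add: add_increasing)
          qed
          moreover have "\<bar>\<xi> n \<omega>\<bar> = 2 * max 0 (\<xi> n \<omega>) - \<xi> n \<omega>" by simp
          ultimately have "(\<xi> n \<omega>)\<^sup>2 \<le> A * (2 * max 0 (\<xi> n \<omega>) - \<xi> n \<omega>) + \<xi> n \<omega> ^ 4 / A\<^sup>2" by metis
          then show "((\<xi> n \<omega>)\<^sup>2 - v n) * indicator G \<omega> + v n * indicator G \<omega> \<le>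
              2 * A * (max 0 (\<xi> n \<omega>) * indicator G \<omega>) - A * (\<xi> n \<omega> * indicator G \<omega>) + \<xi> n \<omega> ^ 4 / A\<^sup>2"
            using A by (cases "\<omega> \<in> G") (auto simp: algebra_simps)
        qed (use i1 i2 i3 iG int_\<xi>[of n 4] in auto)
        also have "\<dots> = 2 * A * e n - A * expectation (\<lambda>\<omega>. \<xi> n \<omega> * indicator G \<omega>) + expectation (\<lambda>\<omega>. \<xi> n \<omega> ^ 4) / A\<^sup>2"
          unfolding e_def using i2 i3 int_\<xi>[of n 4] by simp
        also have "\<dots> \<le> 2 * A * e n - A * expectation (\<lambda>\<omega>. \<xi> n \<omega> * indicator G \<omega>) + 3 / A\<^sup>2"
          using E\<xi>4[of n] by (intro add_left_mono divide_right_mono) auto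
        finally show ?thesis .
      qed
      have "0 + 1 * prob G \<le> 2 * A * 0 - A * 0 + 3 / A\<^sup>2"
        by (rule LIMSEQ_le[OF tendsto_add[OF b_lim tendsto_mult[OF v_lim tendsto_const]]
              tendsto_add[OF tendsto_diff[OF tendsto_mult[OF tendsto_const e_lim] tendsto_mult[OF tendsto_const a_lim]] tendsto_const]])
           (use ineq in blast)
      then show ?thesis by simp
    qed
    have "prob G = 0"
    proof (rule ccontr)
      assume "prob G \<noteq> 0"
      then have pos: "0 < prob G" by (simp add: zero_less_measure_iff)
      \<comment> \<open>at this \<open>A\<close> the bound reads \<open>P G \<le> 3/4 * (P G)\<^sup>2\<close>\<close>
      from P_le[of "2 / prob G"] pos have "prob G \<le> 3 / 4 * (prob G * prob G)"
        by (simp add: power2_eq_square)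
      also have "\<dots> \<le> 3 / 4 * (prob G * 1)" using pos by (intro mult_left_mono) auto
      finally show False using pos by simp
    qed
    then show ?thesis by (simp add: G_def)
  qed
  have "AE \<omega> in M. \<forall>q n0 :: nat. \<not> (\<forall>n\<ge>n0. D (h n) \<omega> \<le> real q * h n)"
    unfolding AE_all_countable
  proof (intro allI)
    fix q n0 :: nat
    have "{\<omega> \<in> space M. \<forall>n\<ge>n0. D (h n) \<omega> \<le> real q * h n} \<in> null_sets M"
      using bad_null[of "real q" n0] by (auto simp: null_sets_def emeasure_eq_measure)
    from AE_not_in[OF this] AE_space show "AE \<omega> in M. \<not> (\<forall>n\<ge>n0. D (h n) \<omega> \<le> real q * h n)"
      by eventually_elim auto
  qed
  then show ?thesis
  proof eventually_elim
    case (elim \<omega>)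
    show ?case
    proof (intro allI impI)
      fix K \<epsilon> :: real assume \<epsilon>: "0 < \<epsilon>"
      obtain q :: nat where q: "K \<le> q" using real_arch_simple by blast
      obtain n0 where n0: "\<And>n. n0 \<le> n \<Longrightarrow> h n < \<epsilon>"
        using order_tendstoD(2)[OF h_lim \<epsilon>] by (auto simp: eventually_sequentially)
      obtain n where n: "n0 \<le> n" "\<not> D (h n) \<omega> \<le> real q * h n" using elim by blast
      have "K * h n \<le> real q * h n" using q h[of n] by (intro mult_right_mono) auto
      then have "K * h n \<le> D (h n) \<omega>" using n(2) by linarith
      then show "\<exists>s. 0 < s \<and> s < \<epsilon> \<and> s \<le> h0 \<and> K * s \<le> D s \<omega>"
        using n n0 h[of n] by (intro exI[of _ "h n"]) auto
    qed
  qed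
qed

end

section \<open>Oscillation of one-sided increments\<close>

context uniform_arrivals
begin

text \<open>
  Finitely many jumps contribute \<open>O (h)\<close> in mean, and the remaining ones at most \<open>sqrt (h * \<rho>)\<close>, where
  \<open>\<rho>\<close> is the tail of the series of \<open>(\<beta> i)\<^sup>2\<close>. Fatou's lemma passes from partial sums to the limit.\<close>

lemma limit_small_in_mean:
  assumes sq: "summable (\<lambda>i. (\<beta> i)\<^sup>2)" and \<epsilon>: "0 < \<epsilon>"
    and Z_meas: "\<And>h. 0 < h \<Longrightarrow> h \<le> h0 \<Longrightarrow> Z h \<in> borel_measurable M"
    and lim: "\<And>h. 0 < h \<Longrightarrow> h \<le> h0 \<Longrightarrow> AE \<omega> in M. (\<lambda>n. Y \<beta> {..<n} h \<omega>) \<longlonglongrightarrow> Z h \<omega>"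
  shows "\<exists>h1>0. \<forall>h. 0 < h \<longrightarrow> h \<le> h1 \<longrightarrow> h \<le> h0 \<longrightarrow>
    integrable M (\<lambda>\<omega>. \<bar>Z h \<omega>\<bar>) \<and> expectation (\<lambda>\<omega>. \<bar>Z h \<omega>\<bar>) \<le> \<epsilon> * sqrt h"
proof -
  obtain N where N: "(\<Sum>i. (\<beta> (i + N))\<^sup>2) < (\<epsilon> / 2)\<^sup>2"
  proof -
    have "eventually (\<lambda>N. (\<Sum>i. (\<beta> (i + N))\<^sup>2) < (\<epsilon> / 2)\<^sup>2) sequentially"
      by (rule order_tendstoD(2)[OF suminf_exist_split2[OF sq]]) (use \<epsilon> in simp)
    then show ?thesis using that by (auto simp: eventually_sequentially)
  qed
  define B where "B = (\<Sum>i<N. \<bar>\<beta> i\<bar>) + 1"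
  have B: "0 < B" unfolding B_def by (intro add_nonneg_pos sum_nonneg) auto
  define h1 where "h1 = (\<epsilon> / (4 * B))\<^sup>2"
  have h1: "0 < h1" using \<epsilon> B by (simp add: h1_def)
  have main: "integrable M (\<lambda>\<omega>. \<bar>Z h \<omega>\<bar>) \<and> expectation (\<lambda>\<omega>. \<bar>Z h \<omega>\<bar>) \<le> \<epsilon> * sqrt h"
    if h: "0 < h" "h \<le> h1" "h \<le> h0" for h
  proof -
    have [measurable]: "Z h \<in> borel_measurable M" using Z_meas h by auto
    have "sqrt h \<le> sqrt h1" using h by simp
    also have "\<dots> = \<epsilon> / (4 * B)" using \<epsilon> B by (simp add: h1_def)
    finally have "sqrt h * (4 * B) \<le> \<epsilon>" using B by (simp add: field_simps)
    then have "sqrt h * (sqrt h * (4 * B)) \<le> sqrt h * \<epsilon>" using h by (intro mult_left_mono) auto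
    then have hB: "2 * h * B \<le> \<epsilon> * sqrt h / 2"
    proof -
      have "sqrt h * (sqrt h * (4 * B)) = (sqrt h * sqrt h) * (4 * B)" by (simp only: mult.assoc)
      also have "\<dots> = 2 * (2 * h * B)" using h by simp
      finally have "sqrt h * (sqrt h * (4 * B)) = 2 * (2 * h * B)" .
      then have "2 * (2 * h * B) \<le> sqrt h * \<epsilon>"
        using \<open>sqrt h * (sqrt h * (4 * B)) \<le> sqrt h * \<epsilon>\<close> by linarith
      then show ?thesis by (simp add: mult.commute[of \<epsilon>])
    qed
    have E_le: "expectation (\<lambda>\<omega>. \<bar>Y \<beta> {..<n} h \<omega>\<bar>) \<le> \<epsilon> * sqrt h" if n: "N \<le> n" for n
    proof -
      define t where "t = \<epsilon> * sqrt h / 2"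
      have t: "0 < t" using \<epsilon> h by (simp add: t_def)
      have t2: "t\<^sup>2 = h * (\<epsilon> / 2)\<^sup>2" using h by (simp add: t_def power2_eq_square field_simps)
      define J where "J \<omega> = (\<Sum>i<N. \<bar>\<beta> i\<bar> * (of_bool (V i \<omega> \<le> h) + h))" for \<omega>
      have intJ: "integrable M J" unfolding J_def using integrable_V_le by auto
      have EJ: "expectation J \<le> 2 * h * B"
      proof -
        have "expectation J = (\<Sum>i<N. \<bar>\<beta> i\<bar> * (h + h))"
          unfolding J_def using integrable_V_le expectation_V_le[of h] h
          by (simp add: Bochner_Integration.integral_sum prob_space)
        also have "\<dots> = 2 * h * (\<Sum>i<N. \<bar>\<beta> i\<bar>)" by (simp add: sum_distrib_left mult_ac)
        also have "\<dots> \<le> 2 * h * B" using h by (intro mult_left_mono) (auto simp: B_def)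
        finally show ?thesis .
      qed
      have int2: "integrable M (\<lambda>\<omega>. (Y \<beta> {N..<n} h \<omega>)\<^sup>2)"
        by (rule integrable_const_bound[where B="(\<Sum>i\<in>{N..<n}. \<bar>\<beta> i\<bar> * (1 + \<bar>h\<bar>))\<^sup>2"])
          (auto simp: abs_le_square_iff[symmetric] intro!: order_trans[OF abs_Y_le])
      have "(\<Sum>i\<in>{N..<n}. (\<beta> i)\<^sup>2) = (\<Sum>i<n - N. (\<beta> (i + N))\<^sup>2)"
        by (rule sum.reindex_bij_witness[of _ "\<lambda>i. i + N" "\<lambda>i. i - N"]) auto
      also have "\<dots> \<le> (\<Sum>i. (\<beta> (i + N))\<^sup>2)"
        by (intro sum_le_suminf summable_ignore_initial_segment[OF sq]) auto
      finally have "(\<Sum>i\<in>{N..<n}. (\<beta> i)\<^sup>2) \<le> (\<epsilon> / 2)\<^sup>2" using N by simp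
      then have E2: "expectation (\<lambda>\<omega>. (Y \<beta> {N..<n} h \<omega>)\<^sup>2) \<le> t\<^sup>2"
        unfolding t2 using h by (intro order_trans[OF second_moment_Y] mult_left_mono) auto
      have "expectation (\<lambda>\<omega>. \<bar>Y \<beta> {..<n} h \<omega>\<bar>) \<le> expectation (\<lambda>\<omega>. J \<omega> + (t / 2 + (Y \<beta> {N..<n} h \<omega>)\<^sup>2 / (2 * t)))"
      proof (rule integral_mono)
        show "integrable M (\<lambda>\<omega>. \<bar>Y \<beta> {..<n} h \<omega>\<bar>)" using integrable_Y by simp
        show "integrable M (\<lambda>\<omega>. J \<omega> + (t / 2 + (Y \<beta> {N..<n} h \<omega>)\<^sup>2 / (2 * t)))" using intJ int2 by simp
        fix \<omega>
        have "{..<n} = {..<N} \<union> {N..<n}" using n by auto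
        then have "Y \<beta> {..<n} h \<omega> = Y \<beta> {..<N} h \<omega> + Y \<beta> {N..<n} h \<omega>"
          unfolding jump_sum_def by (simp add: sum.union_disjoint ivl_disj_int)
        moreover have "\<bar>Y \<beta> {..<N} h \<omega>\<bar> \<le> J \<omega>"
          unfolding jump_sum_def J_def using h
          by (intro order_trans[OF sum_abs] sum_mono) (auto simp: abs_mult intro!: mult_left_mono)
        moreover have "\<bar>Y \<beta> {N..<n} h \<omega>\<bar> \<le> t / 2 + (Y \<beta> {N..<n} h \<omega>)\<^sup>2 / (2 * t)"
        proof -
          have "0 \<le> (\<bar>Y \<beta> {N..<n} h \<omega>\<bar> - t)\<^sup>2 / (2 * t)" using t by simp
          also have "\<dots> = t / 2 + (Y \<beta> {N..<n} h \<omega>)\<^sup>2 / (2 * t) - \<bar>Y \<beta> {N..<n} h \<omega>\<bar>"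
            unfolding power2_diff using t by (simp add: field_simps power2_eq_square)
          finally show ?thesis by simp
        qed
        ultimately show "\<bar>Y \<beta> {..<n} h \<omega>\<bar> \<le> J \<omega> + (t / 2 + (Y \<beta> {N..<n} h \<omega>)\<^sup>2 / (2 * t))" by linarith
      qed
      also have "\<dots> = expectation J + (t / 2 + expectation (\<lambda>\<omega>. (Y \<beta> {N..<n} h \<omega>)\<^sup>2) / (2 * t))"
        using intJ int2 by (simp add: prob_space)
      also have "\<dots> \<le> \<epsilon> * sqrt h / 2 + (t / 2 + t\<^sup>2 / (2 * t))"
        using EJ hB E2 t by (intro add_mono divide_right_mono) auto
      also have "\<dots> = \<epsilon> * sqrt h" using t by (simp add: power2_eq_square) (simp add: t_def)
      finally show ?thesis .
    qed
    have "(\<integral>\<^sup>+\<omega>. ennreal \<bar>Z h \<omega>\<bar> \<partial>M) = (\<integral>\<^sup>+\<omega>. liminf (\<lambda>n. ennreal \<bar>Y \<beta> {..<n} h \<omega>\<bar>) \<partial>M)"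
    proof (rule nn_integral_cong_AE)
      show "AE \<omega> in M. ennreal \<bar>Z h \<omega>\<bar> = liminf (\<lambda>n. ennreal \<bar>Y \<beta> {..<n} h \<omega>\<bar>)"
        using lim[OF h(1,3)]
      proof eventually_elim
        case (elim \<omega>)
        then have "(\<lambda>n. ennreal \<bar>Y \<beta> {..<n} h \<omega>\<bar>) \<longlonglongrightarrow> ennreal \<bar>Z h \<omega>\<bar>"
          by (intro tendsto_ennrealI tendsto_rabs)
        then show ?case by (intro lim_imp_Liminf[symmetric]) auto
      qed
    qed
    also have "\<dots> \<le> liminf (\<lambda>n. \<integral>\<^sup>+\<omega>. ennreal \<bar>Y \<beta> {..<n} h \<omega>\<bar> \<partial>M)"
      by (rule nn_integral_liminf) simp
    also have "\<dots> \<le> ennreal (\<epsilon> * sqrt h)"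
    proof (rule Liminf_le)
      show "\<forall>\<^sub>F n in sequentially. (\<integral>\<^sup>+\<omega>. ennreal \<bar>Y \<beta> {..<n} h \<omega>\<bar> \<partial>M) \<le> ennreal (\<epsilon> * sqrt h)"
        using eventually_ge_at_top[of N]
      proof eventually_elim
        case (elim n)
        have "(\<integral>\<^sup>+\<omega>. ennreal \<bar>Y \<beta> {..<n} h \<omega>\<bar> \<partial>M) = ennreal (expectation (\<lambda>\<omega>. \<bar>Y \<beta> {..<n} h \<omega>\<bar>))"
          using integrable_Y by (intro nn_integral_eq_integral) auto
        then show ?case using E_le[OF elim] by (simp add: ennreal_leI)
      qed
    qed simp
    finally have nn: "(\<integral>\<^sup>+\<omega>. ennreal \<bar>Z h \<omega>\<bar> \<partial>M) \<le> ennreal (\<epsilon> * sqrt h)" .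
    have int: "integrable M (\<lambda>\<omega>. \<bar>Z h \<omega>\<bar>)"
      by (rule integrableI_bounded) (use nn in \<open>auto intro: le_less_trans\<close>)
    moreover have "ennreal (expectation (\<lambda>\<omega>. \<bar>Z h \<omega>\<bar>)) \<le> ennreal (\<epsilon> * sqrt h)"
      using nn_integral_eq_integral[OF int] nn by simp
    ultimately show ?thesis using \<epsilon> h by (simp add: ennreal_le_iff)
  qed
  then show ?thesis using h1 by blast
qed

lemma increments_unbounded_slope_AE:
  assumes bridge: "bridge_increments M g h0" and \<sigma>: "0 \<le> \<sigma>" and sq: "summable (\<lambda>i. (\<beta> i)\<^sup>2)"
    and inf: "0 < \<sigma> \<or> \<not> summable (\<lambda>i. \<bar>\<beta> i\<bar>)"
    and D_meas: "\<And>h. 0 < h \<Longrightarrow> h \<le> h0 \<Longrightarrow> D h \<in> borel_measurable M"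
    and sums: "\<And>h. 0 < h \<Longrightarrow> h \<le> h0 \<Longrightarrow>
        AE \<omega> in M. (\<lambda>i. \<beta> i * (of_bool (V i \<omega> \<le> h) - h)) sums (D h \<omega> - \<alpha> * h - \<sigma> * g h \<omega>)"
  shows "AE \<omega> in M. \<forall>K \<epsilon>. 0 < \<epsilon> \<longrightarrow> (\<exists>s. 0 < s \<and> s < \<epsilon> \<and> s \<le> h0 \<and> K * s \<le> D s \<omega>)"
proof -
  interpret bridge: bridge_increments M g h0 by (rule bridge)
  have lim: "AE \<omega> in M. (\<lambda>n. Y \<beta> {..<n} h \<omega>) \<longlonglongrightarrow> D h \<omega> - \<alpha> * h - \<sigma> * g h \<omega>" if "0 < h" "h \<le> h0" for h
    using sums[OF that] by (simp add: sums_def jump_sum_def)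
  show ?thesis
  proof (cases "0 < \<sigma>")
    case True
    show ?thesis
    proof (rule bridge.unbounded_slope_AE[OF True D_meas])
      fix \<epsilon> :: real assume \<epsilon>: "0 < \<epsilon>"
      show "\<exists>h1>0. \<forall>h. 0 < h \<longrightarrow> h \<le> h1 \<longrightarrow> h \<le> h0 \<longrightarrow>
        integrable M (\<lambda>\<omega>. \<bar>D h \<omega> - \<alpha> * h - \<sigma> * g h \<omega>\<bar>) \<and>
        expectation (\<lambda>\<omega>. \<bar>D h \<omega> - \<alpha> * h - \<sigma> * g h \<omega>\<bar>) \<le> \<epsilon> * sqrt h"
      proof (rule limit_small_in_mean[OF sq \<epsilon> _ lim])
        fix h assume "0 < h" "h \<le> h0"
        then have [measurable]: "D h \<in> borel_measurable M" "g h \<in> borel_measurable M"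
          using D_meas bridge.g_meas by auto
        show "(\<lambda>\<omega>. D h \<omega> - \<alpha> * h - \<sigma> * g h \<omega>) \<in> borel_measurable M" by measurable
      qed
    qed
  next
    case False
    then have "\<sigma> = 0" "\<not> summable (\<lambda>i. \<bar>\<beta> i\<bar>)" using \<sigma> inf by auto
    then have "AE \<omega> in M. \<forall>K \<epsilon>. 0 < \<epsilon> \<longrightarrow> (\<exists>s. 0 < s \<and> s < \<epsilon> \<and> s \<le> h0 \<and> K * s \<le> D s \<omega> - \<alpha> * s)"
      using limit_unbounded_slope_AE[OF sq _ lim] by simp
    then show ?thesis
    proof eventually_elim
      case (elim \<omega>)
      show ?case
      proof (intro allI impI)
        fix K \<epsilon> :: real assume "0 < \<epsilon>"
        with elim obtain s where "0 < s" "s < \<epsilon>" "s \<le> h0" "(K - \<alpha>) * s \<le> D s \<omega> - \<alpha> * s" by blast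
        then show "\<exists>s. 0 < s \<and> s < \<epsilon> \<and> s \<le> h0 \<and> K * s \<le> D s \<omega>"
          by (intro exI[of _ s]) (simp add: algebra_simps)
      qed
    qed
  qed
qed

lemma increments_oscillation_AE:
  assumes bridge: "bridge_increments M g h0" and \<sigma>: "0 \<le> \<sigma>" and sq: "summable (\<lambda>i. (\<beta> i)\<^sup>2)"
    and inf: "0 < \<sigma> \<or> \<not> summable (\<lambda>i. \<bar>\<beta> i\<bar>)"
    and D_meas: "\<And>h. 0 < h \<Longrightarrow> h \<le> h0 \<Longrightarrow> D h \<in> borel_measurable M"
    and sums: "\<And>h. 0 < h \<Longrightarrow> h \<le> h0 \<Longrightarrow>
        AE \<omega> in M. (\<lambda>i. \<beta> i * (of_bool (V i \<omega> \<le> h) - h)) sums (D h \<omega> - \<alpha> * h - \<sigma> * g h \<omega>)"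
  shows "AE \<omega> in M. \<forall>K \<epsilon>. 0 < \<epsilon> \<longrightarrow>
      (\<exists>s. 0 < s \<and> s < \<epsilon> \<and> s \<le> h0 \<and> K * s \<le> D s \<omega>) \<and>
      (\<exists>s. 0 < s \<and> s < \<epsilon> \<and> s \<le> h0 \<and> D s \<omega> \<le> K * s)"
proof -
  interpret bridge: bridge_increments M g h0 by (rule bridge)
  have neg_bridge: "bridge_increments M (\<lambda>h \<omega>. - g h \<omega>) h0"
  proof
    fix h k a b :: real assume hk: "0 < h" "h \<le> h0" "0 < k" "k \<le> h0"
    show "(\<lambda>\<omega>. - g h \<omega>) \<in> borel_measurable M" using bridge.g_meas[OF hk(1,2)] by simp
    show "\<exists>s\<ge>0. distr M borel (\<lambda>\<omega>. a * - g h \<omega> + b * - g k \<omega>) = normal_law 0 s"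
      using bridge.g_normal[OF hk, of "- a" "- b"] by simp
    show "expectation (\<lambda>\<omega>. - g h \<omega> * - g k \<omega>) = min h k - h * k" using bridge.g_cov[OF hk] by simp
  qed (use h0_pos h0_le_1 in auto)
  have "AE \<omega> in M. \<forall>K \<epsilon>. 0 < \<epsilon> \<longrightarrow> (\<exists>s. 0 < s \<and> s < \<epsilon> \<and> s \<le> h0 \<and> K * s \<le> D s \<omega>)"
    by (rule increments_unbounded_slope_AE[OF bridge \<sigma> sq inf D_meas sums])
  moreover have "AE \<omega> in M. \<forall>K \<epsilon>. 0 < \<epsilon> \<longrightarrow> (\<exists>s. 0 < s \<and> s < \<epsilon> \<and> s \<le> h0 \<and> K * s \<le> - D s \<omega>)"
  proof (rule increments_unbounded_slope_AE[OF neg_bridge \<sigma>, where \<beta>="\<lambda>i. - \<beta> i" and \<alpha>="- \<alpha>"])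
    fix h assume h: "0 < h" "h \<le> h0"
    show "(\<lambda>\<omega>. - D h \<omega>) \<in> borel_measurable M" using D_meas[OF h] by simp
    show "AE \<omega> in M. (\<lambda>i. - \<beta> i * (of_bool (V i \<omega> \<le> h) - h)) sums (- D h \<omega> - - \<alpha> * h - \<sigma> * - g h \<omega>)"
      using sums[OF h] by eventually_elim (drule sums_minus, simp add: algebra_simps)
  qed (use sq inf in auto)
  ultimately show ?thesis
  proof eventually_elim
    case (elim \<omega>)
    show ?case
    proof (intro allI impI conjI)
      fix K \<epsilon> :: real assume \<epsilon>: "0 < \<epsilon>"
      show "\<exists>s. 0 < s \<and> s < \<epsilon> \<and> s \<le> h0 \<and> K * s \<le> D s \<omega>" using elim(1) \<epsilon> by blast
      obtain s where "0 < s" "s < \<epsilon>" "s \<le> h0" "- K * s \<le> - D s \<omega>" using elim(2) \<epsilon> by blast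
      then show "\<exists>s. 0 < s \<and> s < \<epsilon> \<and> s \<le> h0 \<and> D s \<omega> \<le> K * s" by auto
    qed
  qed
qed

end

lemma uniform_arrivals_of_uniform:
  fixes U :: "nat \<Rightarrow> 'a \<Rightarrow> real"
  assumes "prob_space M" and indep: "prob_space.indep_vars M (\<lambda>_. borel) U (UNIV :: nat set)"
    and unif: "\<And>i. distr M borel (U i) = uniform_measure lborel {0<..<1}"
    and [measurable]: "\<phi> \<in> borel_measurable borel" and pos: "\<And>u. 0 < \<phi> u"
    and h0: "0 < h0" "h0 \<le> 1"
    and law: "\<And>s. 0 \<le> s \<Longrightarrow> s \<le> h0 \<Longrightarrow> measure lborel ({0<..<1} \<inter> {u. \<phi> u \<le> s}) = s"
  shows "uniform_arrivals M (\<lambda>i \<omega>. \<phi> (U i \<omega>)) h0"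
proof -
  interpret prob_space M by fact
  have [measurable]: "U i \<in> borel_measurable M" for i
    using indep by (auto simp: indep_vars_def)
  show ?thesis
  proof
    show "indep_vars (\<lambda>_. borel) (\<lambda>i \<omega>. \<phi> (U i \<omega>)) UNIV"
      by (rule indep_vars_compose2[OF indep]) simp
    fix i s assume s: "0 \<le> s" "s \<le> h0"
    have "prob {\<omega> \<in> space M. \<phi> (U i \<omega>) \<le> s} = measure (distr M borel (U i)) {u. \<phi> u \<le> s}"
      by (subst measure_distr) (auto intro!: arg_cong[where f=prob])
    also have "\<dots> = measure lborel ({0<..<1} \<inter> {u. \<phi> u \<le> s})"
    proof -
      have "emeasure lborel {0<..<1::real} = 1" by simp
      moreover from this have "measure lborel {0<..<1::real} = 1" by (simp add: measure_def)
      ultimately show ?thesis unfolding unif by (subst measure_uniform_measure) auto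
    qed
    finally show "prob {\<omega> \<in> space M. \<phi> (U i \<omega>) \<le> s} = s" using law[OF s] by simp
  qed (use pos h0 in auto)
qed

lemma uniform_AE_neq:
  assumes "prob_space M" and [measurable]: "U \<in> borel_measurable M"
    and unif: "distr M borel U = uniform_measure lborel {0<..<1::real}"
  shows "AE \<omega> in M. U \<omega> \<noteq> x"
proof -
  have "AE u in lborel. u \<noteq> x" by (rule AE_lborel_singleton)
  then have "AE u in uniform_measure lborel {0<..<1::real}. u \<noteq> x"
    by (intro AE_uniform_measureI) auto
  then have "AE u in distr M borel U. u \<noteq> x" unfolding unif .
  then show ?thesis by (subst (asm) AE_distr_iff) auto
qed

lemma gaussian_process_square_integrable:
  assumes "prob_space M" and gp: "gaussian_process M I Y" and t: "t \<in> I"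
  shows "integrable M (Y t)" "integrable M (\<lambda>\<omega>. (Y t \<omega>)\<^sup>2)"
proof -
  interpret prob_space M by fact
  have [measurable]: "Y t \<in> borel_measurable M" using gp t by (auto simp: gaussian_process_def)
  obtain m s where s: "0 \<le> s" "distr M borel (Y t) = normal_law m s"
    using gp t unfolding gaussian_process_def
    by (auto dest!: spec[of _ "{t}"] spec[of _ "\<lambda>_. 1"])
  have int: "integrable M (\<lambda>\<omega>. (Y t \<omega> - m) ^ k)" for k
    using normal_law_moments(1)[OF s(1), of m k] unfolding s(2)[symmetric] by (simp add: integrable_distr_eq)
  have "integrable M (\<lambda>\<omega>. (Y t \<omega> - m) + m)"
    using int[of 1] by (intro Bochner_Integration.integrable_add) simp_all
  then show *: "integrable M (Y t)" by simp
  have "integrable M (\<lambda>\<omega>. (Y t \<omega> - m)\<^sup>2 + (2 * m * Y t \<omega> - m\<^sup>2))"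
    using int[of 2] * by simp
  then show "integrable M (\<lambda>\<omega>. (Y t \<omega>)\<^sup>2)"
    by (simp add: power2_eq_square algebra_simps)
qed

text \<open>
  The hypothesis \<open>overlap\<close> says that the intervals from \<open>w h\<close> to \<open>u h\<close> are nested, in the form in which it enters
  the covariance.\<close>

lemma bridge_increments_of_bridge:
  assumes "prob_space M" and bridge: "brownian_bridge M b" and h0: "0 < h0" "h0 \<le> 1"
    and uw: "\<And>h. 0 < h \<Longrightarrow> h \<le> h0 \<Longrightarrow> u h \<in> {0..1} \<and> w h \<in> {0..1} \<and> u h - w h = h"
    and overlap: "\<And>h k. 0 < h \<Longrightarrow> h \<le> h0 \<Longrightarrow> 0 < k \<Longrightarrow> k \<le> h0 \<Longrightarrow>
        min (u h) (u k) - min (u h) (w k) - min (w h) (u k) + min (w h) (w k) = min h k"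
  shows "bridge_increments M (\<lambda>h \<omega>. b (u h) \<omega> - b (w h) \<omega>) h0"
proof -
  interpret prob_space M by fact
  have gp: "gaussian_process M {0..1} b" and mean: "\<And>t. t \<in> {0..1} \<Longrightarrow> expectation (b t) = 0"
    and cov: "\<And>s t. s \<in> {0..1} \<Longrightarrow> t \<in> {0..1} \<Longrightarrow> expectation (\<lambda>\<omega>. b s \<omega> * b t \<omega>) = min s t - s * t"
    using bridge by (auto simp: brownian_bridge_def)
  have b_meas: "b t \<in> borel_measurable M" if "t \<in> {0..1}" for t
    using gp that by (simp add: gaussian_process_def)
  note int = gaussian_process_square_integrable[OF \<open>prob_space M\<close> gp]
  have int_prod: "integrable M (\<lambda>\<omega>. b s \<omega> * b t \<omega>)" if st: "s \<in> {0..1}" "t \<in> {0..1}" for s t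
  proof (rule Bochner_Integration.integrable_bound)
    show "integrable M (\<lambda>\<omega>. (b s \<omega>)\<^sup>2 + (b t \<omega>)\<^sup>2)" using int(2) st by simp
    show "(\<lambda>\<omega>. b s \<omega> * b t \<omega>) \<in> borel_measurable M" using b_meas st by simp
    have "\<bar>x * y\<bar> \<le> x\<^sup>2 + y\<^sup>2" for x y :: real
    proof -
      have "0 \<le> (\<bar>x\<bar> - \<bar>y\<bar>)\<^sup>2" by simp
      then have "2 * \<bar>x * y\<bar> \<le> x\<^sup>2 + y\<^sup>2" unfolding power2_diff by (simp add: abs_mult)
      then show ?thesis using abs_ge_zero[of "x * y"] by linarith
    qed
    then show "AE \<omega> in M. norm (b s \<omega> * b t \<omega>) \<le> norm ((b s \<omega>)\<^sup>2 + (b t \<omega>)\<^sup>2)" by simp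
  qed
  show ?thesis
  proof
    fix h k a c :: real assume h: "0 < h" "h \<le> h0" and k: "0 < k" "k \<le> h0"
    have I: "u h \<in> {0..1}" "w h \<in> {0..1}" "u k \<in> {0..1}" "w k \<in> {0..1}"
      and d: "u h - w h = h" "u k - w k = k"
      using uw[OF h] uw[OF k] by auto
    show "(\<lambda>\<omega>. b (u h) \<omega> - b (w h) \<omega>) \<in> borel_measurable M" using b_meas I by simp
    have "(b (u h) \<omega> - b (w h) \<omega>) * (b (u k) \<omega> - b (w k) \<omega>) =
        b (u h) \<omega> * b (u k) \<omega> - b (u h) \<omega> * b (w k) \<omega> - b (w h) \<omega> * b (u k) \<omega> + b (w h) \<omega> * b (w k) \<omega>" for \<omega>
      by (simp add: algebra_simps)
    then have "expectation (\<lambda>\<omega>. (b (u h) \<omega> - b (w h) \<omega>) * (b (u k) \<omega> - b (w k) \<omega>)) =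
        (min (u h) (u k) - u h * u k) - (min (u h) (w k) - u h * w k)
        - (min (w h) (u k) - w h * u k) + (min (w h) (w k) - w h * w k)"
      using int_prod I cov by simp
    also have "\<dots> = min h k - (u h - w h) * (u k - w k)"
      unfolding overlap[OF h k, symmetric] by (simp add: algebra_simps)
    finally show "expectation (\<lambda>\<omega>. (b (u h) \<omega> - b (w h) \<omega>) * (b (u k) \<omega> - b (w k) \<omega>)) = min h k - h * k"
      unfolding d .
    define T where "T = {u h, w h, u k, w k}"
    define e where "e x = a * (of_bool (x = u h) - of_bool (x = w h)) + c * (of_bool (x = u k) - of_bool (x = w k))" for x
    have T: "finite T" "T \<subseteq> {0..1}" using I by (auto simp: T_def)
    have pick: "(\<Sum>x\<in>T. of_bool (x = y) * f x) = f y" if "y \<in> T" for y and f :: "real \<Rightarrow> real"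
    proof -
      have "(\<Sum>x\<in>T. of_bool (x = y) * f x) = (\<Sum>x\<in>T. if x = y then f x else 0)"
        by (rule sum.cong) auto
      then show ?thesis using that T by (simp add: sum.delta)
    qed
    have lin: "(\<Sum>x\<in>T. e x * b x \<omega>) = a * (b (u h) \<omega> - b (w h) \<omega>) + c * (b (u k) \<omega> - b (w k) \<omega>)" for \<omega>
    proof -
      have "(\<Sum>x\<in>T. e x * b x \<omega>) = (\<Sum>x\<in>T. a * (of_bool (x = u h) * b x \<omega>) - a * (of_bool (x = w h) * b x \<omega>)
          + c * (of_bool (x = u k) * b x \<omega>) - c * (of_bool (x = w k) * b x \<omega>))"
        by (rule sum.cong) (auto simp: e_def algebra_simps)
      also have "\<dots> = a * b (u h) \<omega> - a * b (w h) \<omega> + c * b (u k) \<omega> - c * b (w k) \<omega>"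
        unfolding sum_subtractf sum.distrib sum_distrib_left[symmetric]
        using pick[of _ "\<lambda>x. b x \<omega>"] by (simp add: T_def)
      finally show ?thesis by (simp add: algebra_simps)
    qed
    obtain m s where s: "0 \<le> s" and
      law: "distr M borel (\<lambda>\<omega>. a * (b (u h) \<omega> - b (w h) \<omega>) + c * (b (u k) \<omega> - b (w k) \<omega>)) = normal_law m s"
      using gp T unfolding gaussian_process_def lin[symmetric] by blast
    have Z_meas: "(\<lambda>\<omega>. a * (b (u h) \<omega> - b (w h) \<omega>) + c * (b (u k) \<omega> - b (w k) \<omega>)) \<in> borel_measurable M"
      using b_meas I by simp
    have "0 = expectation (\<lambda>\<omega>. a * (b (u h) \<omega> - b (w h) \<omega>) + c * (b (u k) \<omega> - b (w k) \<omega>) - m)"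
      using normal_law_moments(2)[OF s, of m] unfolding law[symmetric] by (subst (asm) integral_distr) (use Z_meas in auto)
    also have "\<dots> = - m" using int(1) I mean by (simp add: prob_space)
    finally have "m = 0" by simp
    then show "\<exists>s\<ge>0. distr M borel (\<lambda>\<omega>. a * (b (u h) \<omega> - b (w h) \<omega>) + c * (b (u k) \<omega> - b (w k) \<omega>)) = normal_law 0 s"
      using s law by auto
  qed (use h0 in auto)
qed

lemma Limsup_eq_PInfty:
  fixes f :: "'b \<Rightarrow> ereal"
  assumes "\<And>K. \<exists>\<^sub>F x in F. ereal K \<le> f x"
  shows "Limsup F f = \<infinity>"
proof (rule ccontr)
  assume "Limsup F f \<noteq> \<infinity>"
  then have "Limsup F f < \<infinity>" by simp
  then obtain K where "Limsup F f < ereal K" using ereal_dense2 by blast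
  then have "\<forall>\<^sub>F x in F. f x < ereal K" by (rule Limsup_lessD)
  then show False using assms[of K] by (auto simp: frequently_def not_le elim: eventually_mono)
qed

lemma Liminf_eq_MInfty:
  fixes f :: "'b \<Rightarrow> ereal"
  assumes "\<And>K. \<exists>\<^sub>F x in F. f x \<le> ereal K"
  shows "Liminf F f = - \<infinity>"
proof (rule ccontr)
  assume "Liminf F f \<noteq> - \<infinity>"
  then have "- \<infinity> < Liminf F f" by simp
  then obtain K where "ereal K < Liminf F f" using ereal_dense2 by blast
  then have "\<forall>\<^sub>F x in F. ereal K < f x" by (rule less_LiminfD)
  then show False using assms[of K] by (auto simp: frequently_def not_le elim: eventually_mono)
qed

lemma frequently_at_right_0:
  assumes "\<And>\<epsilon>. 0 < \<epsilon> \<Longrightarrow> \<exists>s::real. 0 < s \<and> s < \<epsilon> \<and> P s"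
  shows "\<exists>\<^sub>F s in at_right 0. P s"
  unfolding frequently_def eventually_at_right_field using assms by (meson)

lemma frequently_at_left_0:
  assumes "\<And>\<epsilon>. 0 < \<epsilon> \<Longrightarrow> \<exists>s::real. 0 < s \<and> s < \<epsilon> \<and> P (- s)"
  shows "\<exists>\<^sub>F s in at_left 0. P s"
  unfolding frequently_def eventually_at_left_field
proof (intro notI, elim exE conjE)
  fix b :: real assume b: "b < 0" "\<forall>y>b. y < 0 \<longrightarrow> \<not> P y"
  obtain s where "0 < s" "s < - b" "P (- s)" using assms[of "- b"] b(1) by auto
  then show False using b(2) by auto
qed

lemma frequently_at_right_within:
  assumes "\<exists>\<^sub>F h in at_right 0. P h" and "0 \<le> t" "t < (1::real)"
  shows "\<exists>\<^sub>F h in at 0 within {-t..1-t}. P h"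
proof -
  have "at_right 0 = at 0 within {0<..<1 - t}" using assms by (intro at_within_nhd[of _ "{- 1<..<1 - t}"]) auto
  also have "\<dots> \<le> at 0 within {-t..1-t}" using assms by (intro at_le) auto
  finally show ?thesis using assms(1) unfolding frequently_def le_filter_def by blast
qed

lemma frequently_at_left_within:
  assumes "\<exists>\<^sub>F h in at_left 0. P h" and "0 < t" "t \<le> (1::real)"
  shows "\<exists>\<^sub>F h in at 0 within {-t..1-t}. P h"
proof -
  have "at_left 0 = at 0 within {- t<..<0}" using assms by (intro at_within_nhd[of _ "{- t<..<1}"]) auto
  also have "\<dots> \<le> at 0 within {-t..1-t}" using assms by (intro at_le) auto
  finally show ?thesis using assms(1) unfolding frequently_def le_filter_def by blast
qed

lemma right_oscillation_AE:
  assumes EI: "extremal_EI_process M \<alpha> \<sigma> \<beta> X"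
    and inf: "\<sigma> > 0 \<or> \<not> summable (\<lambda>i. \<bar>\<beta> i\<bar>)" and t: "0 \<le> t" "t < 1"
  shows "AE \<omega> in M. \<forall>K. (\<exists>\<^sub>F h in at_right 0. ereal K \<le> diff_quot (\<lambda>s. X s \<omega>) t h) \<and>
    (\<exists>\<^sub>F h in at_right 0. diff_quot (\<lambda>s. X s \<omega>) t h \<le> ereal K)"
proof -
  from EI obtain U b where "prob_space M" and \<sigma>: "0 \<le> \<sigma>" and sq: "summable (\<lambda>i. (\<beta> i)\<^sup>2)"
    and X_meas: "\<And>t. t \<in> {0..1} \<Longrightarrow> X t \<in> borel_measurable M"
    and indep: "prob_space.indep_vars M (\<lambda>_. borel) U (UNIV :: nat set)"
    and unif: "\<And>i. distr M borel (U i) = uniform_measure lborel {0<..<1}"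
    and bridge: "brownian_bridge M b"
    and sums: "\<And>t. t \<in> {0..1} \<Longrightarrow> AE \<omega> in M. (\<lambda>i. \<beta> i * (of_bool (U i \<omega> \<le> t) - t)) sums (X t \<omega> - \<alpha> * t - \<sigma> * b t \<omega>)"
    unfolding extremal_EI_process_def by blast
  define h0 where "h0 = 1 - t"
  have h0: "0 < h0" "h0 \<le> 1" using t by (auto simp: h0_def)
  \<comment> \<open>arrival times counted from \<open>t\<close>; the value \<open>2\<close> marks arrivals up to \<open>t\<close>\<close>
  define \<phi> where "\<phi> u = (if t < u then u - t else 2)" for u :: real
  interpret uniform_arrivals M "\<lambda>i \<omega>. \<phi> (U i \<omega>)" h0
  proof (rule uniform_arrivals_of_uniform[OF \<open>prob_space M\<close> indep unif])
    show "\<phi> \<in> borel_measurable borel" unfolding \<phi>_def[abs_def] by measurable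
    show "0 < \<phi> u" for u by (simp add: \<phi>_def)
    fix s assume s: "0 \<le> s" "s \<le> h0"
    have "measure lborel ({0<..<1} \<inter> {u. \<phi> u \<le> s}) = measure lborel (if s < h0 then {t<..t + s} else {t<..<1})"
      using t s by (intro arg_cong[where f="measure lborel"]) (auto simp: \<phi>_def h0_def split: if_splits)
    also have "\<dots> = s" using t s by (auto simp: h0_def)
    finally show "measure lborel ({0<..<1} \<inter> {u. \<phi> u \<le> s}) = s" .
  qed (use h0 in auto)
  have br: "bridge_increments M (\<lambda>h \<omega>. b (t + h) \<omega> - b t \<omega>) h0"
    using t by (intro bridge_increments_of_bridge[OF \<open>prob_space M\<close> bridge h0, of "\<lambda>h. t + h" "\<lambda>_. t"])
      (auto simp: h0_def min_def)
  have "AE \<omega> in M. \<forall>K \<epsilon>. 0 < \<epsilon> \<longrightarrow>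
      (\<exists>s. 0 < s \<and> s < \<epsilon> \<and> s \<le> h0 \<and> K * s \<le> X (t + s) \<omega> - X t \<omega>) \<and>
      (\<exists>s. 0 < s \<and> s < \<epsilon> \<and> s \<le> h0 \<and> X (t + s) \<omega> - X t \<omega> \<le> K * s)"
  proof (rule increments_oscillation_AE[OF br \<sigma> sq inf])
    fix h assume h: "0 < h" "h \<le> h0"
    then have I: "t \<in> {0..1}" "t + h \<in> {0..1}" using t by (auto simp: h0_def)
    show "(\<lambda>\<omega>. X (t + h) \<omega> - X t \<omega>) \<in> borel_measurable M" using X_meas I by simp
    show "AE \<omega> in M. (\<lambda>i. \<beta> i * (of_bool (\<phi> (U i \<omega>) \<le> h) - h)) sums
        (X (t + h) \<omega> - X t \<omega> - \<alpha> * h - \<sigma> * (b (t + h) \<omega> - b t \<omega>))"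
      using sums[OF I(1)] sums[OF I(2)]
    proof eventually_elim
      case (elim \<omega>)
      have "\<beta> i * (of_bool (U i \<omega> \<le> t + h) - (t + h)) - \<beta> i * (of_bool (U i \<omega> \<le> t) - t) =
          \<beta> i * (of_bool (\<phi> (U i \<omega>) \<le> h) - h)" for i
        using h t by (auto simp: \<phi>_def h0_def algebra_simps)
      moreover have "X (t + h) \<omega> - \<alpha> * (t + h) - \<sigma> * b (t + h) \<omega> - (X t \<omega> - \<alpha> * t - \<sigma> * b t \<omega>) =
          X (t + h) \<omega> - X t \<omega> - \<alpha> * h - \<sigma> * (b (t + h) \<omega> - b t \<omega>)"
        by (simp add: algebra_simps)
      ultimately show ?case using sums_diff[OF elim(2,1)] by (simp only:)
    qed
  qed
  then show ?thesis
  proof eventually_elim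
    case (elim \<omega>)
    show ?case
    proof (intro allI conjI frequently_at_right_0)
      fix K \<epsilon> :: real assume \<epsilon>: "0 < \<epsilon>"
      from elim[rule_format, OF \<epsilon>, of K] show "\<exists>s. 0 < s \<and> s < \<epsilon> \<and> ereal K \<le> diff_quot (\<lambda>s. X s \<omega>) t s"
        by (auto simp: diff_quot_def pos_le_divide_eq)
      from elim[rule_format, OF \<epsilon>, of K] show "\<exists>s. 0 < s \<and> s < \<epsilon> \<and> diff_quot (\<lambda>s. X s \<omega>) t s \<le> ereal K"
        by (auto simp: diff_quot_def pos_divide_le_eq)
    qed
  qed
qed

text \<open>
  Time reversal turns the half-open intervals of the jump indicators around; the two versions
  differ only when some \<open>U i\<close> equals \<open>t\<close> or \<open>t - h\<close>, which has probability \<open>0\<close>.\<close>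

lemma left_oscillation_AE:
  assumes EI: "extremal_EI_process M \<alpha> \<sigma> \<beta> X"
    and inf: "\<sigma> > 0 \<or> \<not> summable (\<lambda>i. \<bar>\<beta> i\<bar>)" and t: "0 < t" "t \<le> 1"
  shows "AE \<omega> in M. \<forall>K. (\<exists>\<^sub>F h in at_left 0. ereal K \<le> diff_quot (\<lambda>s. X s \<omega>) t h) \<and>
    (\<exists>\<^sub>F h in at_left 0. diff_quot (\<lambda>s. X s \<omega>) t h \<le> ereal K)"
proof -
  from EI obtain U b where "prob_space M" and \<sigma>: "0 \<le> \<sigma>" and sq: "summable (\<lambda>i. (\<beta> i)\<^sup>2)"
    and X_meas: "\<And>t. t \<in> {0..1} \<Longrightarrow> X t \<in> borel_measurable M"
    and indep: "prob_space.indep_vars M (\<lambda>_. borel) U (UNIV :: nat set)"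
    and unif: "\<And>i. distr M borel (U i) = uniform_measure lborel {0<..<1}"
    and bridge: "brownian_bridge M b"
    and sums: "\<And>t. t \<in> {0..1} \<Longrightarrow> AE \<omega> in M. (\<lambda>i. \<beta> i * (of_bool (U i \<omega> \<le> t) - t)) sums (X t \<omega> - \<alpha> * t - \<sigma> * b t \<omega>)"
    unfolding extremal_EI_process_def by blast
  have h0: "0 < t" "t \<le> 1" using t by auto
  \<comment> \<open>arrival times counted backwards from \<open>t\<close>; the value \<open>2\<close> marks arrivals from \<open>t\<close> on\<close>
  define \<phi> where "\<phi> u = (if u < t then t - u else 2)" for u :: real
  interpret uniform_arrivals M "\<lambda>i \<omega>. \<phi> (U i \<omega>)" t
  proof (rule uniform_arrivals_of_uniform[OF \<open>prob_space M\<close> indep unif])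
    show "\<phi> \<in> borel_measurable borel" unfolding \<phi>_def[abs_def] by measurable
    show "0 < \<phi> u" for u by (simp add: \<phi>_def)
    fix s assume s: "0 \<le> s" "s \<le> t"
    have "measure lborel ({0<..<1} \<inter> {u. \<phi> u \<le> s}) = measure lborel (if s < t then {t - s..<t} else {0<..<t})"
      using t s by (intro arg_cong[where f="measure lborel"]) (auto simp: \<phi>_def split: if_splits)
    also have "\<dots> = s" using t s by auto
    finally show "measure lborel ({0<..<1} \<inter> {u. \<phi> u \<le> s}) = s" .
  qed (use h0 in auto)
  have br: "bridge_increments M (\<lambda>h \<omega>. b t \<omega> - b (t - h) \<omega>) t"
    using t by (intro bridge_increments_of_bridge[OF \<open>prob_space M\<close> bridge h0, of "\<lambda>_. t" "\<lambda>h. t - h"])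
      (auto simp: min_def)
  have neq: "AE \<omega> in M. \<forall>i. U i \<omega> \<noteq> x" for x
    unfolding AE_all_countable
    using indep unif by (intro allI uniform_AE_neq[OF \<open>prob_space M\<close>]) (auto simp: indep_vars_def)
  have "AE \<omega> in M. \<forall>K \<epsilon>. 0 < \<epsilon> \<longrightarrow>
      (\<exists>s. 0 < s \<and> s < \<epsilon> \<and> s \<le> t \<and> K * s \<le> X t \<omega> - X (t - s) \<omega>) \<and>
      (\<exists>s. 0 < s \<and> s < \<epsilon> \<and> s \<le> t \<and> X t \<omega> - X (t - s) \<omega> \<le> K * s)"
  proof (rule increments_oscillation_AE[OF br \<sigma> sq inf])
    fix h assume h: "0 < h" "h \<le> t"
    then have I: "t \<in> {0..1}" "t - h \<in> {0..1}" using t by auto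
    show "(\<lambda>\<omega>. X t \<omega> - X (t - h) \<omega>) \<in> borel_measurable M" using X_meas I by simp
    show "AE \<omega> in M. (\<lambda>i. \<beta> i * (of_bool (\<phi> (U i \<omega>) \<le> h) - h)) sums
        (X t \<omega> - X (t - h) \<omega> - \<alpha> * h - \<sigma> * (b t \<omega> - b (t - h) \<omega>))"
      using sums[OF I(1)] sums[OF I(2)] neq[of t] neq[of "t - h"]
    proof eventually_elim
      case (elim \<omega>)
      have "\<beta> i * (of_bool (U i \<omega> \<le> t) - t) - \<beta> i * (of_bool (U i \<omega> \<le> t - h) - (t - h)) =
          \<beta> i * (of_bool (\<phi> (U i \<omega>) \<le> h) - h)" for i
        using h t elim(3)[rule_format, of i] elim(4)[rule_format, of i] by (auto simp: \<phi>_def algebra_simps)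
      moreover have "X t \<omega> - \<alpha> * t - \<sigma> * b t \<omega> - (X (t - h) \<omega> - \<alpha> * (t - h) - \<sigma> * b (t - h) \<omega>) =
          X t \<omega> - X (t - h) \<omega> - \<alpha> * h - \<sigma> * (b t \<omega> - b (t - h) \<omega>)"
        by (simp add: algebra_simps)
      ultimately show ?case using sums_diff[OF elim(1,2)] by (simp only:)
    qed
  qed
  then show ?thesis
  proof eventually_elim
    case (elim \<omega>)
    have quot: "diff_quot (\<lambda>s. X s \<omega>) t (- s) = ereal ((X t \<omega> - X (t - s) \<omega>) / s)" for s
      by (simp add: diff_quot_def minus_divide_left[symmetric] minus_divide_right diff_divide_distrib)
    show ?case
    proof (intro allI conjI frequently_at_left_0)
      fix K \<epsilon> :: real assume \<epsilon>: "0 < \<epsilon>"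
      from elim[rule_format, OF \<epsilon>, of K] show "\<exists>s. 0 < s \<and> s < \<epsilon> \<and> ereal K \<le> diff_quot (\<lambda>s. X s \<omega>) t (- s)"
        by (auto simp: quot pos_le_divide_eq)
      from elim[rule_format, OF \<epsilon>, of K] show "\<exists>s. 0 < s \<and> s < \<epsilon> \<and> diff_quot (\<lambda>s. X s \<omega>) t (- s) \<le> ereal K"
        by (auto simp: quot pos_divide_le_eq)
    qed
  qed
qed

theorem theorem1:
  fixes M :: "'a measure" and X :: "real \<Rightarrow> 'a \<Rightarrow> real"
    and \<alpha> \<sigma> t :: real and \<beta> :: "nat \<Rightarrow> real"
  assumes "extremal_EI_process M \<alpha> \<sigma> \<beta> X"
    and "\<sigma> > 0 \<or> \<not> summable (\<lambda>i. \<bar>\<beta> i\<bar>)"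
    and "t \<in> {0..1}"
  shows "AE \<omega> in M.
      (Limsup (at 0 within {-t..1-t}) (diff_quot (\<lambda>s. X s \<omega>) t) = \<infinity> \<and>
       Liminf (at 0 within {-t..1-t}) (diff_quot (\<lambda>s. X s \<omega>) t) = -\<infinity>) \<and>
      (t < 1 \<longrightarrow>
       Limsup (at_right 0) (diff_quot (\<lambda>s. X s \<omega>) t) = \<infinity> \<and>
       Liminf (at_right 0) (diff_quot (\<lambda>s. X s \<omega>) t) = -\<infinity>) \<and>
      (t > 0 \<longrightarrow>
       Limsup (at_left 0) (diff_quot (\<lambda>s. X s \<omega>) t) = \<infinity> \<and>
       Liminf (at_left 0) (diff_quot (\<lambda>s. X s \<omega>) t) = -\<infinity>)"
proof -
  let ?osc = "\<lambda>F \<omega>. \<forall>K. (\<exists>\<^sub>F h in F. ereal K \<le> diff_quot (\<lambda>s. X s \<omega>) t h) \<and>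
    (\<exists>\<^sub>F h in F. diff_quot (\<lambda>s. X s \<omega>) t h \<le> ereal K)"
  have right: "AE \<omega> in M. t < 1 \<longrightarrow> ?osc (at_right 0) \<omega>"
    using right_oscillation_AE[OF assms(1,2), of t] assms(3) by (cases "t < 1") auto
  have left: "AE \<omega> in M. t > 0 \<longrightarrow> ?osc (at_left 0) \<omega>"
    using left_oscillation_AE[OF assms(1,2), of t] assms(3) by (cases "t > 0") auto
  from right left show ?thesis
  proof eventually_elim
    case (elim \<omega>)
    have "?osc (at 0 within {-t..1-t}) \<omega>"
    proof (cases "t < 1")
      case True
      then show ?thesis using elim(1) assms(3) by (intro allI conjI frequently_at_right_within) auto
    next
      case False
      then show ?thesis using elim(2) assms(3) by (intro allI conjI frequently_at_left_within) auto
    qed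
    then show ?case
      using elim by (intro conjI impI Limsup_eq_PInfty Liminf_eq_MInfty) blast+
  qed
qed

end
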